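(* Let $K\subset\mathbb R^3$ be a knot for which the augmentation polynomial $\mathrm{Aug}_K(\lambda,\mu)$ and the stable $A$-polynomial $\widetilde A_K(\lambda,\mu)$ are defined (that is, the maximal-dimensional parts of the Zariski closures of $V_K$ and of $U_K$ are complex curves). Then, up to a sign, $$\mathrm{Aug}_K(\lambda,\mu)=(1-\mu)\,\widetilde A_K(\lambda,\mu).$$
   Context: $K$ is an oriented knot with tubular neighborhood $n(K)$; $\pi_K=\pi_1(\overline{\mathbb R^3\setminus n(K)})$ based at a point $x\in\partial n(K)$; $m\in\pi_K$ is the meridian given by the oriented boundary of the meridian disk of $n(K)$ through $x$, and $\ell\in\pi_K$ is the preferred (Seifert-framed) longitude, so $m\ell=\ell m$. Let $R_0=\mathbb Z[\lambda^{\pm1},\mu^{\pm1}]$. Cord algebra: $\mathcal C_K$ (identified with its standard description in terms of $\pi_K$) is the noncommutative unital $R_0$-algebra generated by symbols $[\gamma]$, $\gamma\in\pi_K$, modulo: (1) $[e]=1-\mu$; (2) $[m\gamma]=[\gamma m]=\mu[\gamma]$ and $[\ell\gamma]=[\gamma\ell]=\lambda[\gamma]$; (3) $[\gamma_1\gamma_2]-[\gamma_1m\gamma_2]=[\gamma_1][\gamma_2]$. An augmentation is a unital ring homomorphism $\epsilon:\mathcal C_K\to\mathbb C$. KCH irrep: an irreducible homomorphism $\rho:\pi_K\to\mathrm{GL}(V)$, $V$ a finite-dimensional complex vector space, such that $\rho(m)$ is diagonalizable with eigenvalue $1$ of multiplicity exactly $\dim V-1$. Let $\mu_0\ne1$ be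 the other eigenvalue; an eigenvector for $\mu_0$ is also an eigenvector of $\rho(\ell)$, with eigenvalue denoted $\lambda_0$. Define in $(\mathbb C^* )^2$: $U_K=\{(\lambda_0,\mu_0)\mid\rho:\pi_K\to\mathrm{GL}(V)\text{ is a KCH irrep}\}$ (no restriction on $\dim V$), and $V_K=\{(\epsilon(\lambda),\epsilon(\mu))\mid\epsilon:\mathcal C_K\to\mathbb C\text{ an augmentation}\}\setminus(\mathbb C^*\times\{1\})$. If the maximal-dimensional part of the Zariski closure of $U_K$ (resp. $V_K$) is a complex curve, there is a polynomial in $\mathbb Z[\lambda,\mu]$ whose zero locus is that curve, unique up to sign once repeated factors and extraneous powers of $\lambda,\mu$ are removed and coefficients are made coprime. The polynomial for $U_K$ is the stable $A$-polynomial $\widetilde A_K(\lambda,\mu)$. The polynomial for $V_K$, multiplied by $1-\mu$, is the (2-variable) augmentation polynomial $\mathrm{Aug}_K(\lambda,\mu)$. *)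

theory Defs
  imports
    "HOL-Analysis.Cross3"
    "HOL-Homology.Homology"
    "HOL-Library.Poly_Mapping"
    "HOL-Library.Extended_Nat"
    "HOL-Computational_Algebra.Squarefree"
    "HOL-Algebra.QuotRing"
    "Jordan_Normal_Form.Char_Poly"
    "Jordan_Normal_Form.VS_Connect"
begin

section \<open>Oriented knots and Seifert-framed tubular neighborhoods\<close>

text \<open>Being \<open>C\<^sup>\<infinity>\<close> on an open set: \<open>D [v\<^sub>k, \<dots>, v\<^sub>1]\<close> is the iterated directional derivative of
  \<open>f\<close> in the directions \<open>v\<^sub>1, \<dots>, v\<^sub>k\<close>, and each of these is again totally differentiable.\<close>

definition smooth_on :: "'a::real_normed_vector set \<Rightarrow> ('a \<Rightarrow> 'b::real_normed_vector) \<Rightarrow> bool" where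
  "smooth_on S f \<longleftrightarrow>
     (\<exists>D :: 'a list \<Rightarrow> 'a \<Rightarrow> 'b. D [] = f \<and>
        (\<forall>vs. \<forall>x\<in>S. (D vs has_derivative (\<lambda>v. D (v # vs) x)) (at x)))"

text \<open>An oriented knot is given by a smooth, regular, injective \<open>1\<close>-periodic parametrization;
  the orientation is the direction of increasing parameter.\<close>

definition knot :: "(real \<Rightarrow> real^3) \<Rightarrow> bool" where
  "knot k \<longleftrightarrow>
     smooth_on UNIV k \<and> (\<forall>t. k (t + 1) = k t) \<and> inj_on k {0..<1} \<and>
     (\<forall>t. vector_derivative k (at t) \<noteq> 0)"

text \<open>A tubular neighborhood \<open>n(K)\<close> is the image of the closed solid torus under a smooth embedding
  which extends to a slightly thicker open solid torus (so that its boundary is a smooth torus).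
  The first coordinate, taken modulo \<open>1\<close>, runs along \<open>K\<close>, and the images of
  \<open>{t} \<times> cball 0 1\<close> are the meridian disks. The sign condition says that the
  parametrization preserves orientation, i.e. that \<open>K\<close> meets each meridian disk, oriented as the
  unit disk in \<open>\<complex>\<close>, positively.\<close>

definition tubular_param :: "(real \<Rightarrow> real^3) \<Rightarrow> (real \<times> complex \<Rightarrow> real^3) \<Rightarrow> bool" where
  "tubular_param k \<tau> \<longleftrightarrow>
     (\<exists>r>1. smooth_on (UNIV \<times> ball 0 r) \<tau> \<and>
            (\<forall>t. \<forall>z\<in>ball 0 r. \<tau> (t + 1, z) = \<tau> (t, z)) \<and>
            inj_on \<tau> ({0..<1} \<times> ball 0 r) \<and>
            (\<forall>p \<in> UNIV \<times> ball 0 r.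
               let D = frechet_derivative \<tau> (at p)
               in inner (cross3 (D (0, 1)) (D (0, \<i>))) (D (1, 0)) > 0)) \<and>
     (\<forall>t. \<tau> (t, 0) = k t)"

definition tube :: "(real \<times> complex \<Rightarrow> real^3) \<Rightarrow> (real^3) set" where
  "tube \<tau> = \<tau> ` (UNIV \<times> cball 0 1)"

definition exterior :: "(real \<times> complex \<Rightarrow> real^3) \<Rightarrow> (real^3) set" where
  "exterior \<tau> = closure (- tube \<tau>)"

definition base_point :: "(real \<times> complex \<Rightarrow> real^3) \<Rightarrow> real^3" where
  "base_point \<tau> = \<tau> (0, 1)"

definition meridian_loop :: "(real \<times> complex \<Rightarrow> real^3) \<Rightarrow> real \<Rightarrow> real^3" where
  "meridian_loop \<tau> s = \<tau> (0, cis (2 * pi * s))"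

definition longitude_loop :: "(real \<times> complex \<Rightarrow> real^3) \<Rightarrow> real \<Rightarrow> real^3" where
  "longitude_loop \<tau> s = \<tau> (s, 1)"

text \<open>A path viewed as a singular 1-chain; the standard 1-simplex consists of the points
  \<open>(x\<^sub>0, x\<^sub>1)\<close> with \<open>x\<^sub>0 + x\<^sub>1 = 1\<close>.\<close>

definition path_chain :: "(real \<Rightarrow> 'a) \<Rightarrow> 'a chain" where
  "path_chain g = frag_of (restrict (\<lambda>x. g (x 1)) (standard_simplex 1))"

text \<open>The preferred (Seifert) longitude is the one that is null-homologous in the exterior.\<close>

definition seifert_framed :: "(real \<times> complex \<Rightarrow> real^3) \<Rightarrow> bool" where
  "seifert_framed \<tau> \<longleftrightarrow>
     singular_relboundary 1 (top_of_set (exterior \<tau>)) {} (path_chain (longitude_loop \<tau>))"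


section \<open>The knot group\<close>

definition loops :: "'a::topological_space set \<Rightarrow> 'a \<Rightarrow> (real \<Rightarrow> 'a) set" where
  "loops S x = {p. path p \<and> path_image p \<subseteq> S \<and> pathstart p = x \<and> pathfinish p = x}"

definition homotopy_class ::
    "'a::topological_space set \<Rightarrow> (real \<Rightarrow> 'a) \<Rightarrow> (real \<Rightarrow> 'a) set" where
  "homotopy_class S p = {q. homotopic_paths S p q}"

definition fundamental_group ::
    "'a::topological_space set \<Rightarrow> 'a \<Rightarrow> (real \<Rightarrow> 'a) set monoid" where
  "fundamental_group S x =
     \<lparr>carrier = homotopy_class S ` loops S x,
      monoid.mult = (\<lambda>A B. \<Union>p\<in>A. \<Union>q\<in>B. homotopy_class S (p +++ q)),
      one = homotopy_class S (\<lambda>_. x)\<rparr>"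

definition knot_group :: "(real \<times> complex \<Rightarrow> real^3) \<Rightarrow> (real \<Rightarrow> real^3) set monoid" where
  "knot_group \<tau> = fundamental_group (exterior \<tau>) (base_point \<tau>)"

definition meridian :: "(real \<times> complex \<Rightarrow> real^3) \<Rightarrow> (real \<Rightarrow> real^3) set" where
  "meridian \<tau> = homotopy_class (exterior \<tau>) (meridian_loop \<tau>)"

definition longitude :: "(real \<times> complex \<Rightarrow> real^3) \<Rightarrow> (real \<Rightarrow> real^3) set" where
  "longitude \<tau> = homotopy_class (exterior \<tau>) (longitude_loop \<tau>)"

lemma homotopy_class_cong:
  assumes "homotopic_paths S p q"
  shows "homotopy_class S p = homotopy_class S q"
proof -
  have "homotopic_paths S p r \<longleftrightarrow> homotopic_paths S q r" for r
    using assms homotopic_paths_sym homotopic_paths_trans by blast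
  then show ?thesis
    by (simp add: homotopy_class_def)
qed

lemma fundamental_group_mult:
  assumes "p \<in> loops S x" "q \<in> loops S x"
  shows "homotopy_class S p \<otimes>\<^bsub>fundamental_group S x\<^esub> homotopy_class S q
           = homotopy_class S (p +++ q)"
proof -
  have pq: "pathfinish p = pathstart q" and refl: "homotopic_paths S p p" "homotopic_paths S q q"
    using assms by (simp_all add: loops_def)
  have eq: "homotopy_class S (p' +++ q') = homotopy_class S (p +++ q)"
    if "p' \<in> homotopy_class S p" "q' \<in> homotopy_class S q" for p' q'
  proof -
    have "homotopic_paths S p p'" "homotopic_paths S q q'"
      using that by (simp_all add: homotopy_class_def)
    then have "homotopic_paths S (p +++ q) (p' +++ q')"
      using pq by (rule homotopic_paths_join)
    then show ?thesis
      by (rule homotopy_class_cong [symmetric])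
  qed
  have mem: "p \<in> homotopy_class S p" "q \<in> homotopy_class S q"
    using refl by (simp_all add: homotopy_class_def)
  have "(\<Union>p'\<in>homotopy_class S p. \<Union>q'\<in>homotopy_class S q. homotopy_class S (p' +++ q'))
          = (\<Union>p'\<in>homotopy_class S p. \<Union>q'\<in>homotopy_class S q. homotopy_class S (p +++ q))"
    using eq by (intro SUP_cong refl) simp_all
  also have "\<dots> = homotopy_class S (p +++ q)"
    using mem by blast
  finally show ?thesis
    by (simp add: fundamental_group_def)
qed

lemma group_fundamental_group:
  fixes x :: "'a::real_normed_vector"
  assumes "x \<in> S"
  shows "group (fundamental_group S x)"
proof -
  let ?G = "fundamental_group S x" and ?c = "homotopy_class S"
  have car: "carrier ?G = ?c ` loops S x" and one: "\<one>\<^bsub>?G\<^esub> = ?c (linepath x x)"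
    by (simp_all add: fundamental_group_def linepath_refl)
  have L: "linepath x x \<in> loops S x"
    using assms by (simp add: loops_def)
  have J: "p +++ q \<in> loops S x" if "p \<in> loops S x" "q \<in> loops S x" for p q
    using that by (simp add: loops_def path_image_join)
  have R: "reversepath p \<in> loops S x" if "p \<in> loops S x" for p
    using that by (simp add: loops_def)
  show ?thesis
  proof (rule groupI)
    fix a b assume "a \<in> carrier ?G" "b \<in> carrier ?G"
    then obtain p q where "p \<in> loops S x" "q \<in> loops S x" "a = ?c p" "b = ?c q"
      unfolding car by blast
    then show "a \<otimes>\<^bsub>?G\<^esub> b \<in> carrier ?G"
      by (simp add: car fundamental_group_mult J)
  next
    show "\<one>\<^bsub>?G\<^esub> \<in> carrier ?G"
      using L by (simp add: car one)
  next
    fix a b c assume "a \<in> carrier ?G" "b \<in> carrier ?G" "c \<in> carrier ?G"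
    then obtain p q r where *: "p \<in> loops S x" "q \<in> loops S x" "r \<in> loops S x"
      "a = ?c p" "b = ?c q" "c = ?c r"
      unfolding car by blast
    have "homotopic_paths S (p +++ (q +++ r)) ((p +++ q) +++ r)"
      by (rule homotopic_paths_assoc) (use * in \<open>simp_all add: loops_def\<close>)
    then have "?c (p +++ (q +++ r)) = ?c ((p +++ q) +++ r)"
      by (rule homotopy_class_cong)
    then show "a \<otimes>\<^bsub>?G\<^esub> b \<otimes>\<^bsub>?G\<^esub> c = a \<otimes>\<^bsub>?G\<^esub> (b \<otimes>\<^bsub>?G\<^esub> c)"
      using * J by (simp add: fundamental_group_mult)
  next
    fix a assume "a \<in> carrier ?G"
    then obtain p where p: "p \<in> loops S x" "a = ?c p"
      unfolding car by blast
    then have *: "path p" "path_image p \<subseteq> S" "pathstart p = x" "pathfinish p = x"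
      by (simp_all add: loops_def)
    have "?c (linepath x x +++ p) = ?c p"
      using homotopic_paths_lid[of p S] * by (intro homotopy_class_cong) simp
    then show "\<one>\<^bsub>?G\<^esub> \<otimes>\<^bsub>?G\<^esub> a = a"
      using p L by (simp add: one fundamental_group_mult)
    have "?c (reversepath p +++ p) = ?c (linepath x x)"
      using homotopic_paths_linv[of p S] * by (intro homotopy_class_cong) simp
    then have "?c (reversepath p) \<otimes>\<^bsub>?G\<^esub> a = \<one>\<^bsub>?G\<^esub>"
      using p R by (simp add: one fundamental_group_mult)
    moreover have "?c (reversepath p) \<in> carrier ?G"
      using p R by (simp add: car)
    ultimately show "\<exists>b\<in>carrier ?G. b \<otimes>\<^bsub>?G\<^esub> a = \<one>\<^bsub>?G\<^esub>"
      by blast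
  qed
qed


section \<open>KCH irreps\<close>

text \<open>Representations of dimension \<open>n\<close> are homomorphisms into the unit group of the ring of
  complex \<open>n \<times> n\<close> matrices.\<close>

definition GL :: "nat \<Rightarrow> complex mat monoid" where
  "GL n = units_of (ring_mat TYPE(complex) n ())"

definition irreducible_rep :: "'g monoid \<Rightarrow> nat \<Rightarrow> ('g \<Rightarrow> complex mat) \<Rightarrow> bool" where
  "irreducible_rep G n \<rho> \<longleftrightarrow>
     n > 0 \<and> \<rho> \<in> hom G (GL n) \<and>
     (\<forall>W. VectorSpace.subspace class_ring W (module_vec TYPE(complex) n) \<and>
          (\<forall>g\<in>carrier G. \<forall>w\<in>W. \<rho> g *\<^sub>v w \<in> W)
          \<longrightarrow> W = {0\<^sub>v n} \<or> W = carrier_vec n)"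

definition diagonalizable :: "complex mat \<Rightarrow> bool" where
  "diagonalizable M \<longleftrightarrow> (\<exists>D. similar_mat M D \<and> diagonal_mat D)"

definition KCH_irrep :: "'g monoid \<Rightarrow> 'g \<Rightarrow> nat \<Rightarrow> ('g \<Rightarrow> complex mat) \<Rightarrow> bool" where
  "KCH_irrep G m n \<rho> \<longleftrightarrow>
     irreducible_rep G n \<rho> \<and> diagonalizable (\<rho> m) \<and>
     Polynomial.order 1 (char_poly (\<rho> m)) = n - 1"

definition KCH_points :: "'g monoid \<Rightarrow> 'g \<Rightarrow> 'g \<Rightarrow> (complex \<times> complex) set" where
  "KCH_points G m l =
     {(l0, m0). \<exists>n \<rho> v. KCH_irrep G m n \<rho> \<and> m0 \<noteq> 1 \<and>
        eigenvector (\<rho> m) v m0 \<and> eigenvector (\<rho> l) v l0}"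


section \<open>The cord algebra and augmentations\<close>

text \<open>The free monoid on \<open>'g\<close>, written additively so that \<open>'g word \<Rightarrow>\<^sub>0 R\<close> is its monoid algebra,
  i.e. the free noncommutative \<open>R\<close>-algebra on \<open>'g\<close>.\<close>

datatype 'g word = Word (letters: "'g list")

instantiation word :: (type) monoid_add
begin

definition zero_word :: "'a word" where "0 = Word []"

definition plus_word :: "'a word \<Rightarrow> 'a word \<Rightarrow> 'a word" where
  "v + w = Word (letters v @ letters w)"

instance
  by standard (auto simp: zero_word_def plus_word_def)

end

text \<open>\<open>\<int>[\<lambda>\<^sup>\<plusminus>\<^sup>1, \<mu>\<^sup>\<plusminus>\<^sup>1]\<close> as the group algebra of \<open>\<int> \<times> \<int>\<close>.\<close>

type_synonym laurent = "int \<times> int \<Rightarrow>\<^sub>0 int"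

definition laurent_lam :: laurent where "laurent_lam = Poly_Mapping.single (1, 0) 1"
definition laurent_mu :: laurent where "laurent_mu = Poly_Mapping.single (0, 1) 1"

type_synonym 'g free_alg = "'g word \<Rightarrow>\<^sub>0 laurent"

definition scalar :: "laurent \<Rightarrow> 'g free_alg" where
  "scalar c = Poly_Mapping.single 0 c"

definition cord :: "'g \<Rightarrow> 'g free_alg" where
  "cord g = Poly_Mapping.single (Word [g]) 1"

definition free_algebra :: "'g set \<Rightarrow> 'g free_alg ring" where
  "free_algebra S =
     \<lparr>carrier = {f. \<forall>w\<in>Poly_Mapping.keys f. set (letters w) \<subseteq> S},
      monoid.mult = (*), one = 1, zero = 0, add = (+)\<rparr>"

definition cord_relators :: "'g monoid \<Rightarrow> 'g \<Rightarrow> 'g \<Rightarrow> 'g free_alg set" where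
  "cord_relators G m l =
     {cord \<one>\<^bsub>G\<^esub> - (1 - scalar laurent_mu)} \<union>
     (\<Union>g\<in>carrier G.
        {cord (m \<otimes>\<^bsub>G\<^esub> g) - scalar laurent_mu * cord g,
         cord (g \<otimes>\<^bsub>G\<^esub> m) - scalar laurent_mu * cord g,
         cord (l \<otimes>\<^bsub>G\<^esub> g) - scalar laurent_lam * cord g,
         cord (g \<otimes>\<^bsub>G\<^esub> l) - scalar laurent_lam * cord g}) \<union>
     (\<Union>g\<in>carrier G. \<Union>h\<in>carrier G.
        {cord (g \<otimes>\<^bsub>G\<^esub> h) - cord (g \<otimes>\<^bsub>G\<^esub> m \<otimes>\<^bsub>G\<^esub> h) - cord g * cord h})"

definition cord_ideal :: "'g monoid \<Rightarrow> 'g \<Rightarrow> 'g \<Rightarrow> 'g free_alg set" where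
  "cord_ideal G m l = Idl\<^bsub>free_algebra (carrier G)\<^esub> (cord_relators G m l)"

definition cord_algebra :: "'g monoid \<Rightarrow> 'g \<Rightarrow> 'g \<Rightarrow> 'g free_alg set ring" where
  "cord_algebra G m l = free_algebra (carrier G) Quot cord_ideal G m l"

definition cord_scalar :: "'g monoid \<Rightarrow> 'g \<Rightarrow> 'g \<Rightarrow> laurent \<Rightarrow> 'g free_alg set" where
  "cord_scalar G m l c = cord_ideal G m l +>\<^bsub>free_algebra (carrier G)\<^esub> scalar c"

definition augmentations :: "'g monoid \<Rightarrow> 'g \<Rightarrow> 'g \<Rightarrow> ('g free_alg set \<Rightarrow> complex) set" where
  "augmentations G m l = Ring.ring_hom (cord_algebra G m l) class_ring"

definition augmentation_points :: "'g monoid \<Rightarrow> 'g \<Rightarrow> 'g \<Rightarrow> (complex \<times> complex) set" where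
  "augmentation_points G m l =
     {(\<epsilon> (cord_scalar G m l laurent_lam), \<epsilon> (cord_scalar G m l laurent_mu)) | \<epsilon>.
        \<epsilon> \<in> augmentations G m l} - (- {0}) \<times> {1}"

lemma ring_free_algebra: "ring (free_algebra S)"
proof -
  define C where "C = {f :: 'a free_alg. \<forall>w\<in>Poly_Mapping.keys f. set (letters w) \<subseteq> S}"
  have mult: "f * g \<in> C" if fg: "f \<in> C" "g \<in> C" for f g
    unfolding C_def
  proof (rule CollectI, rule ballI)
    fix w assume "w \<in> Poly_Mapping.keys (f * g)"
    then obtain u v where "w = u + v" "u \<in> Poly_Mapping.keys f" "v \<in> Poly_Mapping.keys g"
      using keys_mult by blast
    then show "set (letters w) \<subseteq> S"
      using fg by (simp add: C_def plus_word_def)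
  qed
  have add: "f + g \<in> C" if "f \<in> C" "g \<in> C" for f g
    using that Poly_Mapping.keys_add[of f g] unfolding C_def by blast
  have neg: "- f \<in> C" if "f \<in> C" for f
    using that by (simp add: C_def)
  have one: "1 \<in> C"
    by (simp add: C_def zero_word_def)
  have zero: "0 \<in> C"
    by (simp add: C_def)
  let ?R = "\<lparr>carrier = C, monoid.mult = (*), one = 1, zero = 0, add = (+)\<rparr>"
  have "abelian_group ?R"
  proof (rule abelian_groupI)
    fix f g h assume "f \<in> carrier ?R" "g \<in> carrier ?R" "h \<in> carrier ?R"
    then have f: "f \<in> C" and g: "g \<in> C"
      by simp_all
    show "f \<oplus>\<^bsub>?R\<^esub> g \<in> carrier ?R"
      using add[OF f g] by simp
    show "f \<oplus>\<^bsub>?R\<^esub> g \<oplus>\<^bsub>?R\<^esub> h = f \<oplus>\<^bsub>?R\<^esub> (g \<oplus>\<^bsub>?R\<^esub> h)"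
      by (simp add: add.assoc)
    show "f \<oplus>\<^bsub>?R\<^esub> g = g \<oplus>\<^bsub>?R\<^esub> f"
      by (simp add: add.commute)
    show "\<zero>\<^bsub>?R\<^esub> \<oplus>\<^bsub>?R\<^esub> f = f"
      by simp
    show "\<exists>g\<in>carrier ?R. g \<oplus>\<^bsub>?R\<^esub> f = \<zero>\<^bsub>?R\<^esub>"
      using neg[OF f] by (intro bexI[of _ "- f"]) simp_all
  qed (simp add: zero)
  moreover have "Group.monoid ?R"
  proof (rule monoidI)
    fix f g h assume "f \<in> carrier ?R" "g \<in> carrier ?R" "h \<in> carrier ?R"
    then have f: "f \<in> C" and g: "g \<in> C"
      by simp_all
    show "f \<otimes>\<^bsub>?R\<^esub> g \<in> carrier ?R"
      using mult[OF f g] by simp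
    show "f \<otimes>\<^bsub>?R\<^esub> g \<otimes>\<^bsub>?R\<^esub> h = f \<otimes>\<^bsub>?R\<^esub> (g \<otimes>\<^bsub>?R\<^esub> h)"
      by (simp add: mult.assoc)
  qed (simp_all add: one)
  ultimately have "ring ?R"
    by (rule ringI) (simp_all add: distrib_left distrib_right)
  then show ?thesis
    by (simp only: free_algebra_def C_def)
qed


section \<open>Zariski topology on the complex 2-torus\<close>

text \<open>Bivariate polynomials over \<open>R\<close> are elements of \<open>R[\<lambda>][\<mu>]\<close>, represented as \<open>R poly poly\<close>;
  the outer variable is \<open>\<mu>\<close>.\<close>

definition eval2 :: "complex poly poly \<Rightarrow> complex \<times> complex \<Rightarrow> complex" where
  "eval2 f p = poly (poly f [:snd p:]) (fst p)"

definition torus :: "(complex \<times> complex) set" where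
  "torus = (- {0}) \<times> (- {0})"

definition zero_locus :: "complex poly poly set \<Rightarrow> (complex \<times> complex) set" where
  "zero_locus F = {p \<in> torus. \<forall>f\<in>F. eval2 f p = 0}"

definition zariski :: "(complex \<times> complex) topology" where
  "zariski = topology (\<lambda>U. \<exists>F. U = torus - zero_locus F)"

lemma openin_zariski: "openin zariski U \<longleftrightarrow> (\<exists>F. U = torus - zero_locus F)"
proof -
  have "istopology (\<lambda>U. \<exists>F. U = torus - zero_locus F)"
    unfolding istopology_def
  proof (intro conjI allI impI)
    fix U V assume "\<exists>F. U = torus - zero_locus F" "\<exists>G. V = torus - zero_locus G"
    then obtain F G where UV: "U = torus - zero_locus F" "V = torus - zero_locus G"
      by blast
    have "(torus - zero_locus F) \<inter> (torus - zero_locus G)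
            = torus - zero_locus {f * g | f g. f \<in> F \<and> g \<in> G}"
    proof (rule Set.set_eqI)
      fix p
      have "(\<exists>f\<in>F. eval2 f p \<noteq> 0) \<and> (\<exists>g\<in>G. eval2 g p \<noteq> 0) \<longleftrightarrow>
              (\<exists>f\<in>F. \<exists>g\<in>G. eval2 (f * g) p \<noteq> 0)"
        by (simp add: eval2_def)
      then show "p \<in> (torus - zero_locus F) \<inter> (torus - zero_locus G) \<longleftrightarrow>
                 p \<in> torus - zero_locus {f * g | f g. f \<in> F \<and> g \<in> G}"
        unfolding zero_locus_def by blast
    qed
    then show "\<exists>H. U \<inter> V = torus - zero_locus H"
      unfolding UV by blast
  next
    fix \<U> assume "\<forall>U\<in>\<U>. \<exists>F. U = torus - zero_locus F"
    then obtain F where F: "\<forall>U\<in>\<U>. U = torus - zero_locus (F U)"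
      unfolding bchoice_iff by blast
    have "\<Union>\<U> = (\<Union>U\<in>\<U>. torus - zero_locus (F U))"
      using F by (metis (no_types, lifting) SUP_cong image_ident)
    also have "\<dots> = torus - zero_locus (\<Union>U\<in>\<U>. F U)"
      unfolding zero_locus_def by blast
    finally show "\<exists>H. \<Union>\<U> = torus - zero_locus H"
      by blast
  qed
  then show ?thesis
    unfolding zariski_def by (simp only: topology_inverse')
qed

lemma topspace_zariski: "topspace zariski = torus"
proof -
  have "torus = torus - zero_locus {1}"
    by (simp add: zero_locus_def eval2_def)
  then have "openin zariski torus"
    unfolding openin_zariski by blast
  moreover have "U \<subseteq> torus" if "openin zariski U" for U
    using that unfolding openin_zariski by blast
  ultimately show ?thesis
    by (simp add: openin_subset openin_topspace subset_antisym)
qed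

lemma closedin_zariski: "closedin zariski Z \<longleftrightarrow> (\<exists>F. Z = zero_locus F)"
proof -
  have sub: "zero_locus F \<subseteq> torus" for F
    by (simp add: zero_locus_def)
  then have "Z \<subseteq> torus \<and> torus - Z = torus - zero_locus F \<longleftrightarrow> Z = zero_locus F" for F
    by blast
  then show ?thesis
    unfolding closedin_def topspace_zariski openin_zariski by blast
qed

definition irreducible_closed :: "'a topology \<Rightarrow> 'a set \<Rightarrow> bool" where
  "irreducible_closed X Z \<longleftrightarrow>
     closedin X Z \<and> Z \<noteq> {} \<and>
     (\<forall>S T. closedin X S \<and> closedin X T \<and> Z = S \<union> T \<longrightarrow> Z = S \<or> Z = T)"

definition irreducible_components :: "'a topology \<Rightarrow> 'a set \<Rightarrow> 'a set set" where
  "irreducible_components X Z =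
     {C. irreducible_closed X C \<and> C \<subseteq> Z \<and>
         (\<forall>C'. irreducible_closed X C' \<and> C \<subseteq> C' \<and> C' \<subseteq> Z \<longrightarrow> C' = C)}"

definition krull_dim :: "'a topology \<Rightarrow> 'a set \<Rightarrow> enat" where
  "krull_dim X Z =
     Sup {enat n | n. \<exists>C :: nat \<Rightarrow> 'a set.
            (\<forall>i\<le>n. irreducible_closed X (C i) \<and> C i \<subseteq> Z) \<and> (\<forall>i<n. C i \<subset> C (Suc i))}"

definition max_dim_part :: "'a topology \<Rightarrow> 'a set \<Rightarrow> 'a set" where
  "max_dim_part X Z = \<Union>{C \<in> irreducible_components X Z. krull_dim X C = krull_dim X Z}"

definition complex_curve :: "(complex \<times> complex) set \<Rightarrow> bool" where
  "complex_curve C \<longleftrightarrow>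
     closedin zariski C \<and> C \<noteq> {} \<and> (\<forall>Z \<in> irreducible_components zariski C. krull_dim zariski Z = 1)"


section \<open>The augmentation polynomial and the stable A-polynomial\<close>

definition poly_lam :: "int poly poly" where "poly_lam = [:[:0, 1:]:]"
definition poly_mu :: "int poly poly" where "poly_mu = [:0, 1:]"

text \<open>\<open>P\<close> cuts out \<open>C\<close>, with repeated factors and powers of \<open>\<lambda>\<close> and \<open>\<mu>\<close> removed, and with coprime
  coefficients.\<close>

definition defining_polynomial :: "(complex \<times> complex) set \<Rightarrow> int poly poly \<Rightarrow> bool" where
  "defining_polynomial C P \<longleftrightarrow>
     zero_locus {map_poly (map_poly of_int) P} = C \<and>
     squarefree P \<and> \<not> poly_lam dvd P \<and> \<not> poly_mu dvd P \<and>
     (\<forall>d::int. (\<forall>i j. d dvd poly.coeff (poly.coeff P i) j) \<longrightarrow> is_unit d)"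

text \<open>Both polynomials are determined only up to sign, hence are described by predicates.\<close>

definition curve_polynomial :: "(complex \<times> complex) set \<Rightarrow> int poly poly \<Rightarrow> bool" where
  "curve_polynomial S P \<longleftrightarrow>
     (let C = max_dim_part zariski (zariski closure_of S)
      in complex_curve C \<and> defining_polynomial C P)"

definition stable_A_polynomial :: "(real \<times> complex \<Rightarrow> real^3) \<Rightarrow> int poly poly \<Rightarrow> bool" where
  "stable_A_polynomial \<tau> A \<longleftrightarrow>
     curve_polynomial (KCH_points (knot_group \<tau>) (meridian \<tau>) (longitude \<tau>)) A"

definition augmentation_polynomial :: "(real \<times> complex \<Rightarrow> real^3) \<Rightarrow> int poly poly \<Rightarrow> bool" where
  "augmentation_polynomial \<tau> B \<longleftrightarrow>
     (\<exists>P. curve_polynomial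
            (augmentation_points (knot_group \<tau>) (meridian \<tau>) (longitude \<tau>)) P \<and>
          B = (1 - poly_mu) * P)"

end

theory Submission
  imports Defs "HOL-Analysis.Analysis" "HOL-Library.Function_Algebras"
begin

text \<open>
  The KCH irreps and the augmentations with \<open>\<mu> \<noteq> 1\<close> give the same set of points \<open>(\<lambda>\<^sub>0, \<mu>\<^sub>0)\<close>
  (\<open>solid_torus.KCH_points_eq_augmentation_points\<close>). Both polynomials therefore cut out the same
  curve, and a squarefree primitive integral polynomial without factors \<open>\<lambda>\<close> and \<open>\<mu>\<close> is determined up
  to sign by its zero locus in the torus (\<open>defining_polynomial_unique\<close>).

  An augmentation is the same as a function \<open>e\<close> on the knot group that satisfies the relations of the
  cord algebra, \<open>e(gh) - e(gmh) = e(g)e(h)\<close> being the essential one. Given a KCH irrep \<open>\<rho>\<close>,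
  the meridian acts by \<open>\<rho>(m)u = u - \<phi>(u)v\<close> for a \<open>\<mu>\<^sub>0\<close>-eigenvector \<open>v\<close> and a linear form
  \<open>\<phi>\<close>, and \<open>e(g) = \<phi>(\<rho>(g)v)\<close> is such a function (\<open>cord_function_of_KCH_irrep\<close>).

  Conversely, given \<open>e\<close>, let the group act by right translation on the span \<open>V\<close> of all right
  translates of \<open>e\<close>. The essential relation says that \<open>m\<close> acts by \<open>F \<mapsto> F - F(1)e\<close>, so \<open>m\<close> is the
  identity on the hyperplane \<open>F(1) = 0\<close> and multiplies \<open>e\<close> by \<open>\<mu>\<^sub>0 = 1 - e(1)\<close>. A nonzero invariant
  subspace contains a function that does not vanish at \<open>1\<close>, hence \<open>e\<close>, hence all of \<open>V\<close>; so \<open>V\<close> is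
  irreducible. It remains to see that \<open>V\<close> is finite-dimensional. A conjugate \<open>h m h\<^sup>-\<^sup>1\<close> changes a
  function by a multiple of the translate of \<open>e\<close> by \<open>h\<close> only. If finitely many such conjugates
  generate the group, \<open>e\<close> and these finitely many translates span \<open>V\<close>
  (\<open>translates_finite_dim\<close>).

  That a knot group is generated by finitely many conjugates of the meridian is the topological input.
  It is obtained without a knot diagram, in two steps. Finite generation
  (\<open>knot_group_finitely_generated\<close>) holds because all loops can be pushed into a compact set, which
  finitely many balls in the complement of the knot cover. The meridian generates the group as a
  normal subgroup (\<open>hom_trivial_if_meridian_trivial\<close>) by van Kampen's theorem: a homomorphism that
  kills the meridian extends from the complement of the knot across the open tube, and there is no
  nontrivial homomorphism on the fundamental group of space.
\<close>


section \<open>Integral polynomials with a given zero locus\<close>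

text \<open>An element of least degree in the ideal generated by \<open>q\<close> and \<open>A\<close> divides every element of that
  ideal up to a constant: the pseudo-remainder is again in the ideal and has smaller degree.\<close>

lemma common_pseudo_divisor:
  fixes q A :: "'a::idom poly"
  assumes "q \<noteq> 0"
  obtains U V d where "d = U * q + V * A" "d \<noteq> 0"
    "\<exists>c s. c \<noteq> 0 \<and> Polynomial.smult c q = d * s" "\<exists>c s. c \<noteq> 0 \<and> Polynomial.smult c A = d * s"
proof -
  define I where "I = {U * q + V * A | U V. True}"
  have I: "a * x + b * y \<in> I" if "x \<in> I" "y \<in> I" for a b x y
  proof -
    from that obtain U V U' V' where "x = U * q + V * A" "y = U' * q + V' * A"
      unfolding I_def by auto
    then have "a * x + b * y = (a * U + b * U') * q + (a * V + b * V') * A"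
      by (simp add: algebra_simps)
    then show ?thesis unfolding I_def by blast
  qed
  have "q = 1 * q + 0 * A" "A = 0 * q + 1 * A" by simp_all
  then have q: "q \<in> I" and A: "A \<in> I" unfolding I_def by blast+
  obtain d where d: "d \<in> I" "d \<noteq> 0" and min: "\<And>x. x \<in> I \<Longrightarrow> x \<noteq> 0 \<Longrightarrow> Polynomial.degree d \<le> Polynomial.degree x"
    using ex_has_least_nat[of "\<lambda>x. x \<in> I \<and> x \<noteq> 0" q Polynomial.degree] q assms by blast
  have *: "\<exists>c s. c \<noteq> 0 \<and> Polynomial.smult c x = d * s" if x: "x \<in> I" for x
  proof -
    obtain c s where cs: "c \<noteq> 0" "Polynomial.smult c x = d * s + pseudo_mod x d"
      using pseudo_mod(1)[OF d(2)] by blast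
    have "pseudo_mod x d = [:c:] * x + (- s) * d"
      using cs(2) by (simp add: algebra_simps)
    also have "\<dots> \<in> I"
      by (rule I[OF x d(1)])
    finally have "pseudo_mod x d = 0"
      using min pseudo_mod(2)[OF d(2)] by (meson not_le)
    then show ?thesis
      using cs by auto
  qed
  show ?thesis
    using d *[OF q] *[OF A] that unfolding I_def by blast
qed

text \<open>Elimination of the variable, in the role of a resultant. A least element \<open>d\<close> as above is not a
  multiple of \<open>q\<close>, since \<open>q\<close> would then divide a constant multiple of \<open>A\<close>. So \<open>q\<close> divides the
  cofactor \<open>s\<close>, and cancelling \<open>q\<close> shows that \<open>d\<close> divides a constant.\<close>

lemma prime_elem_bezout_const:
  fixes q A :: "'a::idom poly"
  assumes q: "prime_elem q" "Polynomial.degree q > 0" and "\<not> q dvd A"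
  obtains U V R where "[:R:] = U * q + V * A" "R \<noteq> 0"
proof -
  have "q \<noteq> 0" using q by auto
  then obtain U V d c s c' s' where d: "d = U * q + V * A" "d \<noteq> 0"
    and c: "c \<noteq> 0" "Polynomial.smult c q = d * s" and c': "c' \<noteq> 0" "Polynomial.smult c' A = d * s'"
    using common_pseudo_divisor[of q A] by metis
  have ndvd: "\<not> q dvd [:b:]" if "b \<noteq> 0" for b
    using q(2) that by (auto dest: dvd_imp_degree_le)
  have "\<not> q dvd d"
  proof
    assume "q dvd d"
    then have "q dvd [:c':] * A"
      using c'(2) by simp
    then show False
      using q(1) ndvd[OF c'(1)] assms(3) prime_elem_dvd_multD by blast
  qed
  moreover have "q dvd d * s"
    using c(2) by (metis dvd_smult dvd_refl)
  ultimately have "q dvd s"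
    using q(1) prime_elem_dvd_multD by blast
  then obtain t where "s = q * t" ..
  then have "q * [:c:] = q * (d * t)"
    using c(2) by (simp add: algebra_simps)
  then have "[:c:] = d * t"
    using \<open>q \<noteq> 0\<close> by (simp only: mult_cancel_left) simp
  then have "Polynomial.degree d = 0"
    using c(1) d(2) by (metis add_is_0 degree_mult_eq degree_pCons_0 mult_zero_right pCons_eq_0_iff)
  then obtain R where R: "d = [:R:]"
    by (metis degree_eq_zeroE)
  show ?thesis
    by (rule that[of R U V]) (use d R in auto)
qed

abbreviation int_eval :: "int poly \<Rightarrow> complex \<Rightarrow> complex" where
  "int_eval a x \<equiv> poly (map_poly of_int a) x"

definition specialize :: "complex \<Rightarrow> int poly poly \<Rightarrow> complex poly" where
  "specialize x P = map_poly (\<lambda>p. poly p x) (map_poly (map_poly of_int) P)"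

lemma eval2_specialize:
  "eval2 (map_poly (map_poly of_int) P) (x, y) = poly (specialize x P) y"
  using poly_hom.poly_map_poly[of x "map_poly (map_poly of_int) P" "[:y:]"]
  by (simp add: eval2_def specialize_def)

lemma coeff_specialize: "poly.coeff (specialize x P) i = int_eval (poly.coeff P i) x"
  by (simp add: specialize_def)

lemma specialize_hom:
  "specialize x (P + Q) = specialize x P + specialize x Q"
  "specialize x (P * Q) = specialize x P * specialize x Q"
proof -
  interpret h: map_poly_comm_ring_hom "\<lambda>a. int_eval a x"
    by unfold_locales (simp_all add: of_int_poly_hom.hom_add of_int_poly_hom.hom_mult)
  have "specialize x P = map_poly (\<lambda>a. int_eval a x) P" for P
    by (rule poly_eqI) (simp add: coeff_specialize h.base.hom_zero)
  then show "specialize x (P + Q) = specialize x P + specialize x Q"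
    "specialize x (P * Q) = specialize x P * specialize x Q"
    by (simp_all add: h.hom_add h.hom_mult)
qed

lemma finite_int_roots: "a \<noteq> 0 \<Longrightarrow> finite {x. int_eval a x = 0}"
  by (rule poly_roots_finite) simp

text \<open>The case of the Nullstellensatz that is needed. If \<open>\<mu>\<close> occurs in \<open>q\<close> and \<open>q\<close> does not divide
  \<open>A\<close>, then the Bezout identity allows common zeros over finitely many values of \<open>\<lambda>\<close> only, whereas
  \<open>q\<close> has a zero in the torus wherever its leading and its constant coefficient do not vanish. If
  \<open>q\<close> is a polynomial in \<open>\<lambda>\<close> alone, then all coefficients of \<open>A\<close> vanish at a root of \<open>q\<close>, and the
  same Bezout identity, now over the integers, makes \<open>q\<close> divide each of them.\<close>

lemma prime_elem_dvd_if_vanishing: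
  assumes q: "prime_elem q" "\<not> poly_lam dvd q" "\<not> poly_mu dvd q" "\<And>d. q \<noteq> [:[:d:]:]"
    and sub: "zero_locus {map_poly (map_poly of_int) q} \<subseteq> zero_locus {map_poly (map_poly of_int) A}"
  shows "q dvd A"
proof (cases "Polynomial.degree q > 0")
  case True
  show ?thesis
  proof (rule ccontr)
    assume "\<not> q dvd A"
    then obtain U V R where R: "[:R:] = U * q + V * A" "R \<noteq> 0"
      using prime_elem_bezout_const[OF q(1) True] by metis
    have q0: "poly.coeff q 0 \<noteq> 0"
    proof
      assume "poly.coeff q 0 = 0"
      then have "q = poly_mu * poly_shift 1 q"
        by (intro poly_eqI) (auto simp: poly_mu_def coeff_pCons coeff_poly_shift split: nat.split)
      then show False
        using q(3) by (metis dvd_triv_left)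
    qed
    have fin: "finite ({x. int_eval R x = 0} \<union> {x. int_eval (lead_coeff q) x = 0} \<union>
       {x. int_eval (poly.coeff q 0) x = 0} \<union> {0})"
      using R(2) q0 q(1) by (intro finite_UnI finite_int_roots) auto
    then obtain x where x: "int_eval R x \<noteq> 0" "int_eval (lead_coeff q) x \<noteq> 0"
       "int_eval (poly.coeff q 0) x \<noteq> 0" "x \<noteq> 0"
      using ex_new_if_finite[OF infinite_UNIV_char_0 fin] by auto
    have "Polynomial.degree (specialize x q) > 0"
      using x(2) True le_degree[of "specialize x q" "Polynomial.degree q"] by (simp add: coeff_specialize)
    then obtain y where y: "poly (specialize x q) y = 0"
      using fundamental_theorem_of_algebra[of "specialize x q"] by (auto simp: constant_degree)
    have "y \<noteq> 0"
      using y x(3) by (auto simp: poly_0_coeff_0 coeff_specialize)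
    then have "(x, y) \<in> zero_locus {map_poly (map_poly of_int) q}"
      using x y by (simp add: zero_locus_def torus_def eval2_specialize)
    then have "poly (specialize x A) y = 0"
      using sub by (auto simp: zero_locus_def eval2_specialize)
    then have "poly (specialize x [:R:]) y = 0"
      using y by (simp add: R(1) specialize_hom)
    moreover have "specialize x [:R:] = [:int_eval R x:]"
      by (intro poly_eqI) (auto simp: coeff_specialize coeff_pCons split: nat.split)
    ultimately show False
      using x(1) by simp
  qed
next
  case False
  then obtain a where a: "q = [:a:]"
    by (metis degree_eq_zeroE neq0_conv)
  have pa: "prime_elem a"
    using q(1) by (simp add: a prime_elem_const_poly_iff)
  have dega: "Polynomial.degree a > 0"
    using q(4) a by (metis degree_eq_zeroE neq0_conv)
  have "poly.coeff a 0 \<noteq> 0"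
  proof
    assume "poly.coeff a 0 = 0"
    then have "a = [:0, 1:] * poly_shift 1 a"
      by (intro poly_eqI) (auto simp: coeff_pCons coeff_poly_shift split: nat.split)
    then have "q = poly_lam * [:poly_shift 1 a:]"
      using a by (simp add: poly_lam_def)
    then show False
      using q(2) by (metis dvd_triv_left)
  qed
  then have a0: "poly (map_poly of_int a) (0::complex) \<noteq> 0"
    by (simp add: poly_0_coeff_0)
  obtain x where x: "int_eval a x = 0"
    using fundamental_theorem_of_algebra[of "map_poly of_int a :: complex poly"] dega
    by (auto simp: constant_degree)
  have "x \<noteq> 0" using x a0 by auto
  have "poly (specialize x A) y = 0" if "y \<noteq> 0" for y
  proof -
    have "specialize x q = 0"
      using x by (intro poly_eqI) (auto simp: a coeff_specialize coeff_pCons split: nat.split)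
    then have "(x, y) \<in> zero_locus {map_poly (map_poly of_int) q}"
      using \<open>x \<noteq> 0\<close> that by (simp add: zero_locus_def torus_def eval2_specialize)
    then show ?thesis
      using sub by (auto simp: zero_locus_def eval2_specialize)
  qed
  then have "- {0} \<subseteq> {y. poly (specialize x A) y = 0}"
    by auto
  then have "specialize x A = 0"
    using poly_roots_finite[of "specialize x A"] finite_subset infinite_UNIV_char_0[where 'a=complex]
    by (metis (no_types, lifting) finite.emptyI finite.insertI finite_compl)
  then have A0: "int_eval (poly.coeff A i) x = 0" for i
    by (metis coeff_specialize coeff_0)
  have "a dvd poly.coeff A i" for i
  proof (rule ccontr)
    assume "\<not> a dvd poly.coeff A i"
    then obtain U V R where R: "[:R:] = U * a + V * poly.coeff A i" "R \<noteq> 0"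
      using prime_elem_bezout_const[OF pa dega] by metis
    have "int_eval [:R:] x = 0"
      by (simp only: R(1) of_int_poly_hom.hom_add of_int_poly_hom.hom_mult poly_add poly_mult x A0) simp
    then show False
      using R(2) by simp
  qed
  then show ?thesis
    by (simp add: a const_poly_dvd_iff)
qed

text \<open>A squarefree polynomial divides \<open>A\<close> once each of its prime factors does. Coprime coefficients
  exclude the constant primes; \<open>\<lambda>\<close> and \<open>\<mu>\<close>, which have no zeros on the torus, are excluded by
  assumption.\<close>

lemma defining_polynomial_dvd:
  assumes P: "defining_polynomial C P" and A: "defining_polynomial C A"
  shows "P dvd A"
proof -
  have sq: "squarefree P" "squarefree A"
    using P A by (simp_all add: defining_polynomial_def)
  then have nz: "P \<noteq> 0" "A \<noteq> 0"
    by auto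
  have dvd: "q dvd A" if q: "prime q" "q dvd P" for q
  proof (rule prime_elem_dvd_if_vanishing)
    show "prime_elem q" using q by simp
    show "\<not> poly_lam dvd q" "\<not> poly_mu dvd q"
      using P q dvd_trans by (auto simp: defining_polynomial_def)
    show "q \<noteq> [:[:d:]:]" for d
    proof
      assume d: "q = [:[:d:]:]"
      have "d dvd poly.coeff (poly.coeff P i) j" for i j
        using q(2) by (simp add: d const_poly_dvd_iff)
      then have "is_unit d"
        using P by (simp add: defining_polynomial_def)
      then have "is_unit q"
        by (simp add: d is_unit_const_poly_iff)
      then show False
        using q(1) by (simp add: not_prime_unit)
    qed
    obtain s where s: "P = q * s" using q(2) ..
    have "zero_locus {map_poly (map_poly of_int) q} \<subseteq> zero_locus {map_poly (map_poly of_int) P}"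
      by (auto simp: zero_locus_def eval2_specialize s specialize_hom)
    also have "\<dots> = zero_locus {map_poly (map_poly of_int) A}"
      using P A by (simp add: defining_polynomial_def)
    finally show "zero_locus {map_poly (map_poly of_int) q} \<subseteq> zero_locus {map_poly (map_poly of_int) A}" .
  qed
  show ?thesis
  proof (rule multiplicity_le_imp_dvd[OF nz(1)])
    fix p :: "int poly poly" assume p: "prime p"
    show "multiplicity p P \<le> multiplicity p A"
    proof (cases "p dvd P")
      case True
      have "multiplicity p P \<le> 1"
        using sq(1) p by (simp add: squarefree_factorial_semiring''[OF nz(1)])
      also have "1 \<le> multiplicity p A"
        using dvd[OF p True] p nz by (intro multiplicity_geI) auto
      finally show ?thesis .
    qed (simp add: not_dvd_imp_multiplicity_0)
  qed
qed

lemma defining_polynomial_unique: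
  assumes "defining_polynomial C P" "defining_polynomial C A"
  shows "P = A \<or> P = - A"
proof -
  obtain u where u: "P = A * u"
    using defining_polynomial_dvd[OF assms(2,1)] ..
  obtain v where v: "A = P * v"
    using defining_polynomial_dvd[OF assms] ..
  have "P \<noteq> 0"
    using assms(1) by (auto simp: defining_polynomial_def)
  then have "u * v = 1"
    using u v by (metis mult.assoc mult.commute mult_cancel_left2)
  then have "u dvd 1" by (metis dvd_triv_left)
  then obtain a where a: "u = [:a:]" "a dvd 1"
    unfolding is_unit_poly_iff by blast
  then obtain b where b: "a = [:b:]" "b dvd 1"
    unfolding is_unit_poly_iff by blast
  have "b = 1 \<or> b = - 1"
    using b(2) by auto
  then have "u = 1 \<or> u = - 1"
    unfolding a(1) b(1) by (metis minus_pCons minus_zero one_pCons)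
  then show ?thesis using u by auto
qed


section \<open>Augmentations as functions on the group\<close>

text \<open>The extension of a ring homomorphism on the coefficients and a multiplicative map on the monoid to
  the monoid algebra. It serves twice: for Laurent polynomials over the integers, and for the free
  algebra over Laurent polynomials.\<close>

definition monoid_algebra_eval :: "('r::comm_ring_1 \<Rightarrow> complex) \<Rightarrow> ('m::monoid_add \<Rightarrow> complex) \<Rightarrow> ('m \<Rightarrow>\<^sub>0 'r) \<Rightarrow> complex" where
  "monoid_algebra_eval \<phi> \<xi> f = (\<Sum>k\<in>Poly_Mapping.keys f. \<phi> (Poly_Mapping.lookup f k) * \<xi> k)"

locale monoid_algebra_point =
  fixes \<phi> :: "'r::comm_ring_1 \<Rightarrow> complex" and \<xi> :: "'m::monoid_add \<Rightarrow> complex"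
  assumes \<phi>: "\<phi> 1 = 1" "\<phi> (a + b) = \<phi> a + \<phi> b" "\<phi> (a * b) = \<phi> a * \<phi> b"
    and \<xi>: "\<xi> 0 = 1" "\<xi> (u + v) = \<xi> u * \<xi> v"
begin

abbreviation ev where "ev \<equiv> monoid_algebra_eval \<phi> \<xi>"

lemma \<phi>_zero: "\<phi> 0 = 0"
  using \<phi>(2)[of 0 0] by simp

lemma ev_superset:
  assumes "finite S" "Poly_Mapping.keys f \<subseteq> S"
  shows "ev f = (\<Sum>k\<in>S. \<phi> (Poly_Mapping.lookup f k) * \<xi> k)"
  unfolding monoid_algebra_eval_def
  using assms by (intro sum.mono_neutral_left) (auto simp: in_keys_iff \<phi>_zero)

lemma ev_zero: "ev 0 = 0"
  by (simp add: monoid_algebra_eval_def)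

lemma ev_single: "ev (Poly_Mapping.single k c) = \<phi> c * \<xi> k"
  using ev_superset[of "{k}" "Poly_Mapping.single k c"] by simp

lemma ev_add: "ev (f + g) = ev f + ev g"
proof -
  let ?S = "Poly_Mapping.keys f \<union> Poly_Mapping.keys g"
  have "ev (f + g) = (\<Sum>k\<in>?S. \<phi> (Poly_Mapping.lookup (f + g) k) * \<xi> k)"
    by (rule ev_superset) (auto dest: subsetD[OF Poly_Mapping.keys_add])
  also have "\<dots> = ev f + ev g"
    by (simp add: ev_superset[of ?S] lookup_add \<phi>(2) distrib_right sum.distrib)
  finally show ?thesis .
qed

lemma ev_sum: "finite I \<Longrightarrow> ev (\<Sum>i\<in>I. F i) = (\<Sum>i\<in>I. ev (F i))"
  by (induction rule: finite_induct) (simp_all add: ev_zero ev_add)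

lemma sum_of_monomials:
  fixes f :: "'m \<Rightarrow>\<^sub>0 'r"
  shows "f = (\<Sum>k\<in>Poly_Mapping.keys f. Poly_Mapping.single k (Poly_Mapping.lookup f k))"
  by (rule poly_mapping_eqI) (auto simp: lookup_sum lookup_single when_def in_keys_iff)

lemma ev_mult: "ev (f * g) = ev f * ev g"
proof -
  let ?a = "\<lambda>f k. Poly_Mapping.single k (Poly_Mapping.lookup f k)"
  have "f * g = (\<Sum>k\<in>Poly_Mapping.keys f. ?a f k) * (\<Sum>k\<in>Poly_Mapping.keys g. ?a g k)"
    using sum_of_monomials[of f] sum_of_monomials[of g] by simp
  also have "\<dots> = (\<Sum>j\<in>Poly_Mapping.keys f. \<Sum>k\<in>Poly_Mapping.keys g. ?a f j * ?a g k)"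
    by (rule sum_product)
  finally have "ev (f * g) = (\<Sum>j\<in>Poly_Mapping.keys f. \<Sum>k\<in>Poly_Mapping.keys g. ev (?a f j * ?a g k))"
    by (simp add: ev_sum)
  also have "\<dots> = (\<Sum>j\<in>Poly_Mapping.keys f. \<Sum>k\<in>Poly_Mapping.keys g.
      (\<phi> (Poly_Mapping.lookup f j) * \<xi> j) * (\<phi> (Poly_Mapping.lookup g k) * \<xi> k))"
    by (intro sum.cong refl) (simp add: mult_single ev_single \<phi> \<xi>)
  also have "\<dots> = ev f * ev g"
    by (simp add: monoid_algebra_eval_def sum_product)
  finally show ?thesis .
qed

lemma ev_one: "ev 1 = 1"
  using ev_single[of 0 1] by (simp add: \<phi> \<xi>)

end

definition laurent_eval :: "complex \<Rightarrow> complex \<Rightarrow> laurent \<Rightarrow> complex" where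
  "laurent_eval l0 m0 = monoid_algebra_eval of_int (\<lambda>(i, j). l0 powi i * m0 powi j)"

definition word_eval :: "('g \<Rightarrow> complex) \<Rightarrow> 'g word \<Rightarrow> complex" where
  "word_eval e w = prod_list (map e (letters w))"

text \<open>The values \<open>e g\<close> of an augmentation at the generators \<open>[g]\<close>; the equations are the images of the
  defining relations of the cord algebra.\<close>

definition cord_function :: "'g monoid \<Rightarrow> 'g \<Rightarrow> 'g \<Rightarrow> complex \<Rightarrow> complex \<Rightarrow> ('g \<Rightarrow> complex) \<Rightarrow> bool" where
  "cord_function G m l l0 m0 e \<longleftrightarrow>
     e \<one>\<^bsub>G\<^esub> = 1 - m0 \<and>
     (\<forall>g\<in>carrier G. e (m \<otimes>\<^bsub>G\<^esub> g) = m0 * e g \<and> e (g \<otimes>\<^bsub>G\<^esub> m) = m0 * e g \<and>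
        e (l \<otimes>\<^bsub>G\<^esub> g) = l0 * e g \<and> e (g \<otimes>\<^bsub>G\<^esub> l) = l0 * e g) \<and>
     (\<forall>g\<in>carrier G. \<forall>h\<in>carrier G. e (g \<otimes>\<^bsub>G\<^esub> h) - e (g \<otimes>\<^bsub>G\<^esub> m \<otimes>\<^bsub>G\<^esub> h) = e g * e h)"

lemma cord_mem: "g \<in> S \<Longrightarrow> cord g \<in> carrier (free_algebra S)"
  by (simp add: cord_def free_algebra_def)

lemma scalar_mem: "scalar c \<in> carrier (free_algebra S)"
  by (auto simp: scalar_def free_algebra_def zero_word_def)

lemma free_algebra_simps:
  "monoid.mult (free_algebra S) = (*)" "one (free_algebra S) = 1" "zero (free_algebra S) = 0" "add (free_algebra S) = (+)"
  by (simp_all add: free_algebra_def)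

lemma free_algebra_one: "1 \<in> carrier (free_algebra S)"
  by (simp add: free_algebra_def zero_word_def)

lemma free_algebra_closed:
  assumes "f \<in> carrier (free_algebra S)" "g \<in> carrier (free_algebra S)"
  shows "f * g \<in> carrier (free_algebra S)" "f + g \<in> carrier (free_algebra S)" "f - g \<in> carrier (free_algebra S)"
proof -
  interpret ring "free_algebra S" by (rule ring_free_algebra)
  show "f * g \<in> carrier (free_algebra S)" "f + g \<in> carrier (free_algebra S)"
    using m_closed[OF assms] a_closed[OF assms] by (simp_all add: free_algebra_simps)
  show "f - g \<in> carrier (free_algebra S)"
    using assms Poly_Mapping.keys_diff[of f g] unfolding free_algebra_def by auto
qed

text \<open>A group with the two commuting elements that play the roles of meridian and longitude.\<close>

locale marked_group = group G for G :: "'g monoid" (structure) +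
  fixes m l :: 'g
  assumes ml: "m \<in> carrier G" "l \<in> carrier G" and commute: "m \<otimes> l = l \<otimes> m"
begin

lemma cord_relators_subset:
  shows "cord_relators G m l \<subseteq> carrier (free_algebra (carrier G))"
  using ml unfolding cord_relators_def
  by (auto intro!: free_algebra_one free_algebra_closed cord_mem scalar_mem)

lemma cord_ideal_ideal:
  shows "ideal (cord_ideal G m l) (free_algebra (carrier G))" "cord_relators G m l \<subseteq> cord_ideal G m l"
proof -
  interpret F: ring "free_algebra (carrier G)" by (rule ring_free_algebra)
  show "ideal (cord_ideal G m l) (free_algebra (carrier G))"
    unfolding cord_ideal_def by (rule F.genideal_ideal[OF cord_relators_subset])
  show "cord_relators G m l \<subseteq> cord_ideal G m l"
    unfolding cord_ideal_def by (rule F.genideal_self[OF cord_relators_subset])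
qed

text \<open>Evaluation on the free algebra kills the relators, hence the ideal that they generate. It is
  therefore constant on each coset, and \<open>the_elem\<close> reads off its value.\<close>

lemma augmentation_of_cord_function:
  assumes nz: "l0 \<noteq> 0" "m0 \<noteq> 0" and e: "cord_function G m l l0 m0 e"
  shows "\<exists>\<epsilon>\<in>augmentations G m l. \<epsilon> (cord_scalar G m l laurent_lam) = l0 \<and> \<epsilon> (cord_scalar G m l laurent_mu) = m0"
proof -
  let ?F = "free_algebra (carrier G)" and ?I = "cord_ideal G m l" and ?C = "class_ring :: complex ring"
  interpret F: ring ?F by (rule ring_free_algebra)
  interpret I: ideal ?I ?F by (rule cord_ideal_ideal)
  interpret L: monoid_algebra_point "of_int :: int \<Rightarrow> complex" "\<lambda>(i, j). l0 powi i * m0 powi j"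
    using nz by unfold_locales (auto simp: zero_prod_def power_int_add)
  interpret W: monoid_algebra_point "laurent_eval l0 m0" "word_eval e"
    unfolding laurent_eval_def
    by unfold_locales (auto simp: L.ev_one L.ev_add L.ev_mult word_eval_def zero_word_def plus_word_def)
  have Rc: "ring ?C"
    by (rule class_ring.ring_axioms)
  have simps: "W.ev (scalar c) = laurent_eval l0 m0 c" "W.ev (cord g) = e g" for c g
    by (simp_all add: scalar_def cord_def W.ev_single W.\<xi> W.\<phi>) (simp add: word_eval_def)
  have lam: "laurent_eval l0 m0 laurent_lam = l0" and mu: "laurent_eval l0 m0 laurent_mu = m0"
    by (simp_all add: laurent_eval_def laurent_lam_def laurent_mu_def L.ev_single)
  have W_diff: "W.ev (f - g) = W.ev f - W.ev g" for f g
    using W.ev_add[of "f - g" g] by simp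
  have hom: "W.ev \<in> Ring.ring_hom ?F ?C"
    by (rule ring_hom_memI) (auto simp: class_ring_simps free_algebra_simps W.ev_one W.ev_add W.ev_mult)
  have hh: "ring_hom_ring ?F ?C W.ev"
    by (intro ring_hom_ring.intro F.ring_axioms Rc ring_hom_ring_axioms.intro hom)
  have "cord_relators G m l \<subseteq> a_kernel ?F ?C W.ev"
  proof
    fix x assume x: "x \<in> cord_relators G m l"
    then have "W.ev x = 0"
      using e unfolding cord_relators_def cord_function_def
      by (auto simp: W_diff W.ev_mult W.ev_one simps lam mu)
    moreover have "x \<in> carrier ?F" using x cord_relators_subset by blast
    ultimately show "x \<in> a_kernel ?F ?C W.ev"
      by (simp add: a_kernel_def' class_ring_simps)
  qed
  then have ker: "?I \<subseteq> a_kernel ?F ?C W.ev"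
    unfolding cord_ideal_def by (intro F.genideal_minimal ring_hom_ring.kernel_is_ideal[OF hh])
  define \<epsilon> where "\<epsilon> Y = the_elem (W.ev ` Y)" for Y
  have coset: "\<epsilon> (?I +>\<^bsub>?F\<^esub> x) = W.ev x" if x: "x \<in> carrier ?F" for x
  proof -
    have "W.ev ` (?I +>\<^bsub>?F\<^esub> x) = {W.ev x}"
    proof (intro equalityI subsetI)
      fix y assume "y \<in> W.ev ` (?I +>\<^bsub>?F\<^esub> x)"
      then obtain i where i: "i \<in> ?I" "y = W.ev (i + x)"
        unfolding a_r_coset_def' free_algebra_simps by blast
      then have "i \<in> a_kernel ?F ?C W.ev" using ker by blast
      then have "W.ev i = 0" by (simp add: a_kernel_def' class_ring_simps)
      then show "y \<in> {W.ev x}"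
        using i(2) by (simp add: W.ev_add)
    next
      fix y assume "y \<in> {W.ev x}"
      then show "y \<in> W.ev ` (?I +>\<^bsub>?F\<^esub> x)"
        using I.a_rcos_self[OF x] by blast
    qed
    then show ?thesis by (simp add: \<epsilon>_def)
  qed
  have "\<epsilon> \<in> Ring.ring_hom (?F Quot ?I) ?C"
  proof (rule ring_hom_memI)
    fix X Y assume "X \<in> carrier (?F Quot ?I)" "Y \<in> carrier (?F Quot ?I)"
    then obtain x y where xy: "x \<in> carrier ?F" "y \<in> carrier ?F" "X = ?I +>\<^bsub>?F\<^esub> x" "Y = ?I +>\<^bsub>?F\<^esub> y"
      by (auto simp: FactRing_def A_RCOSETS_def')
    have "X \<otimes>\<^bsub>?F Quot ?I\<^esub> Y = ?I +>\<^bsub>?F\<^esub> (x * y)"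
      using xy I.rcoset_mult_add[OF xy(1,2)] by (simp add: FactRing_def free_algebra_simps)
    then show "\<epsilon> (X \<otimes>\<^bsub>?F Quot ?I\<^esub> Y) = \<epsilon> X \<otimes>\<^bsub>?C\<^esub> \<epsilon> Y"
      using xy by (simp add: coset free_algebra_closed W.ev_mult class_ring_simps)
    have "X \<oplus>\<^bsub>?F Quot ?I\<^esub> Y = ?I +>\<^bsub>?F\<^esub> (x + y)"
      using xy I.a_rcos_sum[OF xy(1,2)] by (simp add: FactRing_def free_algebra_simps)
    then show "\<epsilon> (X \<oplus>\<^bsub>?F Quot ?I\<^esub> Y) = \<epsilon> X \<oplus>\<^bsub>?C\<^esub> \<epsilon> Y"
      using xy by (simp add: coset free_algebra_closed W.ev_add class_ring_simps)
  next
    show "\<epsilon> \<one>\<^bsub>?F Quot ?I\<^esub> = \<one>\<^bsub>?C\<^esub>"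
      using coset[OF F.one_closed] by (simp add: FactRing_def free_algebra_simps W.ev_one class_ring_simps)
  qed (simp add: class_ring_simps)
  then have "\<epsilon> \<in> augmentations G m l"
    by (simp add: augmentations_def cord_algebra_def)
  moreover have "\<epsilon> (cord_scalar G m l laurent_lam) = l0" "\<epsilon> (cord_scalar G m l laurent_mu) = m0"
    unfolding cord_scalar_def by (simp_all add: coset scalar_mem simps lam mu)
  ultimately show ?thesis by blast
qed

text \<open>The two scalars do not vanish because \<open>\<lambda>\<close> and \<open>\<mu>\<close> are units of the Laurent polynomial ring.\<close>

lemma cord_function_of_augmentation:
  assumes \<epsilon>: "\<epsilon> \<in> augmentations G m l"
  defines "l0 \<equiv> \<epsilon> (cord_scalar G m l laurent_lam)" and "m0 \<equiv> \<epsilon> (cord_scalar G m l laurent_mu)"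
  shows "l0 \<noteq> 0 \<and> m0 \<noteq> 0 \<and> (\<exists>e. cord_function G m l l0 m0 e)"
proof -
  let ?F = "free_algebra (carrier G)" and ?I = "cord_ideal G m l" and ?C = "class_ring :: complex ring"
  interpret F: ring ?F by (rule ring_free_algebra)
  interpret I: ideal ?I ?F by (rule cord_ideal_ideal)
  define \<eta> where "\<eta> x = \<epsilon> (?I +>\<^bsub>?F\<^esub> x)" for x
  have \<epsilon>': "\<epsilon> \<in> Ring.ring_hom (?F Quot ?I) ?C"
    using \<epsilon> by (simp add: augmentations_def cord_algebra_def)
  have mem: "?I +>\<^bsub>?F\<^esub> x \<in> carrier (?F Quot ?I)" if "x \<in> carrier ?F" for x
    using that by (auto simp: FactRing_def A_RCOSETS_def')
  have mult: "\<eta> (x * y) = \<eta> x * \<eta> y" and add: "\<eta> (x + y) = \<eta> x + \<eta> y" if "x \<in> carrier ?F" "y \<in> carrier ?F" for x y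
    using ring_hom_mult[OF \<epsilon>' mem[OF that(1)] mem[OF that(2)]] ring_hom_add[OF \<epsilon>' mem[OF that(1)] mem[OF that(2)]]
      ring_hom_mult[OF I.rcos_ring_hom that] ring_hom_add[OF I.rcos_ring_hom that]
    by (simp_all add: \<eta>_def free_algebra_simps class_ring_simps)
  have one: "\<eta> 1 = 1"
    using ring_hom_one[OF \<epsilon>'] ring_hom_one[OF I.rcos_ring_hom] by (simp add: \<eta>_def free_algebra_simps class_ring_simps)
  note mems = cord_mem scalar_mem free_algebra_one free_algebra_closed m_closed ml
  have diff: "\<eta> (x - y) = \<eta> x - \<eta> y" if "x \<in> carrier ?F" "y \<in> carrier ?F" for x y
    using add[of "x - y" y] that by (simp add: mems)
  have zero: "\<eta> x = 0" if x: "x \<in> cord_relators G m l" for x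
  proof -
    have "x \<in> ?I" using x cord_ideal_ideal(2) by blast
    then have "?I +>\<^bsub>?F\<^esub> x = ?I +>\<^bsub>?F\<^esub> \<zero>\<^bsub>?F\<^esub>"
      using I.a_rcos_const by (simp add: I.a_subset)
    then have "\<eta> x = \<eta> 0" by (simp add: \<eta>_def free_algebra_simps)
    moreover have "\<eta> 0 = 0" using diff[of 1 1] by (simp add: free_algebra_one)
    ultimately show ?thesis by simp
  qed
  have eta_scalar: "\<eta> (scalar laurent_lam) = l0" "\<eta> (scalar laurent_mu) = m0"
    by (simp_all add: \<eta>_def l0_def m0_def cord_scalar_def)
  have "scalar laurent_lam * scalar (Poly_Mapping.single (-1, 0) 1) = (1 :: 'g free_alg)"
    "scalar laurent_mu * scalar (Poly_Mapping.single (0, -1) 1) = (1 :: 'g free_alg)"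
    by (simp_all add: scalar_def laurent_lam_def laurent_mu_def mult_single flip: zero_prod_def)
  then have "l0 * \<eta> (scalar (Poly_Mapping.single (-1, 0) 1)) = 1" "m0 * \<eta> (scalar (Poly_Mapping.single (0, -1) 1)) = 1"
    using mult[OF scalar_mem scalar_mem] one eta_scalar by metis+
  then have nz: "l0 \<noteq> 0" "m0 \<noteq> 0" by auto
  have "cord_function G m l l0 m0 (\<lambda>g. \<eta> (cord g))"
    unfolding cord_function_def
  proof (intro conjI ballI)
    have "cord \<one> - (1 - scalar laurent_mu) \<in> cord_relators G m l" by (simp add: cord_relators_def)
    from zero[OF this] show "\<eta> (cord \<one>) = 1 - m0"
      by (simp add: diff mems one eta_scalar)
  next
    fix g assume g: "g \<in> carrier G"
    have "cord (m \<otimes> g) - scalar laurent_mu * cord g \<in> cord_relators G m l"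
      "cord (g \<otimes> m) - scalar laurent_mu * cord g \<in> cord_relators G m l"
      "cord (l \<otimes> g) - scalar laurent_lam * cord g \<in> cord_relators G m l"
      "cord (g \<otimes> l) - scalar laurent_lam * cord g \<in> cord_relators G m l"
      using g by (auto simp: cord_relators_def)
    from this[THEN zero] g show "\<eta> (cord (m \<otimes> g)) = m0 * \<eta> (cord g)" "\<eta> (cord (g \<otimes> m)) = m0 * \<eta> (cord g)"
      "\<eta> (cord (l \<otimes> g)) = l0 * \<eta> (cord g)" "\<eta> (cord (g \<otimes> l)) = l0 * \<eta> (cord g)"
      by (simp_all add: diff mult mems eta_scalar)
  next
    fix g h assume gh: "g \<in> carrier G" "h \<in> carrier G"
    have "cord (g \<otimes> h) - cord (g \<otimes> m \<otimes> h) - cord g * cord h \<in> cord_relators G m l"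
      using gh by (auto simp: cord_relators_def)
    from zero[OF this] gh show "\<eta> (cord (g \<otimes> h)) - \<eta> (cord (g \<otimes> m \<otimes> h)) = \<eta> (cord g) * \<eta> (cord h)"
      by (simp add: diff mult mems)
  qed
  then show ?thesis using nz by blast
qed

lemma augmentation_points_iff:
  "(l0, m0) \<in> augmentation_points G m l \<longleftrightarrow> l0 \<noteq> 0 \<and> m0 \<noteq> 0 \<and> m0 \<noteq> 1 \<and> (\<exists>e. cord_function G m l l0 m0 e)"
proof
  assume "(l0, m0) \<in> augmentation_points G m l"
  then obtain \<epsilon> where \<epsilon>: "\<epsilon> \<in> augmentations G m l" and eq: "l0 = \<epsilon> (cord_scalar G m l laurent_lam)"
      "m0 = \<epsilon> (cord_scalar G m l laurent_mu)" and "\<not> (l0 \<noteq> 0 \<and> m0 = 1)"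
    by (auto simp: augmentation_points_def)
  with cord_function_of_augmentation[OF \<epsilon>, folded eq]
  show "l0 \<noteq> 0 \<and> m0 \<noteq> 0 \<and> m0 \<noteq> 1 \<and> (\<exists>e. cord_function G m l l0 m0 e)"
    by blast
next
  assume R: "l0 \<noteq> 0 \<and> m0 \<noteq> 0 \<and> m0 \<noteq> 1 \<and> (\<exists>e. cord_function G m l l0 m0 e)"
  then obtain \<epsilon> where "\<epsilon> \<in> augmentations G m l" "\<epsilon> (cord_scalar G m l laurent_lam) = l0"
      "\<epsilon> (cord_scalar G m l laurent_mu) = m0"
    using augmentation_of_cord_function[of l0 m0] by blast
  then show "(l0, m0) \<in> augmentation_points G m l"
    using R unfolding augmentation_points_def by blast
qed

end


section \<open>From KCH irreps to augmentations\<close>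

lemma order_prod_linear:
  fixes a :: complex
  shows "Polynomial.order a (\<Prod>x\<leftarrow>xs. [:- x, 1:]) = length (filter (\<lambda>x. x = a) xs)"
proof (induction xs)
  case (Cons x xs)
  let ?P = "\<Prod>x\<leftarrow>xs. [:- x, 1:]"
  have "?P \<noteq> 0" by (auto simp: prod_list_zero_iff)
  moreover have "[:- x, 1:] \<noteq> 0" by simp
  ultimately have "[:- x, 1:] * ?P \<noteq> 0" by (metis mult_eq_0_iff)
  then have "Polynomial.order a ([:- x, 1:] * ?P) = Polynomial.order a [:- x, 1:] + Polynomial.order a ?P"
    by (rule order_mult)
  moreover have "Polynomial.order a [:- x, 1:] = (if x = a then 1 else 0)"
    using order_power_n_n[of a 1] by (auto intro: order_0I)
  ultimately show ?case using Cons by (simp only: list.map prod_list.Cons filter.simps) simp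
qed (simp add: order_0I)

lemma order_char_poly_diagonal:
  fixes D :: "complex mat"
  assumes "D \<in> carrier_mat n n" "diagonal_mat D"
  shows "Polynomial.order a (char_poly D) = card {i. i < n \<and> D $$ (i, i) = a}"
proof -
  have "upper_triangular D"
    using assms by (auto simp: upper_triangular_def diagonal_mat_def)
  then have "char_poly D = (\<Prod>x\<leftarrow>diag_mat D. [:- x, 1:])"
    by (rule char_poly_upper_triangular[OF assms(1)])
  then have "Polynomial.order a (char_poly D) = length (filter (\<lambda>x. x = a) (diag_mat D))"
    by (simp add: order_prod_linear)
  also have "\<dots> = card {i. i < n \<and> D $$ (i, i) = a}"
    using assms(1) by (auto simp: length_filter_conv_card diag_mat_def intro!: arg_cong[where f=card])
  finally show ?thesis .
qed

text \<open>In a diagonal form of \<open>M\<close>, the multiplicity \<open>n - 1\<close> leaves exactly one diagonal entry different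
  from \<open>1\<close>. So \<open>M\<close> differs from the identity by a map of rank one whose image is the eigenline
  of \<open>m0\<close>.\<close>

lemma rank_one_perturbation:
  fixes M :: "complex mat"
  assumes M: "M \<in> carrier_mat n n" "diagonalizable M" "Polynomial.order 1 (char_poly M) = n - 1" and n: "n > 0"
    and m0: "m0 \<noteq> 1" and ev: "eigenvector M v m0"
  obtains \<phi> where "\<phi> v = 1 - m0" "\<And>u. u \<in> carrier_vec n \<Longrightarrow> M *\<^sub>v u = u - \<phi> u \<cdot>\<^sub>v v"
    "\<And>u w. u \<in> carrier_vec n \<Longrightarrow> w \<in> carrier_vec n \<Longrightarrow> \<phi> (u - w) = \<phi> u - \<phi> w"
    "\<And>u c. u \<in> carrier_vec n \<Longrightarrow> \<phi> (c \<cdot>\<^sub>v u) = c * \<phi> u"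
proof -
  obtain D P R where D: "similar_mat_wit M D P R" "diagonal_mat D"
    using M(2) unfolding diagonalizable_def similar_mat_def by blast
  note S = similar_mat_witD2[OF M(1) D(1)]
  have "char_poly M = char_poly D"
    using D(1) by (intro char_poly_similar) (auto simp: similar_mat_def)
  then have c1: "card {i. i < n \<and> D $$ (i, i) = 1} = n - 1"
    using M(3) order_char_poly_diagonal[OF S(5) D(2)] by simp
  have "card {i. i < n \<and> D $$ (i, i) \<noteq> 1} = n - card {i. i < n \<and> D $$ (i, i) = 1}"
  proof -
    have "{i. i < n \<and> D $$ (i, i) \<noteq> 1} = {..<n} - {i. i < n \<and> D $$ (i, i) = 1}" by auto
    then show ?thesis by (simp add: card_Diff_subset subset_eq)
  qed
  then have "card {i. i < n \<and> D $$ (i, i) \<noteq> 1} = 1"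
    using c1 n by simp
  then obtain k where "{i. i < n \<and> D $$ (i, i) \<noteq> 1} = {k}"
    by (auto simp: card_1_singleton_iff)
  then have k: "k < n" "D $$ (k, k) \<noteq> 1" "\<And>i. i < n \<Longrightarrow> i \<noteq> k \<Longrightarrow> D $$ (i, i) = 1"
    by blast+
  have Dx: "vec_index (D *\<^sub>v x) i = D $$ (i, i) * vec_index x i" if "x \<in> carrier_vec n" "i < n" for x i
  proof -
    have "vec_index (D *\<^sub>v x) i = (\<Sum>j = 0..<n. D $$ (i, j) * vec_index x j)"
      using that S(5) by (auto simp: scalar_prod_def)
    also have "\<dots> = (\<Sum>j\<in>{i}. D $$ (i, j) * vec_index x j)"
      using that S(5) D(2) by (intro sum.mono_neutral_right) (auto simp: diagonal_mat_def)
    finally show ?thesis by simp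
  qed
  have v: "v \<in> carrier_vec n" "v \<noteq> 0\<^sub>v n" "M *\<^sub>v v = m0 \<cdot>\<^sub>v v"
    using ev M(1) by (auto simp: eigenvector_def)
  have RM: "R *\<^sub>v (M *\<^sub>v u) = D *\<^sub>v (R *\<^sub>v u)" if "u \<in> carrier_vec n" for u
  proof -
    have "R * M = R * (P * (D * R))"
      unfolding S(3) using S by (simp add: assoc_mult_mat[of P n n D n R n])
    also have "\<dots> = (R * P) * (D * R)"
      using S assoc_mult_mat[of R n n P n "D * R" n] by simp
    also have "\<dots> = D * R"
      using S by simp
    finally show ?thesis
      using that S assoc_mult_mat_vec[of R n n M n u] assoc_mult_mat_vec[of D n n R n u] by simp
  qed
  have PR: "P *\<^sub>v (R *\<^sub>v u) = u" if "u \<in> carrier_vec n" for u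
    using that S assoc_mult_mat_vec[of P n n R n u] by simp
  define w where "w = R *\<^sub>v v"
  have w: "w \<in> carrier_vec n" using S v by (simp add: w_def)
  have Dw: "D *\<^sub>v w = m0 \<cdot>\<^sub>v w"
    using RM[OF v(1)] v S by (simp add: w_def mult_mat_vec)
  have wi: "D $$ (i, i) * vec_index w i = m0 * vec_index w i" if "i < n" for i
    using Dx[OF w that] Dw w that by auto
  then have w0: "vec_index w i = 0" if "i < n" "i \<noteq> k" for i
    using wi[OF that(1)] k(3)[OF that] m0 by auto
  have wk: "vec_index w k \<noteq> 0"
  proof
    assume "vec_index w k = 0"
    then have "vec_index w i = 0" if "i < n" for i using w0 that by (cases "i = k") auto
    then have "w = 0\<^sub>v n" using w by (intro eq_vecI) auto
    moreover have "P *\<^sub>v 0\<^sub>v n = 0\<^sub>v n" using S by (intro eq_vecI) auto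
    ultimately have "v = 0\<^sub>v n" using PR[OF v(1)] by (simp add: w_def)
    then show False using v by simp
  qed
  then have Dk: "D $$ (k, k) = m0" using wi[OF k(1)] by simp
  define \<phi> where "\<phi> u = (1 - m0) * vec_index (R *\<^sub>v u) k / vec_index w k" for u
  have "M *\<^sub>v u = u - \<phi> u \<cdot>\<^sub>v v" if u: "u \<in> carrier_vec n" for u
  proof -
    have Ru: "R *\<^sub>v u \<in> carrier_vec n" using S u by simp
    have "D *\<^sub>v (R *\<^sub>v u) = R *\<^sub>v u - \<phi> u \<cdot>\<^sub>v w"
    proof (rule eq_vecI)
      fix i assume "i < dim_vec (R *\<^sub>v u - \<phi> u \<cdot>\<^sub>v w)"
      then have i: "i < n" using w by simp
      show "vec_index (D *\<^sub>v (R *\<^sub>v u)) i = vec_index (R *\<^sub>v u - \<phi> u \<cdot>\<^sub>v w) i"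
      proof (cases "i = k")
        case True
        have "\<phi> u * vec_index w k = (1 - m0) * vec_index (R *\<^sub>v u) k" using wk by (simp add: \<phi>_def)
        then show ?thesis using True Dx[OF Ru i] Dk w i by (simp add: left_diff_distrib)
      next
        case False
        then show ?thesis using Dx[OF Ru i] k(3)[OF i] w0[OF i] w i by simp
      qed
    qed (use S w in auto)
    then have "R *\<^sub>v (M *\<^sub>v u) = R *\<^sub>v u - \<phi> u \<cdot>\<^sub>v (R *\<^sub>v v)"
      using RM[OF u] by (simp add: w_def)
    also have "\<dots> = R *\<^sub>v (u - \<phi> u \<cdot>\<^sub>v v)"
      using S u v by (simp add: mult_minus_distrib_mat_vec[of R n n] mult_mat_vec[of R n n])
    finally have "P *\<^sub>v (R *\<^sub>v (M *\<^sub>v u)) = P *\<^sub>v (R *\<^sub>v (u - \<phi> u \<cdot>\<^sub>v v))"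
      by simp
    then show ?thesis
      using PR[of "M *\<^sub>v u"] PR[of "u - \<phi> u \<cdot>\<^sub>v v"] M(1) u v by simp
  qed
  moreover have "\<phi> v = 1 - m0" using wk by (simp add: \<phi>_def w_def)
  moreover have "\<phi> (u - w) = \<phi> u - \<phi> w" if "u \<in> carrier_vec n" "w \<in> carrier_vec n" for u w
    using that S k(1) by (simp add: \<phi>_def mult_minus_distrib_mat_vec[of R n n] diff_divide_distrib right_diff_distrib)
  moreover have "\<phi> (c \<cdot>\<^sub>v u) = c * \<phi> u" if "u \<in> carrier_vec n" for u c
    using that S k(1) by (simp add: \<phi>_def mult_mat_vec[of R n n])
  ultimately show ?thesis using that by blast
qed

lemma GL_hom_matrix:
  assumes G: "group G" and \<rho>: "\<rho> \<in> hom G (GL n)"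
  shows "g \<in> carrier G \<Longrightarrow> \<rho> g \<in> carrier_mat n n"
    "g \<in> carrier G \<Longrightarrow> h \<in> carrier G \<Longrightarrow> \<rho> (g \<otimes>\<^bsub>G\<^esub> h) = \<rho> g * \<rho> h"
    "\<rho> \<one>\<^bsub>G\<^esub> = 1\<^sub>m n"
proof -
  interpret R: ring "ring_mat TYPE(complex) n ()" by (rule ring_mat)
  have GL: "group (GL n)" unfolding GL_def by (rule R.units_group)
  show "g \<in> carrier G \<Longrightarrow> \<rho> g \<in> carrier_mat n n"
    using \<rho> by (auto simp: hom_def GL_def units_of_def Units_def ring_mat_simps)
  show "g \<in> carrier G \<Longrightarrow> h \<in> carrier G \<Longrightarrow> \<rho> (g \<otimes>\<^bsub>G\<^esub> h) = \<rho> g * \<rho> h"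
    using \<rho> by (auto simp: hom_def GL_def units_of_def ring_mat_simps)
  show "\<rho> \<one>\<^bsub>G\<^esub> = 1\<^sub>m n"
    using hom_one[OF \<rho> G GL] by (simp add: GL_def units_of_def ring_mat_simps)
qed

context marked_group
begin

text \<open>The function is \<open>e g = \<phi> (\<rho> g v)\<close>, with \<open>\<phi>\<close> from the rank-one form of \<open>\<rho> m\<close>. The product
  relation is that form, inserted between \<open>\<rho> g\<close> and \<open>\<rho> h\<close>. For \<open>l\<close> on the left the form \<open>\<phi>\<close> must be
  an eigenvector of the dual action of \<open>l\<close>, with the same eigenvalue as \<open>v\<close>; this holds because \<open>l\<close>
  commutes with \<open>m\<close>.\<close>

lemma cord_function_of_KCH_irrep:
  assumes irr: "KCH_irrep G m n \<rho>" and m0: "m0 \<noteq> 1" and ev: "eigenvector (\<rho> m) v m0" "eigenvector (\<rho> l) v l0"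
  shows "l0 \<noteq> 0 \<and> m0 \<noteq> 0 \<and> (\<exists>e. cord_function G m l l0 m0 e)"
proof -
  have n: "n > 0" and hom: "\<rho> \<in> hom G (GL n)"
    using irr by (auto simp: KCH_irrep_def irreducible_rep_def)
  note \<rho> = GL_hom_matrix[OF is_group hom]
  have M: "\<rho> m \<in> carrier_mat n n" and L: "\<rho> l \<in> carrier_mat n n" using \<rho>(1) ml by auto
  have v: "v \<in> carrier_vec n" "v \<noteq> 0\<^sub>v n" "\<rho> m *\<^sub>v v = m0 \<cdot>\<^sub>v v" "\<rho> l *\<^sub>v v = l0 \<cdot>\<^sub>v v"
    using ev M L by (auto simp: eigenvector_def)
  obtain \<phi> where \<phi>: "\<phi> v = 1 - m0" "\<And>u. u \<in> carrier_vec n \<Longrightarrow> \<rho> m *\<^sub>v u = u - \<phi> u \<cdot>\<^sub>v v"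
    "\<And>u w. u \<in> carrier_vec n \<Longrightarrow> w \<in> carrier_vec n \<Longrightarrow> \<phi> (u - w) = \<phi> u - \<phi> w"
    "\<And>u c. u \<in> carrier_vec n \<Longrightarrow> \<phi> (c \<cdot>\<^sub>v u) = c * \<phi> u"
    using rank_one_perturbation[OF M _ _ n m0 ev(1)] irr by (auto simp: KCH_irrep_def)
  have mult: "\<rho> (g \<otimes> h) *\<^sub>v u = \<rho> g *\<^sub>v (\<rho> h *\<^sub>v u)" if "g \<in> carrier G" "h \<in> carrier G" "u \<in> carrier_vec n" for g h u
    using that \<rho>(1,2) by (simp add: assoc_mult_mat_vec[of _ n n _ n])
  have car: "\<rho> g *\<^sub>v u \<in> carrier_vec n" if "g \<in> carrier G" "u \<in> carrier_vec n" for g u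
    using that \<rho>(1) by (intro mult_mat_vec_carrier)
  have lin: "\<rho> g *\<^sub>v (u - c \<cdot>\<^sub>v v) = \<rho> g *\<^sub>v u - c \<cdot>\<^sub>v (\<rho> g *\<^sub>v v)" "\<rho> g *\<^sub>v (c \<cdot>\<^sub>v u) = c \<cdot>\<^sub>v (\<rho> g *\<^sub>v u)"
    if "g \<in> carrier G" "u \<in> carrier_vec n" for g u c
    using that \<rho>(1) v by (simp_all add: mult_minus_distrib_mat_vec[of _ n n] mult_mat_vec[of _ n n])
  have nonzero: "c \<noteq> 0" if g: "g \<in> carrier G" and eg: "\<rho> g *\<^sub>v v = c \<cdot>\<^sub>v v" for g c
  proof
    assume "c = 0"
    have "v = \<rho> (inv g \<otimes> g) *\<^sub>v v" using g v \<rho>(3) by simp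
    also have "\<dots> = \<rho> (inv g) *\<^sub>v (c \<cdot>\<^sub>v v)" using g v eg by (simp only: mult inv_closed)
    also have "\<dots> = 0 \<cdot>\<^sub>v (\<rho> (inv g) *\<^sub>v v)" using lin(2)[of "inv g" v c] g v \<open>c = 0\<close> by simp
    also have "\<dots> = 0\<^sub>v n"
    proof -
      have "0 \<cdot>\<^sub>v x = 0\<^sub>v n" if "x \<in> carrier_vec n" for x :: "complex Matrix.vec"
        using that by (intro eq_vecI) auto
      then show ?thesis using car[of "inv g" v] g v by simp
    qed
    finally show False using v by simp
  qed
  have smult_cancel: "a = b" if "a \<cdot>\<^sub>v v = b \<cdot>\<^sub>v v" for a b
  proof -
    obtain i where i: "i < n" "vec_index v i \<noteq> 0"
      using v by (metis carrier_vecD eq_vecI index_zero_vec(1) index_zero_vec(2))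
    have "vec_index (a \<cdot>\<^sub>v v) i = vec_index (b \<cdot>\<^sub>v v) i" using that by simp
    then show ?thesis using i v by simp
  qed
  have \<phi>L: "\<phi> (\<rho> l *\<^sub>v u) = l0 * \<phi> u" if u: "u \<in> carrier_vec n" for u
  proof -
    have Lu: "\<rho> l *\<^sub>v u \<in> carrier_vec n" using car ml u by simp
    have "\<rho> m *\<^sub>v (\<rho> l *\<^sub>v u) = \<rho> l *\<^sub>v (\<rho> m *\<^sub>v u)"
      using mult[of m l u] mult[of l m u] ml u commute by simp
    then have "\<rho> l *\<^sub>v u - \<phi> (\<rho> l *\<^sub>v u) \<cdot>\<^sub>v v = \<rho> l *\<^sub>v u - \<phi> u \<cdot>\<^sub>v (l0 \<cdot>\<^sub>v v)"
      using \<phi>(2)[OF Lu] \<phi>(2)[OF u] lin(1)[OF ml(2) u] v(4) by simp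
    then have "\<phi> (\<rho> l *\<^sub>v u) \<cdot>\<^sub>v v = (\<phi> u * l0) \<cdot>\<^sub>v v"
    proof -
      assume eq: "\<rho> l *\<^sub>v u - \<phi> (\<rho> l *\<^sub>v u) \<cdot>\<^sub>v v = \<rho> l *\<^sub>v u - \<phi> u \<cdot>\<^sub>v (l0 \<cdot>\<^sub>v v)"
      show ?thesis
      proof (rule eq_vecI)
        fix i assume "i < dim_vec ((\<phi> u * l0) \<cdot>\<^sub>v v)"
        then have i: "i < n" using v by simp
        show "vec_index (\<phi> (\<rho> l *\<^sub>v u) \<cdot>\<^sub>v v) i = vec_index ((\<phi> u * l0) \<cdot>\<^sub>v v) i"
          using arg_cong[OF eq, of "\<lambda>x. vec_index x i"] i Lu v by simp
      qed simp
    qed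
    from smult_cancel[OF this] show ?thesis by (simp add: mult.commute)
  qed
  define e where "e g = \<phi> (\<rho> g *\<^sub>v v)" for g
  have "cord_function G m l l0 m0 e"
    unfolding cord_function_def
  proof (intro conjI ballI)
    show "e \<one> = 1 - m0" using \<rho>(3) v \<phi>(1) by (simp add: e_def)
  next
    fix g assume g: "g \<in> carrier G"
    have u: "\<rho> g *\<^sub>v v \<in> carrier_vec n" using car g v by simp
    show "e (m \<otimes> g) = m0 * e g"
      using mult[OF ml(1) g v(1)] \<phi>(2)[OF u] \<phi>(3)[OF u, of "\<phi> (\<rho> g *\<^sub>v v) \<cdot>\<^sub>v v"] \<phi>(4)[OF v(1)] \<phi>(1) v
      by (simp add: e_def algebra_simps)
    show "e (g \<otimes> m) = m0 * e g"
      using mult[OF g ml(1) v(1)] lin(2)[OF g v(1)] \<phi>(4)[OF u] v by (simp add: e_def)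
    show "e (l \<otimes> g) = l0 * e g"
      using mult[OF ml(2) g v(1)] \<phi>L[OF u] by (simp add: e_def)
    show "e (g \<otimes> l) = l0 * e g"
      using mult[OF g ml(2) v(1)] lin(2)[OF g v(1)] \<phi>(4)[OF u] v by (simp add: e_def)
  next
    fix g h assume g: "g \<in> carrier G" and h: "h \<in> carrier G"
    have u: "\<rho> h *\<^sub>v v \<in> carrier_vec n" "\<rho> g *\<^sub>v v \<in> carrier_vec n" using car g h v by simp_all
    have "\<rho> (g \<otimes> m \<otimes> h) *\<^sub>v v = \<rho> g *\<^sub>v (\<rho> m *\<^sub>v (\<rho> h *\<^sub>v v))"
      using mult[of "g \<otimes> m" h v] mult[of g m "\<rho> h *\<^sub>v v"] g h ml v u by simp
    also have "\<dots> = \<rho> g *\<^sub>v (\<rho> h *\<^sub>v v) - e h \<cdot>\<^sub>v (\<rho> g *\<^sub>v v)"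
      using \<phi>(2)[OF u(1)] lin(1)[OF g u(1)] by (simp add: e_def)
    finally have "e (g \<otimes> m \<otimes> h) = \<phi> (\<rho> g *\<^sub>v (\<rho> h *\<^sub>v v)) - e h * e g"
      using \<phi>(3)[OF car[OF g u(1)], of "e h \<cdot>\<^sub>v (\<rho> g *\<^sub>v v)"] \<phi>(4)[OF u(2)] u by (simp add: e_def)
    then show "e (g \<otimes> h) - e (g \<otimes> m \<otimes> h) = e g * e h"
      using mult[OF g h v(1)] by (simp add: e_def mult.commute)
  qed
  then show ?thesis using nonzero[OF ml(1) v(3)] nonzero[OF ml(2) v(4)] by blast
qed

end


section \<open>From augmentations to KCH irreps\<close>

definition fun_scale :: "complex \<Rightarrow> ('a \<Rightarrow> complex) \<Rightarrow> 'a \<Rightarrow> complex" where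
  "fun_scale c f = (\<lambda>x. c * f x)"

lemma fun_scale_apply: "fun_scale c f x = c * f x"
  by (simp add: fun_scale_def)

text \<open>Sums of functions are treated as vectors, and are evaluated pointwise only where this is asked for.\<close>

declare plus_fun_apply [simp del] zero_fun_apply [simp del] minus_apply [simp del]

lemmas pointwise = fun_eq_iff plus_fun_apply zero_fun_apply minus_apply fun_scale_apply

interpretation fun_vs: vector_space "fun_scale :: complex \<Rightarrow> ('a \<Rightarrow> complex) \<Rightarrow> _"
  by unfold_locales (auto simp: pointwise algebra_simps)

lemma (in vector_space) span_closed_induct:
  assumes "x \<in> span S" "\<And>x. x \<in> S \<Longrightarrow> P x" "P 0" "\<And>x y. P x \<Longrightarrow> P y \<Longrightarrow> P (x + y)" "\<And>c x. P x \<Longrightarrow> P (scale c x)"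
  shows "P x"
  using assms(1) by (induction rule: span_induct_alt) (auto intro: assms)

lemma mat_eq_if_mult_vec_eq:
  fixes A B :: "complex Matrix.mat"
  assumes "A \<in> carrier_mat n n" "B \<in> carrier_mat n n" "\<And>w. w \<in> carrier_vec n \<Longrightarrow> A *\<^sub>v w = B *\<^sub>v w"
  shows "A = B"
proof (rule eq_matI)
  fix i j assume ij: "i < dim_row B" "j < dim_col B"
  then have "vec_index (A *\<^sub>v unit_vec n j) i = vec_index (B *\<^sub>v unit_vec n j) i"
    using assms(3)[of "unit_vec n j"] by simp
  then show "A $$ (i, j) = B $$ (i, j)"
    using ij assms(1,2) by simp
qed (use assms in auto)

context marked_group
begin

text \<open>Right translation. Functions are cut off outside the group, so that equality of functions is
  equality on the group.\<close>

definition translate :: "'g \<Rightarrow> ('g \<Rightarrow> complex) \<Rightarrow> 'g \<Rightarrow> complex" where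
  "translate g F = (\<lambda>y. if y \<in> carrier G then F (y \<otimes> g) else 0)"

lemma translate_linear:
  "translate g (F + F') = translate g F + translate g F'"
  "translate g (fun_scale c F) = fun_scale c (translate g F)"
  "translate g 0 = 0"
  by (auto simp: translate_def pointwise)

lemma translate_diff: "translate g (F - F') = translate g F - translate g F'"
  by (auto simp: translate_def pointwise)

lemma translate_sum: "finite I \<Longrightarrow> translate g (\<Sum>i\<in>I. F i) = (\<Sum>i\<in>I. translate g (F i))"
  by (induction rule: finite_induct) (simp_all add: translate_linear)

lemma translate_translate:
  "g \<in> carrier G \<Longrightarrow> h \<in> carrier G \<Longrightarrow> translate g (translate h F) = translate (g \<otimes> h) F"
  by (auto simp: translate_def pointwise m_assoc)

definition translates :: "('g \<Rightarrow> complex) \<Rightarrow> ('g \<Rightarrow> complex) set" where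
  "translates e = fun_vs.span ((\<lambda>x. translate x e) ` carrier G)"

lemma translates_gen: "x \<in> carrier G \<Longrightarrow> translate x e \<in> translates e"
  unfolding translates_def by (intro fun_vs.span_base imageI)

lemma translates_closed:
  "F \<in> translates e \<Longrightarrow> F' \<in> translates e \<Longrightarrow> F + F' \<in> translates e"
  "F \<in> translates e \<Longrightarrow> F' \<in> translates e \<Longrightarrow> F - F' \<in> translates e"
  "F \<in> translates e \<Longrightarrow> fun_scale c F \<in> translates e"
  "0 \<in> translates e"
  unfolding translates_def by (intro fun_vs.span_add fun_vs.span_diff fun_vs.span_scale fun_vs.span_zero; assumption)+

lemma translates_induct:
  assumes "F \<in> translates e" "\<And>x. x \<in> carrier G \<Longrightarrow> P (translate x e)" "P 0" "\<And>F F'. P F \<Longrightarrow> P F' \<Longrightarrow> P (F + F')"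
    "\<And>c F. P F \<Longrightarrow> P (fun_scale c F)"
  shows "P F"
  using assms(1) unfolding translates_def by (rule fun_vs.span_closed_induct) (use assms(2-) in auto)

lemma translate_translates:
  assumes "F \<in> translates e" "g \<in> carrier G"
  shows "translate g F \<in> translates e"
  using assms(1)
  by (rule translates_induct)
    (simp_all add: assms(2) translate_translate translates_gen translate_linear translates_closed)

lemma translate_one: "F \<in> translates e \<Longrightarrow> translate \<one> F = F"
  by (erule translates_induct) (simp_all add: translate_translate translate_linear)

lemma translates_outside: "F \<in> translates e \<Longrightarrow> y \<notin> carrier G \<Longrightarrow> F y = 0"
  by (erule translates_induct) (simp_all add: translate_def plus_fun_apply zero_fun_apply fun_scale_apply)

end

locale cord_point = marked_group G m l for G :: "'g monoid" (structure) and m l +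
  fixes l0 m0 :: complex and e :: "'g \<Rightarrow> complex"
  assumes cord: "cord_function G m l l0 m0 e" and m0: "m0 \<noteq> 0" "m0 \<noteq> 1"
begin

abbreviation "V \<equiv> translates e"
abbreviation "E \<equiv> translate \<one> e"

lemma E: "E \<in> V" "E \<one> = 1 - m0"
  using cord translates_gen[of \<one> e] by (simp_all add: translate_def cord_function_def)

lemma translate_E: "x \<in> carrier G \<Longrightarrow> translate x E = translate x e"
  by (simp add: translate_translate)

text \<open>For \<open>F = translate x e\<close> this is the relation \<open>e (y x) - e (y m x) = e y * e x\<close>. Both sides are
  linear in \<open>F\<close>.\<close>

lemma translate_meridian:
  assumes "F \<in> V"
  shows "translate m F = F - fun_scale (F \<one>) E"
  using assms
proof (rule translates_induct)
  fix x assume x: "x \<in> carrier G"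
  have "e (y \<otimes> x) - e (y \<otimes> m \<otimes> x) = e y * e x" if "y \<in> carrier G" for y
    using cord x that by (simp add: cord_function_def)
  then show "translate m (translate x e) = translate x e - fun_scale (translate x e \<one>) E"
    using x ml by (auto simp: translate_def pointwise m_assoc[symmetric] algebra_simps)
next
  fix F F' assume "translate m F = F - fun_scale (F \<one>) E" "translate m F' = F' - fun_scale (F' \<one>) E"
  then show "translate m (F + F') = F + F' - fun_scale ((F + F') \<one>) E"
    by (simp add: translate_linear pointwise algebra_simps)
next
  fix c F assume "translate m F = F - fun_scale (F \<one>) E"
  then have "translate m (fun_scale c F) = fun_scale c (F - fun_scale (F \<one>) E)"
    by (simp only: translate_linear)
  then show "translate m (fun_scale c F) = fun_scale c F - fun_scale (fun_scale c F \<one>) E"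
    by (simp add: pointwise algebra_simps)
qed (simp only: translate_linear, simp add: pointwise)

lemma translate_inv_meridian:
  assumes F: "F \<in> V"
  shows "translate (inv m) F = F + fun_scale (F \<one> / m0) E"
proof -
  let ?G = "F + fun_scale (F \<one> / m0) E"
  have G: "?G \<in> V" by (intro translates_closed F E)
  have "translate m ?G = ?G - fun_scale (?G \<one>) E" by (rule translate_meridian[OF G])
  also have "\<dots> = F"
  proof -
    have "?G \<one> = F \<one> / m0" using m0 by (simp add: pointwise E(2) field_simps)
    then show ?thesis by (simp add: pointwise)
  qed
  finally have "translate (inv m) F = translate (inv m) (translate m ?G)" by simp
  also have "\<dots> = ?G" using ml translate_one[OF G] by (simp add: translate_translate)
  finally show ?thesis .
qed

lemma translate_longitude: "translate l E = fun_scale l0 E"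
  using cord ml by (auto simp: translate_def pointwise cord_function_def)

text \<open>Conjugating by \<open>h\<close> moves the rank-one part of the action of \<open>m\<close> onto the line of the translate of
  \<open>e\<close> by \<open>h\<close>.\<close>

lemma translate_conjugate:
  assumes F: "F \<in> V" and h: "h \<in> carrier G"
  shows "\<exists>a. translate (h \<otimes> m \<otimes> inv h) F = F + fun_scale a (translate h e)"
    "\<exists>a. translate (inv (h \<otimes> m \<otimes> inv h)) F = F + fun_scale a (translate h e)"
proof -
  let ?F = "translate (inv h) F"
  have F': "?F \<in> V" using F h by (intro translate_translates) auto
  have hF: "translate h ?F = F" using h translate_one[OF F] by (simp add: translate_translate)
  have conj: "translate (h \<otimes> k \<otimes> inv h) F = translate h (translate k ?F)" if "k \<in> carrier G" for k
    using h that by (simp add: translate_translate m_assoc)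
  have "translate (h \<otimes> m \<otimes> inv h) F = F - fun_scale (?F \<one>) (translate h e)"
    using conj[OF ml(1)] translate_meridian[OF F'] h by (simp add: translate_diff translate_linear translate_E hF)
  also have "\<dots> = F + fun_scale (- ?F \<one>) (translate h e)" by (simp add: pointwise)
  finally show "\<exists>a. translate (h \<otimes> m \<otimes> inv h) F = F + fun_scale a (translate h e)" by blast
  have "inv (h \<otimes> m \<otimes> inv h) = h \<otimes> inv m \<otimes> inv h"
    using h ml by (simp add: inv_mult_group m_assoc)
  then have "translate (inv (h \<otimes> m \<otimes> inv h)) F = F + fun_scale (?F \<one> / m0) (translate h e)"
    using conj[of "inv m"] ml translate_inv_meridian[OF F'] h by (simp add: translate_linear translate_E hF)
  then show "\<exists>a. translate (inv (h \<otimes> m \<otimes> inv h)) F = F + fun_scale a (translate h e)" by blast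
qed

text \<open>The span of \<open>E\<close> and of the translates by the finitely many \<open>h\<close> is stable under each generator and
  its inverse. So it is stable under the group, and it contains the generator \<open>E\<close> of \<open>V\<close>.\<close>

lemma translates_finite_dim:
  assumes H: "finite H" "H \<subseteq> carrier G" "carrier G = generate G ((\<lambda>h. h \<otimes> m \<otimes> inv h) ` H)"
  obtains S where "finite S" "V = fun_vs.span S"
proof -
  define S where "S = (\<lambda>x. translate x e) ` insert \<one> H"
  have SV: "fun_vs.span S \<subseteq> V"
    unfolding translates_def S_def using H(2) by (intro fun_vs.span_mono image_mono) auto
  have gen: "translate h e \<in> fun_vs.span S" if "h \<in> H" for h
    unfolding S_def using that by (intro fun_vs.span_base imageI) simp
  have "\<forall>F\<in>fun_vs.span S. translate g F \<in> fun_vs.span S" if "g \<in> carrier G" for g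
    using that unfolding H(3)
  proof (induction rule: generate.induct)
    case one
    then show ?case using translate_one SV by (metis subsetD)
  next
    case (incl c)
    then obtain h where h: "h \<in> H" "c = h \<otimes> m \<otimes> inv h" by blast
    show ?case
    proof
      fix F assume F: "F \<in> fun_vs.span S"
      obtain a where "translate c F = F + fun_scale a (translate h e)"
        using translate_conjugate(1)[of F h] F SV h H(2) by blast
      then show "translate c F \<in> fun_vs.span S"
        using F gen[OF h(1)] by (simp add: fun_vs.span_add fun_vs.span_scale)
    qed
  next
    case (inv c)
    then obtain h where h: "h \<in> H" "c = h \<otimes> m \<otimes> inv h" by blast
    show ?case
    proof
      fix F assume F: "F \<in> fun_vs.span S"
      obtain a where "translate (inv c) F = F + fun_scale a (translate h e)"
        using translate_conjugate(2)[of F h] F SV h H(2) by blast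
      then show "translate (inv c) F \<in> fun_vs.span S"
        using F gen[OF h(1)] by (simp add: fun_vs.span_add fun_vs.span_scale)
    qed
  next
    case (eng g h)
    then have "g \<in> carrier G" "h \<in> carrier G" using H(3) by simp_all
    then show ?case using eng.IH by (simp flip: translate_translate)
  qed
  moreover have "E \<in> fun_vs.span S" unfolding S_def by (intro fun_vs.span_base imageI) simp
  ultimately have "translate x e \<in> fun_vs.span S" if "x \<in> carrier G" for x
    using translate_E[OF that] that by metis
  then have "V \<subseteq> fun_vs.span S"
    unfolding translates_def by (intro fun_vs.span_minimal fun_vs.subspace_span) auto
  then show ?thesis
    using SV H(1) that[of S] by (auto simp: S_def)
qed

text \<open>A basis in which \<open>m\<close> is diagonal: \<open>E\<close> is an eigenvector for \<open>m0\<close>, and the functions that vanish at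
  \<open>\<one>\<close> are fixed. They form a complement of the line of \<open>E\<close> because \<open>E \<one> = 1 - m0 \<noteq> 0\<close>.\<close>

lemma adapted_basis:
  assumes "finite S" "V = fun_vs.span S"
  obtains n :: nat and u where "n > 0" "u 0 = E" "inj_on u {..<n}" "fun_vs.independent (u ` {..<n})" "V = fun_vs.span (u ` {..<n})"
    "\<And>i. 0 < i \<Longrightarrow> i < n \<Longrightarrow> u i \<one> = 0"
proof -
  define K where "K = {F \<in> V. F \<one> = 0}"
  have K: "fun_vs.subspace K"
    unfolding K_def by (intro fun_vs.subspaceI) (auto intro: translates_closed simp: plus_fun_apply zero_fun_apply fun_scale_apply)
  obtain B where B: "B \<subseteq> K" "fun_vs.independent B" "K \<subseteq> fun_vs.span B"
    using fun_vs.maximal_independent_subset[of K] by blast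
  have BV: "B \<subseteq> V" using B(1) by (auto simp: K_def)
  then have finB: "finite B"
    using fun_vs.independent_span_bound[OF assms(1) B(2)] assms(2) by auto
  have BK: "fun_vs.span B \<subseteq> K" using B(1) K by (rule fun_vs.span_minimal)
  have EB: "E \<notin> fun_vs.span B" using BK E(2) m0 by (auto simp: K_def)
  then have EB': "E \<notin> B" using fun_vs.span_base by blast
  have ind: "fun_vs.independent (insert E B)"
    using EB B(2) by (simp add: fun_vs.independent_insert)
  have spanV: "V = fun_vs.span (insert E B)"
  proof
    show "fun_vs.span (insert E B) \<subseteq> V"
      using BV E(1) by (intro fun_vs.span_minimal) (auto simp: translates_def)
    show "V \<subseteq> fun_vs.span (insert E B)"
    proof
      fix F assume F: "F \<in> V"
      let ?c = "F \<one> / (1 - m0)"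
      have "F - fun_scale ?c E \<in> V" by (intro translates_closed F E(1))
      moreover have "(F - fun_scale ?c E) \<one> = 0" using E(2) m0 by (simp add: pointwise)
      ultimately have "F - fun_scale ?c E \<in> K" by (simp add: K_def)
      then have "F - fun_scale ?c E \<in> fun_vs.span (insert E B)"
        using B(3) fun_vs.span_mono[of B "insert E B"] by blast
      then have "(F - fun_scale ?c E) + fun_scale ?c E \<in> fun_vs.span (insert E B)"
        by (intro fun_vs.span_add[OF _ fun_vs.span_scale] fun_vs.span_base[of E]) simp_all
      moreover have "(F - fun_scale ?c E) + fun_scale ?c E = F" by (simp add: pointwise)
      ultimately show "F \<in> fun_vs.span (insert E B)" by simp
    qed
  qed
  obtain b where b: "bij_betw b {0..<card B} B"
    using ex_bij_betw_nat_finite[OF finB] by blast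
  define u where "u = case_nat E b"
  have img: "u ` {..<Suc (card B)} = insert E B"
  proof -
    have "u ` {..<Suc (card B)} = insert (u 0) ((\<lambda>j. u (Suc j)) ` {..<card B})"
      by (simp only: lessThan_Suc_eq_insert_0 image_insert image_image)
    also have "\<dots> = insert E B"
      using b by (simp add: u_def bij_betw_def atLeast0LessThan)
    finally show ?thesis .
  qed
  have "card (u ` {..<Suc (card B)}) = card {..<Suc (card B)}"
    unfolding img using finB EB' by simp
  then have inj: "inj_on u {..<Suc (card B)}"
    by (intro eq_card_imp_inj_on) auto
  have "u i \<one> = 0" if "0 < i" "i < Suc (card B)" for i
  proof -
    define j where "j = i - 1"
    then have j: "i = Suc j" "j \<in> {0..<card B}" using that by simp_all
    have "u i = b j" by (simp add: u_def j)
    then have "u i \<in> B" using b j(2) bij_betwE by metis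
    then show ?thesis using B(1) by (auto simp: K_def)
  qed
  then show ?thesis
    using that[of "Suc (card B)" u] inj img ind spanV by (simp add: u_def)
qed


text \<open>The KCH irrep is the action on \<open>V\<close> by right translation, written in an adapted basis. It is
  irreducible: a nonzero function in an invariant subspace has a translate \<open>F\<close> with
  \<open>F \<one> \<noteq> 0\<close>, and \<open>m\<close> moves \<open>F\<close> by the multiple \<open>- F \<one>\<close> of \<open>E\<close>. So \<open>E\<close> is in the subspace, and its
  translates span \<open>V\<close>.\<close>

lemma KCH_point:
  assumes dim: "finite S" "V = fun_vs.span S"
  shows "(l0, m0) \<in> KCH_points G m l"
proof -
  obtain n :: nat and u where n: "n > 0" and u0: "u 0 = E" and inj: "inj_on u {..<n}" and ind: "fun_vs.independent (u ` {..<n})"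
    and span: "V = fun_vs.span (u ` {..<n})" and u1: "\<And>i. 0 < i \<Longrightarrow> i < n \<Longrightarrow> u i \<one> = 0"
    using adapted_basis[OF dim] by blast
  let ?rep = "fun_vs.representation (u ` {..<n})"
  define coords where "coords F = Matrix.vec n (\<lambda>i. ?rep F (u i))" for F
  define comb where "comb w = (\<Sum>j<n. fun_scale (vec_index w j) (u j))" for w
  have uV: "u j \<in> V" if "j < n" for j
    unfolding span using that by (intro fun_vs.span_base) auto
  have sumV: "(\<Sum>j<n. fun_scale (a j) (x j)) \<in> V" if "\<And>j. j < n \<Longrightarrow> x j \<in> V" for a x
    using that unfolding span by (intro fun_vs.span_sum fun_vs.span_scale) auto
  have combV: "comb w \<in> V" for w
    unfolding comb_def by (rule sumV) (rule uV)
  have rep_sum: "?rep (\<Sum>j<n. fun_scale (a j) (x j)) b = (\<Sum>j<n. a j * ?rep (x j) b)" if "\<And>j. j < n \<Longrightarrow> x j \<in> V" for a x b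
  proof -
    have xs: "x j \<in> fun_vs.span (u ` {..<n})" if "j < n" for j
      using \<open>\<And>j. j < n \<Longrightarrow> x j \<in> V\<close>[OF that] by (simp add: span)
    then have "?rep (\<Sum>j<n. fun_scale (a j) (x j)) = (\<lambda>b. \<Sum>j<n. ?rep (fun_scale (a j) (x j)) b)"
      by (intro fun_vs.representation_sum[OF ind] fun_vs.span_scale) simp
    then show ?thesis
      using xs by (simp add: fun_vs.representation_scale[OF ind])
  qed
  have comb_coords: "comb (coords F) = F" if "F \<in> V" for F
  proof -
    have "(\<Sum>b\<in>u ` {..<n}. fun_scale (?rep F b) b) = F"
      using that by (intro fun_vs.sum_representation_eq[OF ind]) (auto simp: span)
    then show ?thesis
      by (simp add: comb_def coords_def sum.reindex[OF inj])
  qed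
  have coords_comb: "coords (comb w) = w" if "w \<in> carrier_vec n" for w
  proof (rule eq_vecI)
    fix i assume "i < dim_vec w"
    then have i: "i < n" using that by simp
    have "vec_index (coords (comb w)) i = (\<Sum>j<n. vec_index w j * ?rep (u j) (u i))"
      using i by (simp add: coords_def comb_def rep_sum[OF uV])
    also have "\<dots> = (\<Sum>j<n. if j = i then vec_index w j else 0)"
      using inj i by (intro sum.cong refl) (auto simp: fun_vs.representation_basis[OF ind] inj_on_def)
    also have "\<dots> = vec_index w i" using i by simp
    finally show "vec_index (coords (comb w)) i = vec_index w i" .
  qed (use that in \<open>simp add: coords_def\<close>)
  have comb_one: "comb w \<one> = vec_index w 0 * (1 - m0)" for w
  proof -
    have "comb w \<one> = (\<Sum>j<n. vec_index w j * u j \<one>)"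
    proof -
      have "(\<Sum>j\<in>J. fun_scale (vec_index w j) (u j)) \<one> = (\<Sum>j\<in>J. vec_index w j * u j \<one>)" if "finite J" for J
        using that by (induction rule: finite_induct) (simp_all add: pointwise)
      then show ?thesis by (simp add: comb_def)
    qed
    also have "\<dots> = (\<Sum>j\<in>{0}. vec_index w j * u j \<one>)"
      using n u1 by (intro sum.mono_neutral_right) auto
    finally show ?thesis using u0 E(2) by simp
  qed
  have coords_E: "coords E = unit_vec n 0"
  proof (rule eq_vecI)
    have "E \<in> u ` {..<n}" using n u0 by (metis imageI lessThan_iff)
    then have rep: "?rep E = (\<lambda>F. if F = E then 1 else 0)" by (rule fun_vs.representation_basis[OF ind])
    fix i assume "i < dim_vec (unit_vec n 0)"
    then have i: "i < n" by simp
    have "u i = E \<longleftrightarrow> i = 0" using inj_onD[OF inj, of i 0] i n u0 by auto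
    then show "vec_index (coords E) i = vec_index (unit_vec n 0) i"
      using i by (simp add: coords_def rep)
  qed (simp add: coords_def)
  have coords_linear: "coords (F + fun_scale a F') = coords F + a \<cdot>\<^sub>v coords F'" if "F \<in> V" "F' \<in> V" for F F' a
  proof -
    have "?rep (F + fun_scale a F') = (\<lambda>b. ?rep F b + ?rep (fun_scale a F') b)"
      using that by (intro fun_vs.representation_add[OF ind]) (auto simp: span intro: fun_vs.span_scale)
    then show ?thesis
      using that by (intro eq_vecI) (simp_all add: coords_def fun_vs.representation_scale[OF ind] span)
  qed
  have coords_zero: "coords 0 = 0\<^sub>v n"
    by (auto simp: coords_def fun_vs.representation_zero intro!: eq_vecI)
  define \<rho> where "\<rho> g = Matrix.mat n n (\<lambda>(i, j). ?rep (translate g (u j)) (u i))" for g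
  have \<rho>_carrier: "\<rho> g \<in> carrier_mat n n" for g by (simp add: \<rho>_def)
  have \<rho>_apply: "\<rho> g *\<^sub>v w = coords (translate g (comb w))" if g: "g \<in> carrier G" and w: "w \<in> carrier_vec n" for g w
  proof (rule eq_vecI)
    fix i assume "i < dim_vec (coords (translate g (comb w)))"
    then have i: "i < n" by (simp add: coords_def)
    have "translate g (comb w) = (\<Sum>j<n. fun_scale (vec_index w j) (translate g (u j)))"
      unfolding comb_def by (subst translate_sum) (simp_all add: translate_linear)
    then have "vec_index (coords (translate g (comb w))) i = (\<Sum>j<n. vec_index w j * ?rep (translate g (u j)) (u i))"
      using i g uV by (simp add: coords_def rep_sum translate_translates)
    also have "\<dots> = vec_index (\<rho> g *\<^sub>v w) i"
      using i w by (simp add: \<rho>_def scalar_prod_def atLeast0LessThan mult.commute)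
    finally show "vec_index (\<rho> g *\<^sub>v w) i = vec_index (coords (translate g (comb w))) i" by simp
  qed (simp add: \<rho>_def coords_def)
  have comb_\<rho>: "comb (\<rho> g *\<^sub>v w) = translate g (comb w)" if "g \<in> carrier G" "w \<in> carrier_vec n" for g w
    using that by (simp add: \<rho>_apply comb_coords translate_translates combV)
  have \<rho>_mult: "\<rho> (g \<otimes> h) = \<rho> g * \<rho> h" if gh: "g \<in> carrier G" "h \<in> carrier G" for g h
  proof (rule mat_eq_if_mult_vec_eq)
    fix w :: "complex Matrix.vec" assume w: "w \<in> carrier_vec n"
    have hw: "\<rho> h *\<^sub>v w \<in> carrier_vec n" using \<rho>_carrier w by (rule mult_mat_vec_carrier)
    have "\<rho> (g \<otimes> h) *\<^sub>v w = \<rho> g *\<^sub>v (\<rho> h *\<^sub>v w)"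
      using gh w hw by (simp add: \<rho>_apply[of "g \<otimes> h"] \<rho>_apply[of g "\<rho> h *\<^sub>v w"] comb_\<rho> translate_translate)
    then show "\<rho> (g \<otimes> h) *\<^sub>v w = (\<rho> g * \<rho> h) *\<^sub>v w"
      using \<rho>_carrier w by (simp add: assoc_mult_mat_vec[of _ n n _ n])
  qed (use \<rho>_carrier mult_carrier_mat in blast)+
  have \<rho>_one: "\<rho> \<one> = 1\<^sub>m n"
    by (rule mat_eq_if_mult_vec_eq)
      (use \<rho>_carrier in \<open>auto simp: \<rho>_apply translate_one[OF combV] coords_comb\<close>)
  have \<rho>_hom: "\<rho> \<in> hom G (GL n)"
  proof (rule homI)
    fix g assume g: "g \<in> carrier G"
    have "\<rho> g * \<rho> (inv g) = 1\<^sub>m n" "\<rho> (inv g) * \<rho> g = 1\<^sub>m n"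
      using g by (simp_all flip: \<rho>_mult add: \<rho>_one)
    then show "\<rho> g \<in> carrier (GL n)"
      using \<rho>_carrier by (auto simp: GL_def units_of_def Units_def ring_mat_simps)
  qed (simp add: GL_def units_of_def ring_mat_simps \<rho>_mult)
  have \<rho>m: "\<rho> m *\<^sub>v w = w + (- (vec_index w 0 * (1 - m0))) \<cdot>\<^sub>v unit_vec n 0" if w: "w \<in> carrier_vec n" for w
  proof -
    have eq: "translate m (comb w) = comb w + fun_scale (- (comb w \<one>)) E"
      using translate_meridian[OF combV] by (simp add: pointwise)
    show ?thesis
      by (simp only: \<rho>_apply[OF ml(1) w] eq coords_linear[OF combV E(1)] coords_comb[OF w] coords_E comb_one)
  qed
  have entry: "\<rho> m $$ (i, j) = (if i = j then if i = 0 then m0 else 1 else 0)" if ij: "i < n" "j < n" for i j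
  proof -
    have "\<rho> m $$ (i, j) = vec_index (\<rho> m *\<^sub>v unit_vec n j) i"
      using ij \<rho>_carrier[of m] by simp
    also have "\<dots> = (if i = j then if i = 0 then m0 else 1 else 0)"
      unfolding \<rho>m[OF unit_vec_carrier] using ij by auto
    finally show ?thesis .
  qed
  have diag: "diagonal_mat (\<rho> m)"
    using \<rho>_carrier[of m] by (auto simp: diagonal_mat_def entry)
  have "{i. i < n \<and> \<rho> m $$ (i, i) = 1} = {1..<n}"
    using m0 by (auto simp: entry split: if_splits)
  then have ord: "Polynomial.order 1 (char_poly (\<rho> m)) = n - 1"
    using order_char_poly_diagonal[OF \<rho>_carrier diag] by simp
  have unit0: "unit_vec n 0 \<in> carrier_vec n" "unit_vec n 0 \<noteq> (0\<^sub>v n :: complex Matrix.vec)"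
  proof -
    have "vec_index (unit_vec n 0) 0 = (1 :: complex)" "vec_index (0\<^sub>v n) 0 = (0 :: complex)"
      using n by simp_all
    then show "unit_vec n 0 \<noteq> (0\<^sub>v n :: complex Matrix.vec)" by (metis zero_neq_one)
  qed simp
  have comb_unit: "comb (unit_vec n 0) = E"
    using comb_coords[OF E(1)] by (simp add: coords_E)
  have ev_m: "eigenvector (\<rho> m) (unit_vec n 0) m0"
  proof -
    have "\<rho> m *\<^sub>v unit_vec n 0 = m0 \<cdot>\<^sub>v unit_vec n 0"
      unfolding \<rho>m[OF unit0(1)] using n by (intro eq_vecI) (auto simp: unit_vec_def)
    then show ?thesis using unit0 \<rho>_carrier[of m] by (simp add: eigenvector_def)
  qed
  have ev_l: "eigenvector (\<rho> l) (unit_vec n 0) l0"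
  proof -
    have "\<rho> l *\<^sub>v unit_vec n 0 = coords (0 + fun_scale l0 E)"
      using ml unit0 by (simp add: \<rho>_apply comb_unit translate_longitude)
    also have "\<dots> = coords 0 + l0 \<cdot>\<^sub>v coords E"
      by (rule coords_linear[OF translates_closed(4) E(1)])
    also have "\<dots> = l0 \<cdot>\<^sub>v unit_vec n 0"
      by (simp add: coords_zero coords_E)
    finally show ?thesis using unit0 \<rho>_carrier[of l] by (simp add: eigenvector_def)
  qed
  have irr: "W = {0\<^sub>v n} \<or> W = carrier_vec n"
    if W: "VectorSpace.subspace class_ring W (module_vec TYPE(complex) n)" and inv: "\<forall>g\<in>carrier G. \<forall>w\<in>W. \<rho> g *\<^sub>v w \<in> W" for W
  proof -
    have sm: "submodule class_ring W (module_vec TYPE(complex) n)"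
      using W by (simp add: VectorSpace.subspace_def)
    have W_sub: "W \<subseteq> carrier_vec n" and W_zero: "0\<^sub>v n \<in> W"
      and W_add: "\<And>x y. x \<in> W \<Longrightarrow> y \<in> W \<Longrightarrow> x + y \<in> W" and W_smult: "\<And>c x. x \<in> W \<Longrightarrow> c \<cdot>\<^sub>v x \<in> W"
      using submodule.subset[OF sm] submodule.zero_closed[OF sm] submodule.m_closed[OF sm] submodule.smult_closed[OF sm]
      by (simp_all add: module_vec_simps class_ring_simps)
    show ?thesis
    proof (cases "W = {0\<^sub>v n}")
      case False
      then obtain w where w: "w \<in> W" "w \<noteq> 0\<^sub>v n" using W_zero by blast
      then have wc: "w \<in> carrier_vec n" using W_sub by blast
      have "comb w \<noteq> 0"
      proof
        assume "comb w = 0"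
        then have "w = coords 0" using coords_comb[OF wc] by simp
        then show False using w by (simp add: coords_zero)
      qed
      then obtain x where "comb w x \<noteq> 0" by (auto simp: pointwise)
      then have x: "x \<in> carrier G" "comb w x \<noteq> 0" using translates_outside[OF combV] by blast+
      define w' where "w' = \<rho> x *\<^sub>v w"
      have w': "w' \<in> W" using inv x w by (simp add: w'_def)
      then have w'c: "w' \<in> carrier_vec n" using W_sub by blast
      have "comb w' \<one> \<noteq> 0"
        using x wc by (simp add: w'_def comb_\<rho>) (simp add: translate_def)
      then have c: "vec_index w' 0 * (1 - m0) \<noteq> 0" by (simp add: comb_one)
      let ?c = "vec_index w' 0 * (1 - m0)"
      \<comment> \<open>solving \<open>\<rho> m w' = w' - c E\<close> for \<open>E\<close>, which has coordinates \<open>unit_vec n 0\<close>\<close>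
      have "\<rho> m *\<^sub>v w' \<in> W" using inv ml w' by blast
      then have "(- 1 / ?c) \<cdot>\<^sub>v (\<rho> m *\<^sub>v w' + (- 1) \<cdot>\<^sub>v w') \<in> W"
        using w' by (intro W_smult W_add)
      also have "(- 1 / ?c) \<cdot>\<^sub>v (\<rho> m *\<^sub>v w' + (- 1) \<cdot>\<^sub>v w') = unit_vec n 0"
        unfolding \<rho>m[OF w'c] using c w'c by (intro eq_vecI) auto
      finally have uW: "unit_vec n 0 \<in> W" .
      have "coords F \<in> W" if "F \<in> V" for F
      proof -
        have "F \<in> V \<and> coords F \<in> W"
          using that
        proof (rule translates_induct)
          fix y assume y: "y \<in> carrier G"
          have "coords (translate y e) = \<rho> y *\<^sub>v unit_vec n 0"
            using y unit0 by (simp add: \<rho>_apply comb_unit translate_translate)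
          then show "translate y e \<in> V \<and> coords (translate y e) \<in> W"
            using inv y uW by (simp add: translates_gen)
        next
          show "0 \<in> V \<and> coords 0 \<in> W" using W_zero by (simp add: coords_zero translates_closed)
        next
          fix F F' assume "F \<in> V \<and> coords F \<in> W" "F' \<in> V \<and> coords F' \<in> W"
          then show "F + F' \<in> V \<and> coords (F + F') \<in> W"
            using coords_linear[of F F' 1] W_add by (simp add: translates_closed)
        next
          fix c F assume F: "F \<in> V \<and> coords F \<in> W"
          then have "coords (F + fun_scale (c - 1) F) \<in> W"
            using coords_linear[of F F "c - 1"] W_add W_smult by simp
          moreover have "F + fun_scale (c - 1) F = fun_scale c F" by (simp add: pointwise algebra_simps)
          ultimately show "fun_scale c F \<in> V \<and> coords (fun_scale c F) \<in> W"
            using F by (simp add: translates_closed)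
        qed
        then show ?thesis by simp
      qed
      then have "carrier_vec n \<subseteq> W" using coords_comb combV by (metis subsetI)
      then show ?thesis using W_sub by blast
    qed simp
  qed
  have "KCH_irrep G m n \<rho>"
    unfolding KCH_irrep_def irreducible_rep_def
    using n \<rho>_hom irr ord diag similar_mat_refl[OF \<rho>_carrier] by (auto simp: diagonalizable_def)
  then show ?thesis
    unfolding KCH_points_def using m0 ev_m ev_l by blast
qed

end


section \<open>Transport along paths\<close>

text \<open>A functor from the fundamental groupoid of \<open>A\<close> to the group \<open>Q\<close>, given on paths.\<close>

locale path_functor = group Q for Q (structure) +
  fixes A :: "'p::real_normed_vector set" and h :: "(real \<Rightarrow> 'p) \<Rightarrow> 'a"
  assumes closed [simp]: "path p \<Longrightarrow> path_image p \<subseteq> A \<Longrightarrow> h p \<in> carrier Q"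
    and join: "path p \<Longrightarrow> path_image p \<subseteq> A \<Longrightarrow> path q \<Longrightarrow> path_image q \<subseteq> A \<Longrightarrow>
      pathfinish p = pathstart q \<Longrightarrow> h (p +++ q) = h p \<otimes> h q"
    and homotopic: "homotopic_paths A p q \<Longrightarrow> h p = h q"
begin

lemma eq_on_unit:
  assumes "path p" "path_image p \<subseteq> A" "\<And>t. t \<in> {0..1} \<Longrightarrow> p t = q t"
  shows "h p = h q"
  using assms by (intro homotopic homotopic_paths_eq) auto

lemma const:
  assumes "path p" "path_image p \<subseteq> A" "\<And>t. t \<in> {0..1} \<Longrightarrow> p t = a"
  shows "h p = \<one>"
proof -
  have "pathfinish p = pathstart p"
    using assms(3) by (simp add: pathfinish_def pathstart_def)
  then have "h p \<otimes> h p = h (p +++ p)"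
    using assms by (simp add: join)
  also have "\<dots> = h p"
    using assms by (intro eq_on_unit[symmetric]) (auto simp: joinpaths_def)
  finally show ?thesis
    using assms by (simp add: l_cancel_one)
qed

lemma homotopic_in_convex:
  fixes \<Phi> :: "'v::real_normed_vector \<Rightarrow> 'p"
  assumes D: "convex D" "continuous_on D \<Phi>" "\<Phi> ` D \<subseteq> A"
    and p: "path p" "path_image p \<subseteq> D" and q: "path q" "path_image q \<subseteq> D"
    and "pathstart p = pathstart q" "pathfinish p = pathfinish q"
  shows "h (\<Phi> \<circ> p) = h (\<Phi> \<circ> q)"
proof -
  have "homotopic_paths D p q"
    using convex_imp_simply_connected[OF D(1)] assms(4-) unfolding simply_connected_eq_homotopic_paths by auto
  then show ?thesis
    using D by (intro homotopic homotopic_paths_continuous_image) auto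
qed

text \<open>Transport along the image of a straight segment. In a convex set all paths with the same endpoints
  are homotopic, so these values determine the transport along all paths in the image of \<open>\<Phi>\<close>.\<close>

definition segment :: "('v::real_normed_vector \<Rightarrow> 'p) \<Rightarrow> 'v \<Rightarrow> 'v \<Rightarrow> 'a" where
  "segment \<Phi> P R = h (\<Phi> \<circ> linepath P R)"

lemma segment_path:
  assumes D: "convex D" "continuous_on D \<Phi>" "\<Phi> ` D \<subseteq> A"
    and p: "path p" "path_image p \<subseteq> D"
  shows "h (\<Phi> \<circ> p) = segment \<Phi> (pathstart p) (pathfinish p)"
proof -
  have "pathstart p \<in> D" "pathfinish p \<in> D"
    using p by auto
  then have "closed_segment (pathstart p) (pathfinish p) \<subseteq> D"
    using D(1) by (simp add: closed_segment_subset)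
  then show ?thesis
    unfolding segment_def using assms by (intro homotopic_in_convex[OF D p]) auto
qed

lemma segment_closed:
  assumes D: "convex D" "continuous_on D \<Phi>" "\<Phi> ` D \<subseteq> A" and "P \<in> D" "R \<in> D"
  shows "segment \<Phi> P R \<in> carrier Q"
proof -
  have "closed_segment P R \<subseteq> D"
    using assms by (simp add: closed_segment_subset)
  then show ?thesis
    using D unfolding segment_def
    by (intro closed) (auto simp: path_image_compose intro!: path_continuous_image elim: continuous_on_subset)
qed

lemma segment_trans:
  assumes D: "convex D" "continuous_on D \<Phi>" "\<Phi> ` D \<subseteq> A" and "P \<in> D" "R \<in> D" "S \<in> D"
  shows "segment \<Phi> P R \<otimes> segment \<Phi> R S = segment \<Phi> P S"
proof -
  have sub: "closed_segment P R \<subseteq> D" "closed_segment R S \<subseteq> D"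
    using assms by (simp_all add: closed_segment_subset)
  then have "segment \<Phi> P R \<otimes> segment \<Phi> R S = h ((\<Phi> \<circ> linepath P R) +++ (\<Phi> \<circ> linepath R S))"
    unfolding segment_def using D
    by (intro join[symmetric]) (auto simp: path_image_compose pathfinish_compose pathstart_compose intro!: path_continuous_image elim: continuous_on_subset)
  also have "\<dots> = h (\<Phi> \<circ> (linepath P R +++ linepath R S))"
    by (simp add: path_compose_join)
  also have "\<dots> = segment \<Phi> P S"
    using segment_path[OF D, of "linepath P R +++ linepath R S"] sub
    by (simp add: path_image_join)
  finally show ?thesis .
qed

lemma segment_refl:
  assumes D: "convex D" "continuous_on D \<Phi>" "\<Phi> ` D \<subseteq> A" and "P \<in> D"
  shows "segment \<Phi> P P = \<one>"
  using segment_trans[OF D, of P P P] segment_closed[OF D, of P P] assms by simp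

end

text \<open>A functor may be defined on the paths in each member of an open cover only. It is nevertheless trivial
  on a loop in one member that contracts in the union. Divide the unit square into small squares,
  each of which the contraction maps into one member of the cover. In each of them, the two ways
  along the boundary from the lower left to the upper right corner have the same transport. Hence
  the transport along a row of edges equals that along the next row, up to the transports along the
  left and right sides of the big square, where the contraction is constant. On the last row the
  contraction is constant as well.\<close>

lemma group_van_Kampen:
  fixes Q (structure) and H :: "real \<times> real \<Rightarrow> 'a::real_normed_vector"
  assumes U: "\<And>U. U \<in> \<U> \<Longrightarrow> open U \<and> path_functor Q U h"
    and H: "continuous_on ({0..1} \<times> {0..1}) H" "H ` ({0..1} \<times> {0..1}) \<subseteq> \<Union>\<U>"
    and A: "A \<in> \<U>" "(\<lambda>s. H (s, 0)) ` {0..1} \<subseteq> A"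
    and bd: "\<And>s. s \<in> {0..1} \<Longrightarrow> H (s, 1) = x" "\<And>t. t \<in> {0..1} \<Longrightarrow> H (0, t) = x"
      "\<And>t. t \<in> {0..1} \<Longrightarrow> H (1, t) = x"
  shows "h (\<lambda>s. H (s, 0)) = \<one>"
proof -
  let ?I = "{0..1} \<times> {0..1} :: (real \<times> real) set"
  interpret A: path_functor Q A h
    using U A(1) by blast
  have "\<exists>G. open G \<and> ?I \<inter> G = ?I \<inter> H -` U" if "U \<in> \<U>" for U
    using H(1) U[OF that] unfolding continuous_on_open_invariant by (metis Int_commute)
  then obtain G where G: "\<And>U. U \<in> \<U> \<Longrightarrow> open (G U)" "\<And>U. U \<in> \<U> \<Longrightarrow> ?I \<inter> G U = ?I \<inter> H -` U"
    by metis
  have cI: "compact ?I" by (intro compact_Times compact_Icc)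
  obtain e where e: "e > 0" "\<And>z. z \<in> ?I \<Longrightarrow> \<exists>V \<in> G ` \<U>. ball z e \<subseteq> V"
  proof (rule Heine_Borel_lemma[OF cI])
    show "?I \<subseteq> \<Union> (G ` \<U>)"
    proof
      fix z assume z: "z \<in> ?I"
      then obtain U where "U \<in> \<U>" "H z \<in> U" using H(2) by blast
      then show "z \<in> \<Union> (G ` \<U>)" using G(2)[of U] z by blast
    qed
  qed (use G in auto)
  obtain N where N: "N > 0" "2 / real N < e"
  proof -
    obtain N where "2 / e < real N"
      using reals_Archimedean2 by blast
    moreover have "0 < 2 / e" using e(1) by simp
    ultimately have "N > 0" using of_nat_0_less_iff[of N, where 'a=real] by linarith
    then show ?thesis
      using e(1) \<open>2 / e < real N\<close> by (intro that[of N]) (auto simp: field_simps)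
  qed
  define v :: "nat \<Rightarrow> nat \<Rightarrow> real \<times> real" where "v i j = (real i / N, real j / N)" for i j
  define E where "E i j = A.segment H (v i j) (v (Suc i) j)" for i j
  define F where "F i j = A.segment H (v i j) (v i (Suc j))" for i j
  have sq: "E i j \<otimes> F (Suc i) j = F i j \<otimes> E i (Suc j)" "E i j \<in> carrier Q" "F i j \<in> carrier Q"
      "E i (Suc j) \<in> carrier Q" "F (Suc i) j \<in> carrier Q"
      if ij: "i < N" "j < N" for i j
  proof -
    let ?D = "ball (v i j) e \<inter> ?I"
    have vI: "v i j \<in> ?I" "v (Suc i) j \<in> ?I" "v i (Suc j) \<in> ?I" "v (Suc i) (Suc j) \<in> ?I"
      using ij by (auto simp: v_def)
    obtain U where U': "U \<in> \<U>" "ball (v i j) e \<subseteq> G U"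
      using e(2)[OF vI(1)] by blast
    interpret U: path_functor Q U h
      using U U' by blast
    have D: "convex ?D" "continuous_on ?D H" "H ` ?D \<subseteq> U"
      using U' G(2)[OF U'(1)] by (auto intro!: convex_Int convex_Times intro: continuous_on_subset[OF H(1)])
    have near: "w \<in> ball (v i j) e" if "w = (real i / N + a, real j / N + b)" "\<bar>a\<bar> \<le> 1 / N" "\<bar>b\<bar> \<le> 1 / N" for w a b
    proof -
      have "dist (v i j) w \<le> dist (fst (v i j)) (fst w) + dist (snd (v i j)) (snd w)"
        by (simp add: dist_prod_def sqrt_sum_squares_le_sum)
      also have "\<dots> \<le> 1 / N + 1 / N"
        using that by (intro add_mono) (auto simp: v_def dist_real_def)
      also have "\<dots> < e" using N by simp
      finally show ?thesis by simp
    qed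
    have vD: "v i j \<in> ?D" "v (Suc i) j \<in> ?D" "v i (Suc j) \<in> ?D" "v (Suc i) (Suc j) \<in> ?D"
      using vI near[of "v i j" 0 0] near[of "v (Suc i) j" "1/N" 0] near[of "v i (Suc j)" 0 "1/N"]
        near[of "v (Suc i) (Suc j)" "1/N" "1/N"] by (simp_all add: v_def add_divide_distrib)
    show "E i j \<otimes> F (Suc i) j = F i j \<otimes> E i (Suc j)"
      unfolding E_def F_def using vD by (simp only: U.segment_trans[OF D])
    show "E i j \<in> carrier Q" "F i j \<in> carrier Q" "E i (Suc j) \<in> carrier Q" "F (Suc i) j \<in> carrier Q"
      unfolding E_def F_def using vD U.segment_closed[OF D] by metis+
  qed
  have pI: "path (H \<circ> linepath P R)" "path_image (H \<circ> linepath P R) \<subseteq> H ` closed_segment P R"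
    if "P \<in> ?I" "R \<in> ?I" for P R
  proof -
    have "closed_segment P R \<subseteq> ?I"
      using that by (intro closed_segment_subset convex_Times) auto
    then show "path (H \<circ> linepath P R)" "path_image (H \<circ> linepath P R) \<subseteq> H ` closed_segment P R"
      by (auto simp: path_image_compose intro!: path_continuous_image intro: continuous_on_subset[OF H(1)])
  qed
  have xA: "x \<in> A" using A(2) bd(2)[of 0] by force
  have const: "A.segment H P R = \<one>" if "P \<in> ?I" "R \<in> ?I" "\<And>z. z \<in> closed_segment P R \<Longrightarrow> H z = x" for P R
    unfolding A.segment_def
  proof (rule A.const[of _ x])
    show "path_image (H \<circ> linepath P R) \<subseteq> A"
      using pI(2)[OF that(1,2)] that(3) xA by auto
    show "(H \<circ> linepath P R) t = x" if "t \<in> {0..1}" for t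
      using \<open>\<And>z. z \<in> closed_segment P R \<Longrightarrow> H z = x\<close> that linepath_in_path by fastforce
  qed (use pI that in auto)
  have seg_snd: "snd z \<in> {0..1}" "fst z = fst P" if "z \<in> closed_segment P R" "fst P = fst R" "P \<in> ?I" "R \<in> ?I" for z and P R :: "real \<times> real"
  proof -
    have "closed_segment P R \<subseteq> {fst P} \<times> {0..1}"
      using that by (intro closed_segment_subset convex_Times) (auto simp: mem_Times_iff)
    from subsetD[OF this that(1)] show "snd z \<in> {0..1}" "fst z = fst P" by (auto simp: mem_Times_iff)
  qed
  have seg_fst: "fst z \<in> {0..1}" "snd z = snd P" if "z \<in> closed_segment P R" "snd P = snd R" "P \<in> ?I" "R \<in> ?I" for z and P R :: "real \<times> real"
  proof -
    have "closed_segment P R \<subseteq> {0..1} \<times> {snd P}"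
      using that by (intro closed_segment_subset convex_Times) (auto simp: mem_Times_iff)
    from subsetD[OF this that(1)] show "fst z \<in> {0..1}" "snd z = snd P" by (auto simp: mem_Times_iff)
  qed
  have F0: "F 0 j = \<one>" if "j < N" for j
    unfolding F_def
  proof (rule const)
    fix z assume "z \<in> closed_segment (v 0 j) (v 0 (Suc j))"
    then have "snd z \<in> {0..1}" "fst z = 0"
      using seg_snd[of z "v 0 j" "v 0 (Suc j)"] that by (auto simp: v_def)
    then show "H z = x" using bd(2)[of "snd z"] by (metis prod.collapse)
  qed (use that in \<open>auto simp: v_def\<close>)
  have FN: "F N j = \<one>" if "j < N" for j
    unfolding F_def
  proof (rule const)
    fix z assume "z \<in> closed_segment (v N j) (v N (Suc j))"
    then have "snd z \<in> {0..1}" "fst z = 1"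
      using seg_snd[of z "v N j" "v N (Suc j)"] that by (auto simp: v_def)
    then show "H z = x" using bd(3)[of "snd z"] by (metis prod.collapse)
  qed (use that in \<open>auto simp: v_def\<close>)
  have EN: "E i N = \<one>" if "i < N" for i
    unfolding E_def
  proof (rule const)
    fix z assume "z \<in> closed_segment (v i N) (v (Suc i) N)"
    then have "fst z \<in> {0..1}" "snd z = 1"
      using seg_fst[of z "v i N" "v (Suc i) N"] that by (auto simp: v_def)
    then show "H z = x" using bd(1)[of "fst z"] by (metis prod.collapse)
  qed (use that in \<open>auto simp: v_def\<close>)
  \<comment> \<open>the transport along the first \<open>k\<close> edges of row \<open>j\<close>\<close>
  define R where "R j k = rec_nat \<one> (\<lambda>i a. a \<otimes> E i j) k" for j k
  have R0: "R j 0 = \<one>" and RS: "R j (Suc k) = R j k \<otimes> E k j" for j k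
    by (simp_all add: R_def)
  have Ecl: "E i j \<in> carrier Q" if "i < N" "j \<le> N" for i j
    using sq(2)[of i j] EN[of i] that by (cases "j = N") auto
  have Rcl: "R j k \<in> carrier Q" if "k \<le> N" "j \<le> N" for j k
    using that by (induction k) (auto simp: R0 RS Ecl)
  have Fcl: "F i j \<in> carrier Q" if "i \<le> N" "j < N" for i j
    using sq(3)[of i j] FN[of j] that by (cases "i = N") auto
  have row: "R j k \<otimes> F k j = R (Suc j) k" if "k \<le> N" "j < N" for j k
    using that
  proof (induction k)
    case 0
    then show ?case by (simp add: R0 F0)
  next
    case (Suc k)
    then have "R j (Suc k) \<otimes> F (Suc k) j = R j k \<otimes> (E k j \<otimes> F (Suc k) j)"
      by (simp add: RS A.m_assoc Rcl Ecl Fcl)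
    also have "\<dots> = R j k \<otimes> (F k j \<otimes> E k (Suc j))"
      using Suc.prems by (simp add: sq(1))
    also have "\<dots> = (R j k \<otimes> F k j) \<otimes> E k (Suc j)"
      using Suc.prems by (intro A.m_assoc[symmetric]) (simp_all add: Rcl Ecl Fcl)
    also have "\<dots> = R (Suc j) (Suc k)"
      using Suc by (simp add: RS)
    finally show ?case .
  qed
  have RN: "R j N = R 0 N" if "j \<le> N" for j
    using that
  proof (induction j)
    case (Suc j)
    then have "R (Suc j) N = R j N \<otimes> F N j"
      using row[of N j] by simp
    then show ?case
      using Suc by (simp add: FN Rcl)
  qed simp
  have R1: "R N k = \<one>" if "k \<le> N" for k
    using that by (induction k) (auto simp: R0 RS EN)
  have "R 0 N = \<one>"
    using RN[of N] R1[of N] by simp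
  have D0: "convex ({0..1::real} \<times> {0::real})" "continuous_on ({0..1} \<times> {0}) H" "H ` ({0..1} \<times> {0}) \<subseteq> A"
    using A(2) by (auto intro!: convex_Times intro: continuous_on_subset[OF H(1)])
  have v0: "v i 0 \<in> {0..1} \<times> {0}" if "i \<le> N" for i
    using that N by (auto simp: v_def divide_le_eq_1)
  have "R 0 k = A.segment H (v 0 0) (v k 0)" if "k \<le> N" for k
    using that
  proof (induction k)
    case 0
    then show ?case using A.segment_refl[OF D0 v0] by (simp add: R0)
  next
    case (Suc k)
    then show ?case using A.segment_trans[OF D0 v0 v0 v0, of 0 k "Suc k"] by (simp add: RS E_def)
  qed
  then have "A.segment H (0, 0) (1, 0) = \<one>"
    using \<open>R 0 N = \<one>\<close> N by (simp add: v_def zero_prod_def)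
  moreover have "h (\<lambda>s. H (s, 0)) = A.segment H (0, 0) (1, 0)"
  proof -
    have "path (\<lambda>s::real. (s, 0::real))" "path_image (\<lambda>s. (s, 0::real)) \<subseteq> {0..1} \<times> {0}"
      by (auto simp: path_def path_image_def intro!: continuous_intros)
    from A.segment_path[OF D0 this] show ?thesis
      by (simp add: o_def pathstart_def pathfinish_def)
  qed
  ultimately show ?thesis by simp
qed

lemma homotopic_paths_join_cancel:
  fixes a :: "real \<Rightarrow> 'a::real_normed_vector"
  assumes "path a" "path_image a \<subseteq> S" "path p" "path_image p \<subseteq> S" "path b" "path_image b \<subseteq> S"
    "path q" "path_image q \<subseteq> S" "path c" "path_image c \<subseteq> S"
    "pathfinish a = pathstart p" "pathfinish p = pathfinish b" "pathfinish b = pathstart q" "pathfinish q = pathfinish c"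
  shows "homotopic_paths S (((a +++ p) +++ reversepath b) +++ ((b +++ q) +++ reversepath c)) ((a +++ (p +++ q)) +++ reversepath c)"
    (is "homotopic_paths S (?X +++ ?Y) _")
proof -
  note [trans] = homotopic_paths_trans
  let ?b = "reversepath b" and ?c = "reversepath c"
  note simps = assms path_image_join path_image_reversepath
  have bY: "homotopic_paths S (?b +++ ?Y) (?b +++ (b +++ (q +++ ?c)))"
    by (rule homotopic_paths_join, simp add: simps, rule homotopic_paths_sym[OF homotopic_paths_assoc])
      (simp_all add: simps)
  have "homotopic_paths S (?X +++ ?Y) ((a +++ p) +++ (?b +++ ?Y))"
    by (rule homotopic_paths_sym[OF homotopic_paths_assoc]) (simp_all add: simps)
  also have "homotopic_paths S \<dots> ((a +++ p) +++ (?b +++ (b +++ (q +++ ?c))))"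
    by (rule homotopic_paths_join[OF _ bY]) (simp_all add: simps)
  also have "homotopic_paths S \<dots> ((a +++ p) +++ ((?b +++ b) +++ (q +++ ?c)))"
    by (rule homotopic_paths_join[OF _ homotopic_paths_assoc]) (simp_all add: simps)
  also have "homotopic_paths S \<dots> ((a +++ p) +++ (linepath (pathstart q) (pathstart q) +++ (q +++ ?c)))"
    using homotopic_paths_linv[of b S]
    by (intro homotopic_paths_join[where p="a +++ p"] homotopic_paths_join[where q="q +++ ?c"]) (simp_all add: simps)
  also have "homotopic_paths S \<dots> ((a +++ p) +++ (q +++ ?c))"
    using homotopic_paths_lid[of "q +++ ?c" S]
    by (intro homotopic_paths_join[where p="a +++ p"]) (simp_all add: simps)
  also have "homotopic_paths S \<dots> (((a +++ p) +++ q) +++ ?c)"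
    by (rule homotopic_paths_assoc) (simp_all add: simps)
  also have "homotopic_paths S \<dots> ((a +++ (p +++ q)) +++ ?c)"
    by (rule homotopic_paths_join[OF homotopic_paths_sym[OF homotopic_paths_assoc]]) (simp_all add: simps)
  finally show ?thesis .
qed

definition basing_paths :: "'a::real_normed_vector set \<Rightarrow> 'a \<Rightarrow> ('a \<Rightarrow> real \<Rightarrow> 'a) \<Rightarrow> bool" where
  "basing_paths S x c \<longleftrightarrow> (\<forall>y. path_component S x y \<longrightarrow>
     path (c y) \<and> path_image (c y) \<subseteq> S \<and> pathstart (c y) = x \<and> pathfinish (c y) = y)"

definition close_up :: "('a::real_normed_vector \<Rightarrow> real \<Rightarrow> 'a) \<Rightarrow> (real \<Rightarrow> 'a) \<Rightarrow> real \<Rightarrow> 'a" where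
  "close_up c p = (c (pathstart p) +++ p) +++ reversepath (c (pathfinish p))"

text \<open>A homomorphism \<open>\<theta>\<close> on the fundamental group extends to all paths, once these are closed up by a
  choice \<open>c\<close> of paths from the base point. Paths in other components cannot be closed up and are
  sent to \<open>\<one>\<close>.\<close>

definition transport where
  "transport Q S x \<theta> c p =
     (if path_component S x (pathstart p) then \<theta> (homotopy_class S (close_up c p)) else \<one>\<^bsub>Q\<^esub>)"

lemma path_component_ends:
  assumes "path p" "path_image p \<subseteq> S"
  shows "path_component S x (pathfinish p) \<longleftrightarrow> path_component S x (pathstart p)"
proof -
  have "path_component S (pathstart p) (pathfinish p)"
    using assms unfolding path_component_def by blast
  then show ?thesis
    using path_component_trans path_component_sym by blast
qed

lemma close_up_loop:
  assumes c: "basing_paths S x c" and p: "path p" "path_image p \<subseteq> S" "path_component S x (pathstart p)"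
  shows "close_up c p \<in> loops S x"
  using assms path_component_ends[OF p(1,2), of x]
  by (auto simp: basing_paths_def close_up_def loops_def path_image_join)

lemma path_functor_transport:
  fixes Q (structure)
  assumes "group Q" and x: "x \<in> S" and \<theta>: "\<theta> \<in> hom (fundamental_group S x) Q" and c: "basing_paths S x c"
  shows "path_functor Q S (transport Q S x \<theta> c)"
proof -
  interpret group Q by fact
  let ?G = "fundamental_group S x"
  have car: "homotopy_class S (close_up c p) \<in> carrier ?G"
    if "path p" "path_image p \<subseteq> S" "path_component S x (pathstart p)" for p
    using close_up_loop[OF c that] by (simp add: fundamental_group_def)
  show ?thesis
  proof
    fix p assume "path p" "path_image p \<subseteq> S"
    then show "transport Q S x \<theta> c p \<in> carrier Q"
      using car \<theta> by (auto simp: transport_def hom_def)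
  next
    fix p q assume pq: "path p" "path_image p \<subseteq> S" "path q" "path_image q \<subseteq> S" "pathfinish p = pathstart q"
    show "transport Q S x \<theta> c (p +++ q) = transport Q S x \<theta> c p \<otimes> transport Q S x \<theta> c q"
    proof (cases "path_component S x (pathstart p)")
      case True
      then have q: "path_component S x (pathstart q)" "path_component S x (pathfinish q)"
        using pq path_component_ends by metis+
      have "homotopic_paths S (close_up c p +++ close_up c q) (close_up c (p +++ q))"
        unfolding close_up_def
        using homotopic_paths_join_cancel[of "c (pathstart p)" S p "c (pathfinish p)" q "c (pathfinish q)"] c pq True q
        by (auto simp: basing_paths_def)
      then have "homotopy_class S (close_up c (p +++ q)) = homotopy_class S (close_up c p +++ close_up c q)"
        by (simp add: homotopy_class_cong)
      also have "\<dots> = homotopy_class S (close_up c p) \<otimes>\<^bsub>?G\<^esub> homotopy_class S (close_up c q)"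
        using close_up_loop[OF c] pq True q by (simp add: fundamental_group_mult)
      finally show ?thesis
        using True q \<theta> car pq by (simp add: transport_def hom_mult)
    next
      case False
      then have "\<not> path_component S x (pathstart q)"
        using pq path_component_ends by metis
      then show ?thesis using False by (simp add: transport_def)
    qed
  next
    fix p q assume pq: "homotopic_paths S p q"
    then have ends: "pathstart p = pathstart q" "pathfinish p = pathfinish q"
      by (simp_all add: homotopic_paths_imp_pathstart homotopic_paths_imp_pathfinish)
    have im: "path p" "path_image p \<subseteq> S"
      using pq homotopic_paths_imp_path homotopic_paths_imp_subset by blast+
    show "transport Q S x \<theta> c p = transport Q S x \<theta> c q"
    proof (cases "path_component S x (pathstart p)")
      case True
      then have q: "path_component S x (pathfinish p)"
        using im path_component_ends by metis
      have "homotopic_paths S (close_up c p) (close_up c q)"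
        unfolding close_up_def ends[symmetric] using c True q pq
        by (intro homotopic_paths_join) (auto simp: basing_paths_def)
      then show ?thesis
        using True ends by (simp add: transport_def homotopy_class_cong)
    qed (simp add: transport_def ends)
  qed
qed

lemma transport_loop:
  assumes "p \<in> loops S x" "c x = linepath x x" "x \<in> S"
  shows "transport Q S x \<theta> c p = \<theta> (homotopy_class S p)"
proof -
  have p: "path p" "path_image p \<subseteq> S" "pathstart p = x" "pathfinish p = x"
    using assms by (simp_all add: loops_def)
  have "homotopic_paths S (linepath x x +++ p) p"
    using homotopic_paths_lid[of p S] p by simp
  moreover have "homotopic_paths S ((linepath x x +++ p) +++ linepath x x) (linepath x x +++ p)"
    using homotopic_paths_rid[of "linepath x x +++ p" S] p assms(3) by (simp add: path_image_join)
  ultimately have "homotopic_paths S ((linepath x x +++ p) +++ linepath x x) p"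
    using homotopic_paths_trans by blast
  then show ?thesis
    using p assms by (simp add: transport_def close_up_def homotopy_class_cong path_component_refl)
qed

text \<open>The paths \<open>c\<close> may be chosen so that the transport along prescribed paths becomes trivial.\<close>

lemma transport_basing_path:
  assumes "group Q" and \<theta>: "\<theta> \<in> hom (fundamental_group S x) Q" and c: "basing_paths S x c" and x: "x \<in> S"
    and p: "path p" "path_image p \<subseteq> S" "c (pathfinish p) = c (pathstart p) +++ p"
  shows "transport Q S x \<theta> c p = \<one>\<^bsub>Q\<^esub>"
proof (cases "path_component S x (pathstart p)")
  case True
  have G: "group (fundamental_group S x)" by (rule group_fundamental_group[OF x])
  have "homotopic_paths S (close_up c p) (linepath x x)"
    using homotopic_paths_rinv[of "c (pathstart p) +++ p" S] True c p
    by (simp add: close_up_def basing_paths_def path_image_join)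
  then have "homotopy_class S (close_up c p) = \<one>\<^bsub>fundamental_group S x\<^esub>"
    by (simp add: homotopy_class_cong fundamental_group_def linepath_refl)
  then show ?thesis
    using True hom_one[OF \<theta> G assms(1)] by (simp add: transport_def)
qed (simp add: transport_def)


section \<open>Fundamental groups\<close>

lemma basing_paths_exist:
  obtains c where "basing_paths S x c" "c x = linepath x x"
proof -
  define c where "c y = (if y = x then linepath x x else
     (SOME g. path g \<and> path_image g \<subseteq> S \<and> pathstart g = x \<and> pathfinish g = y))" for y
  have "basing_paths S x c"
    unfolding basing_paths_def
  proof (intro allI impI)
    fix y assume y: "path_component S x y"
    show "path (c y) \<and> path_image (c y) \<subseteq> S \<and> pathstart (c y) = x \<and> pathfinish (c y) = y"
    proof (cases "y = x")
      case True
      then show ?thesis using path_component_mem(1)[OF y] by (simp add: c_def)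
    next
      case False
      have "\<exists>g. path g \<and> path_image g \<subseteq> S \<and> pathstart g = x \<and> pathfinish g = y"
        using y by (simp add: path_component_def)
      from someI_ex[OF this] show ?thesis using False by (simp add: c_def)
    qed
  qed
  then show ?thesis by (intro that[of c]) (auto simp: c_def)
qed

text \<open>The map of fundamental groups induced by \<open>f\<close>. The choice of a representative is immaterial by
  \<open>homotopy_class_cong\<close>.\<close>

definition induced :: "'b::topological_space set \<Rightarrow> ('a::topological_space \<Rightarrow> 'b) \<Rightarrow> (real \<Rightarrow> 'a) set \<Rightarrow> (real \<Rightarrow> 'b) set" where
  "induced T f K = homotopy_class T (f \<circ> (SOME p. p \<in> K))"

lemma induced_class:
  assumes "continuous_on S f" "f ` S \<subseteq> T" "p \<in> loops S x"
  shows "induced T f (homotopy_class S p) = homotopy_class T (f \<circ> p)"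
proof -
  have "p \<in> homotopy_class S p"
    using assms(3) by (simp add: homotopy_class_def loops_def)
  then have "(SOME q. q \<in> homotopy_class S p) \<in> homotopy_class S p"
    by (rule someI[where P="\<lambda>q. q \<in> homotopy_class S p"])
  then have "homotopic_paths S p (SOME q. q \<in> homotopy_class S p)"
    by (simp add: homotopy_class_def)
  then have "homotopic_paths T (f \<circ> p) (f \<circ> (SOME q. q \<in> homotopy_class S p))"
    using assms by (intro homotopic_paths_continuous_image) auto
  then show ?thesis
    unfolding induced_def by (simp add: homotopy_class_cong)
qed

lemma loops_image: "continuous_on S f \<Longrightarrow> f ` S \<subseteq> T \<Longrightarrow> p \<in> loops S x \<Longrightarrow> f \<circ> p \<in> loops T (f x)"
  by (auto simp: loops_def path_image_compose pathstart_compose pathfinish_compose intro!: path_continuous_image elim: continuous_on_subset)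

lemma loops_join: "p \<in> loops S x \<Longrightarrow> q \<in> loops S x \<Longrightarrow> p +++ q \<in> loops S x"
  by (simp add: loops_def path_image_join)

lemma carrier_fundamental_group: "carrier (fundamental_group S x) = homotopy_class S ` loops S x"
  by (simp add: fundamental_group_def)

lemma induced_hom:
  assumes "continuous_on S f" "f ` S \<subseteq> T"
  shows "induced T f \<in> hom (fundamental_group S x) (fundamental_group T (f x))"
proof (rule homI)
  fix a assume "a \<in> carrier (fundamental_group S x)"
  then show "induced T f a \<in> carrier (fundamental_group T (f x))"
    using induced_class[OF assms] loops_image[OF assms] by (auto simp: carrier_fundamental_group)
next
  fix a b assume "a \<in> carrier (fundamental_group S x)" "b \<in> carrier (fundamental_group S x)"
  then obtain p q where pq: "p \<in> loops S x" "q \<in> loops S x" "a = homotopy_class S p" "b = homotopy_class S q"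
    by (auto simp: carrier_fundamental_group)
  then show "induced T f (a \<otimes>\<^bsub>fundamental_group S x\<^esub> b)
      = induced T f a \<otimes>\<^bsub>fundamental_group T (f x)\<^esub> induced T f b"
    using induced_class[OF assms] loops_image[OF assms] induced_class[OF assms loops_join[OF pq(1,2)]]
    by (simp add: fundamental_group_mult path_compose_join)
qed

text \<open>Choose finitely many points \<open>n y\<close> of \<open>C\<close>, one close to each point \<open>y\<close> of \<open>C\<close>, so close that larger
  balls around them still lie in \<open>A\<close>. A loop in \<open>C\<close> is cut into short pieces. Replacing each
  endpoint \<open>y\<close> of a piece by \<open>n y\<close> within such a ball turns the transport along the piece into that
  along a segment between two of the chosen points. There are finitely many such segments.\<close>

lemma finitely_generated_loops:
  fixes A :: "'a::euclidean_space set"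
  assumes A: "open A" and C: "compact C" "C \<subseteq> A" "x \<in> C"
  obtains Gs where "finite Gs" "Gs \<subseteq> carrier (fundamental_group A x)"
    "\<And>p. p \<in> loops C x \<Longrightarrow> homotopy_class A p \<in> generate (fundamental_group A x) Gs"
proof -
  let ?G = "fundamental_group A x"
  have xA: "x \<in> A" using C by blast
  interpret G: group ?G by (rule group_fundamental_group[OF xA])
  obtain c where c: "basing_paths A x c" "c x = linepath x x" by (rule basing_paths_exist)
  define h where "h = transport ?G A x id c"
  have id: "id \<in> hom ?G ?G" by (simp add: hom_def)
  interpret h: path_functor ?G A h
    unfolding h_def by (rule path_functor_transport[OF G.group_axioms xA id c(1)])
  obtain e where e: "e > 0" "\<And>y. y \<in> C \<Longrightarrow> ball y e \<subseteq> A"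
    using Heine_Borel_lemma[OF C(1), of "{A}"] C(2) A by auto
  obtain Y where Y: "Y \<subseteq> C" "finite Y" "C \<subseteq> (\<Union>y\<in>Y. ball y (e / 4))"
  proof (rule compactE_image[OF C(1), of C "\<lambda>y. ball y (e / 4)"])
    show "C \<subseteq> (\<Union>y\<in>C. ball y (e / 4))" using e(1) by auto
  qed auto
  have "\<exists>z\<in>Y. y \<in> ball z (e / 4)" if "y \<in> C" for y
    using Y(3) that by blast
  then obtain n where n: "\<And>y. y \<in> C \<Longrightarrow> n y \<in> Y" "\<And>y. y \<in> C \<Longrightarrow> dist (n y) y < e / 4"
    by (metis mem_ball)
  define k where "k y = h (linepath (n y) y)" for y
  define Gs where "Gs = insert (k x) ((\<lambda>(a, b). h (linepath a b)) ` {(a, b). a \<in> Y \<and> b \<in> Y \<and> dist a b < e})"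
  have seg: "closed_segment a b \<subseteq> A" if "a \<in> C" "dist a b < e" for a b
  proof -
    have "closed_segment a b \<subseteq> ball a e"
      using that e(1) by (intro closed_segment_subset) auto
    then show ?thesis using e(2)[OF that(1)] by blast
  qed
  have nC: "n y \<in> C" if "y \<in> C" for y using n(1)[OF that] Y(1) by blast
  have kG: "k y \<in> carrier ?G" if "y \<in> C" for y
    unfolding k_def using seg[OF nC[OF that], of y] n(2)[OF that] e(1) by (intro h.closed) auto
  have fin: "finite Gs"
  proof -
    have "finite {(a, b). a \<in> Y \<and> b \<in> Y \<and> dist a b < e}"
      by (rule finite_subset[OF _ finite_cartesian_product[OF Y(2) Y(2)]]) auto
    then show ?thesis by (simp add: Gs_def)
  qed
  have sub: "Gs \<subseteq> carrier ?G"
  proof -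
    have "h (linepath a b) \<in> carrier ?G" if "a \<in> Y" "dist a b < e" for a b
      using seg[of a b] Y(1) that by (intro h.closed) auto
    then show ?thesis using kG[OF C(3)] by (auto simp: Gs_def)
  qed
  have step: "\<exists>g\<in>Gs. k y \<otimes>\<^bsub>?G\<^esub> h q = g \<otimes>\<^bsub>?G\<^esub> k y' \<and> h q \<in> carrier ?G"
    if y: "y \<in> C" "y' \<in> C" and q: "path q" "path_image q \<subseteq> ball y (e / 4)" "pathstart q = y" "pathfinish q = y'" for y y' q
  proof -
    let ?D = "ball (n y) e"
    have D: "convex ?D" "continuous_on ?D (\<lambda>x. x)" "(\<lambda>x. x) ` ?D \<subseteq> A"
      using e(2)[OF nC[OF y(1)]] by auto
    have inD: "z \<in> ?D" if "dist y z < e / 2" for z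
      using dist_triangle[of "n y" z y] n(2)[OF y(1)] that e(1) by simp
    have "y' \<in> ball y (e / 4)" using q by (metis pathfinish_in_path_image subsetD)
    then have y': "dist y y' < e / 4" by simp
    have ny': "dist y (n y') < e / 2"
      using dist_triangle[of y "n y'" y'] n(2)[OF y(2)] y' by (simp add: dist_commute)
    have mem: "n y \<in> ?D" "y \<in> ?D" "y' \<in> ?D" "n y' \<in> ?D"
      using e(1) inD[of y] inD[of y'] inD[OF ny'] y' by auto
    have qD: "path_image q \<subseteq> ?D"
      using q(2) inD e(1) by (force simp: subset_iff)
    have hq: "h q = h.segment (\<lambda>x. x) y y'"
      using h.segment_path[OF D q(1) qD] q by (simp add: o_def)
    have seg_id: "h.segment (\<lambda>x. x) a b = h (linepath a b)" for a b
      by (simp add: h.segment_def o_def)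
    have "k y \<otimes>\<^bsub>?G\<^esub> h q = h (linepath (n y) (n y')) \<otimes>\<^bsub>?G\<^esub> k y'"
      unfolding hq k_def seg_id[symmetric] using mem by (simp add: h.segment_trans[OF D])
    moreover have "dist (n y) (n y') < e" using mem(4) by simp
    then have "h (linepath (n y) (n y')) \<in> Gs"
      using n(1) y unfolding Gs_def by auto
    moreover have "h q \<in> carrier ?G"
      unfolding hq using mem by (intro h.segment_closed[OF D])
    ultimately show ?thesis by blast
  qed
  have "homotopy_class A p \<in> generate ?G Gs" if p: "p \<in> loops C x" for p
  proof -
    have p': "path p" "path_image p \<subseteq> C" "p 0 = x" "p 1 = x"
      using p by (auto simp: loops_def pathstart_def pathfinish_def)
    then have pA: "path_image p \<subseteq> A" using C(2) by blast
    have pC: "p t \<in> C" if "t \<in> {0..1}" for t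
      using p'(2) that by (auto simp: path_image_def)
    have "uniformly_continuous_on {0..1} p"
      using p'(1) by (intro compact_uniformly_continuous) (auto simp: path_def)
    then obtain d where d: "d > 0" "\<And>s t. s \<in> {0..1} \<Longrightarrow> t \<in> {0..1} \<Longrightarrow> dist t s < d \<Longrightarrow> dist (p t) (p s) < e / 4"
      using e(1) unfolding uniformly_continuous_on_def by (metis zero_less_divide_iff zero_less_numeral)
    obtain N :: nat where N: "1 / d < real N" using reals_Archimedean2 by blast
    moreover have "0 < 1 / d" using d(1) by simp
    ultimately have N0: "N > 0" using of_nat_0_less_iff[of N, where 'a=real] by linarith
    have Nd: "1 / real N < d" using N N0 d(1) by (simp add: field_simps)
    have unit: "real i / real N \<in> {0..1}" if "i \<le> N" for i
      using that N0 by (auto simp: divide_le_eq_1)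
    \<comment> \<open>the factors \<open>k\<close> at the ends of consecutive pieces cancel\<close>
    have main: "\<exists>w\<in>generate ?G Gs. k x \<otimes>\<^bsub>?G\<^esub> h (subpath 0 (real i / N) p) = w \<otimes>\<^bsub>?G\<^esub> k (p (real i / N))"
      if "i \<le> N" for i
      using that
    proof (induction i)
      case 0
      have "h (subpath 0 (real 0 / N) p) = \<one>\<^bsub>?G\<^esub>"
        using pA p' xA by (intro h.const[of _ x]) (auto simp: subpath_def path_image_def path_def)
      then show ?case
        using kG[OF C(3)] p'(3) generate.one[of ?G Gs] by (intro bexI[of _ "\<one>\<^bsub>?G\<^esub>"]) auto
    next
      case (Suc i)
      let ?s = "real i / N" and ?t = "real (Suc i) / N"
      have st: "?s \<in> {0..1}" "?t \<in> {0..1}" "?s \<le> ?t" "?t - ?s = 1 / N"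
        using unit[of i] unit[of "Suc i"] Suc.prems by (simp_all add: divide_right_mono diff_divide_distrib[symmetric])
      let ?q = "subpath ?s ?t p"
      have q: "path ?q" "pathstart ?q = p ?s" "pathfinish ?q = p ?t"
        using p'(1) st by (auto intro: path_subpath)
      have "path_image ?q = p ` {?s..?t}"
        using st(3) by (simp add: path_image_subpath closed_segment_eq_real_ivl)
      also have "\<dots> \<subseteq> ball (p ?s) (e / 4)"
      proof (rule image_subsetI)
        fix u assume "u \<in> {?s..?t}"
        then have u: "?s \<le> u" "u \<le> ?t" by simp_all
        have "0 \<le> ?s" by simp
        then have "0 \<le> u" using u(1) by (rule order_trans)
        then have "u \<in> {0..1}" "dist ?s u < d"
          using u st Nd by (auto simp: dist_real_def)
        then show "p u \<in> ball (p ?s) (e / 4)"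
          using d(2)[of u ?s] st by simp
      qed
      finally have qb: "path_image ?q \<subseteq> ball (p ?s) (e / 4)" .
      obtain g where g: "g \<in> Gs" "k (p ?s) \<otimes>\<^bsub>?G\<^esub> h ?q = g \<otimes>\<^bsub>?G\<^esub> k (p ?t)" "h ?q \<in> carrier ?G"
        using step[OF pC[OF st(1)] pC[OF st(2)] q(1) qb q(2,3)] by blast
      obtain w where w: "w \<in> generate ?G Gs" "k x \<otimes>\<^bsub>?G\<^esub> h (subpath 0 ?s p) = w \<otimes>\<^bsub>?G\<^esub> k (p ?s)"
        using Suc.IH Suc.prems by auto
      have qA: "path_image ?q \<subseteq> A" "path (subpath 0 ?s p)" "path_image (subpath 0 ?s p) \<subseteq> A"
        using order_trans[OF path_image_subpath_subset[of ?s ?t p] pA] order_trans[OF path_image_subpath_subset[of 0 ?s p] pA]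
          p'(1) st(1,2) by (simp_all add: path_subpath del: of_nat_Suc)
      have "h (subpath 0 ?t p) = h (subpath 0 ?s p +++ ?q)"
        using homotopic_join_subpaths1[OF p'(1) pA, of 0 ?s ?t] st by (intro h.homotopic[symmetric]) auto
      also have "\<dots> = h (subpath 0 ?s p) \<otimes>\<^bsub>?G\<^esub> h ?q"
        using qA q by (intro h.join) auto
      finally have hh: "h (subpath 0 ?t p) = h (subpath 0 ?s p) \<otimes>\<^bsub>?G\<^esub> h ?q" .
      have cl: "h (subpath 0 ?s p) \<in> carrier ?G" "w \<in> carrier ?G" "g \<in> carrier ?G"
        "k x \<in> carrier ?G" "k (p ?s) \<in> carrier ?G" "k (p ?t) \<in> carrier ?G"
        using qA(2,3) w(1) G.generate_in_carrier[OF sub] g(1) sub kG C(3) pC[OF st(1)] pC[OF st(2)]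
        by (auto intro: h.closed simp del: of_nat_Suc)
      have "k x \<otimes>\<^bsub>?G\<^esub> h (subpath 0 ?t p) = (w \<otimes>\<^bsub>?G\<^esub> k (p ?s)) \<otimes>\<^bsub>?G\<^esub> h ?q"
        using cl g(3) by (simp add: hh G.m_assoc del: of_nat_Suc flip: w(2))
      also have "\<dots> = (w \<otimes>\<^bsub>?G\<^esub> g) \<otimes>\<^bsub>?G\<^esub> k (p ?t)"
        using cl g by (simp add: G.m_assoc del: of_nat_Suc)
      finally show ?case
        using w(1) g(1) by (intro bexI[of _ "w \<otimes>\<^bsub>?G\<^esub> g"]) (auto intro: generate.intros)
    qed
    obtain w where w: "w \<in> generate ?G Gs" "k x \<otimes>\<^bsub>?G\<^esub> h p = w \<otimes>\<^bsub>?G\<^esub> k x"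
      using main[of N] N0 p' by auto
    have cl: "w \<in> carrier ?G" "k x \<in> carrier ?G" "h p \<in> carrier ?G"
      using w(1) G.generate_in_carrier[OF sub] kG C(3) p' pA by (auto intro: h.closed)
    have "h p = inv\<^bsub>?G\<^esub> (k x) \<otimes>\<^bsub>?G\<^esub> (w \<otimes>\<^bsub>?G\<^esub> k x)"
      using cl by (simp add: G.inv_solve_left w(2)[symmetric])
    also have "\<dots> \<in> generate ?G Gs"
    proof (intro generate.eng w(1))
      have "k x \<in> Gs" by (simp add: Gs_def)
      then show "k x \<in> generate ?G Gs" "inv\<^bsub>?G\<^esub> (k x) \<in> generate ?G Gs"
        by (simp_all add: generate.incl generate.inv)
    qed
    finally have "h p \<in> generate ?G Gs" .
    moreover have "h p = homotopy_class A p"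
      unfolding h_def using transport_loop[of p A x c ?G id] p C(2) c xA by (auto simp: loops_def)
    ultimately show ?thesis by simp
  qed
  then show ?thesis using that fin sub by blast
qed

lemma (in group) generate_finite_support:
  assumes "a \<in> generate G S" "S \<subseteq> carrier G"
  shows "\<exists>F. finite F \<and> F \<subseteq> S \<and> a \<in> generate G F"
  using assms(1)
proof (induction rule: generate.induct)
  case one
  then show ?case by (intro exI[of _ "{}"]) (auto intro: generate.one)
next
  case (incl h)
  then show ?case by (intro exI[of _ "{h}"]) (auto intro: generate.incl)
next
  case (inv h)
  then show ?case by (intro exI[of _ "{h}"]) (auto intro: generate.inv)
next
  case (eng h1 h2)
  then obtain F1 F2 where F: "finite F1" "F1 \<subseteq> S" "h1 \<in> generate G F1" "finite F2" "F2 \<subseteq> S" "h2 \<in> generate G F2"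
    by blast
  then have "h1 \<in> generate G (F1 \<union> F2)" "h2 \<in> generate G (F1 \<union> F2)"
    using mono_generate[of F1 "F1 \<union> F2"] mono_generate[of F2 "F1 \<union> F2"] by blast+
  then show ?case
    using F by (intro exI[of _ "F1 \<union> F2"]) (auto intro: generate.eng)
qed

text \<open>The quotient by the normal closure of \<open>m\<close> is trivial by assumption, so the conjugates of \<open>m\<close>
  generate the group. Each of the finitely many generators is a product of finitely many conjugates
  and their inverses. The target groups \<open>Q\<close> have the type of quotients of \<open>G\<close>.\<close>

lemma (in group) finitely_many_conjugates_generate:
  assumes m: "m \<in> carrier G" and Gs: "finite Gs" "Gs \<subseteq> carrier G" "carrier G = generate G Gs"
    and triv: "\<And>(Q :: 'a set monoid) \<theta> a. group Q \<Longrightarrow> \<theta> \<in> hom G Q \<Longrightarrow> \<theta> m = \<one>\<^bsub>Q\<^esub> \<Longrightarrow> a \<in> carrier G \<Longrightarrow> \<theta> a = \<one>\<^bsub>Q\<^esub>"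
  obtains H where "finite H" "H \<subseteq> carrier G" "carrier G = generate G ((\<lambda>h. h \<otimes> m \<otimes> inv h) ` H)"
proof -
  define M where "M = (\<lambda>h. h \<otimes> m \<otimes> inv h) ` carrier G"
  have M: "M \<subseteq> carrier G" using m by (auto simp: M_def)
  have "generate G M \<lhd> G"
  proof (rule normal_generateI[OF M])
    fix h g assume "h \<in> M" and g: "g \<in> carrier G"
    then obtain k where k: "k \<in> carrier G" "h = k \<otimes> m \<otimes> inv k" by (auto simp: M_def)
    have "g \<otimes> h \<otimes> inv g = (g \<otimes> k) \<otimes> m \<otimes> inv (g \<otimes> k)"
      using g k m by (simp add: m_assoc inv_mult_group)
    then show "g \<otimes> h \<otimes> inv g \<in> M" using g k(1) by (auto simp: M_def)
  qed
  then interpret N: normal "generate G M" G .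
  have "\<one> \<otimes> m \<otimes> inv \<one> \<in> M" unfolding M_def by (rule imageI) simp
  then have "m \<in> generate G M" using m by (intro generate.incl) simp
  then have "generate G M #> m = generate G M"
    using N.subgroup_axioms m by (simp add: coset_join2)
  then have "generate G M #> a = generate G M" if "a \<in> carrier G" for a
    using triv[OF N.factorgroup_is_group N.r_coset_hom_Mod _ that] by (simp add: FactGroup_def)
  then have all: "a \<in> generate G M" if "a \<in> carrier G" for a
    using rcos_self[OF that N.subgroup_axioms] that by blast
  have "\<exists>F. finite F \<and> F \<subseteq> M \<and> a \<in> generate G F" if "a \<in> Gs" for a
    using generate_finite_support[OF all M] that Gs(2) by blast
  then obtain F where F: "\<And>a. a \<in> Gs \<Longrightarrow> finite (F a) \<and> F a \<subseteq> M \<and> a \<in> generate G (F a)"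
    by metis
  let ?F = "\<Union>a\<in>Gs. F a"
  have "finite ?F" "?F \<subseteq> M" using F Gs(1) by auto
  then obtain H where H: "H \<subseteq> carrier G" "finite H" "?F = (\<lambda>h. h \<otimes> m \<otimes> inv h) ` H"
    unfolding M_def by (meson finite_subset_image)
  have "Gs \<subseteq> generate G ?F"
    using F mono_generate[of _ ?F] by blast
  moreover have sub: "?F \<subseteq> carrier G" using \<open>?F \<subseteq> M\<close> M by blast
  ultimately have "generate G Gs \<subseteq> generate G ?F"
    by (intro generate_subgroup_incl generate_is_subgroup)
  then have "carrier G = generate G ?F"
    using Gs(3) generate_incl[OF sub] by blast
  then show ?thesis
    using H that by simp
qed


section \<open>The exterior of an embedded solid torus\<close>

lemma unit_periodic_int:
  fixes f :: "real \<Rightarrow> 'b"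
  assumes "\<And>t. f (t + 1) = f t"
  shows "f (t + of_int n) = f t"
proof -
  have *: "f (t + real k) = f t" for k t
  proof (induction k)
    case (Suc k)
    have "t + real (Suc k) = (t + real k) + 1" by simp
    then show ?case using Suc assms[of "t + real k"] by (simp only:)
  qed simp
  show ?thesis
  proof (cases "n \<ge> 0")
    case True
    then show ?thesis using *[of t "nat n"] by simp
  next
    case False
    then show ?thesis using *[of "t + of_int n" "nat (- n)"] by simp
  qed
qed

text \<open>The topological content of a tubular neighborhood parametrization: an embedding of the open solid
  torus of radius \<open>r > 1\<close>, written on its universal cover.\<close>

locale solid_torus =
  fixes \<tau> :: "real \<times> complex \<Rightarrow> real^3" and r :: real
  assumes r: "r > 1"
    and cont: "continuous_on (UNIV \<times> ball 0 r) \<tau>"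
    and periodic: "z \<in> ball 0 r \<Longrightarrow> \<tau> (t + 1, z) = \<tau> (t, z)"
    and inj: "inj_on \<tau> ({0..<1} \<times> ball 0 r)"
begin

lemma periodic_int: "z \<in> ball 0 r \<Longrightarrow> \<tau> (t + of_int n, z) = \<tau> (t, z)"
  using unit_periodic_int[of "\<lambda>t. \<tau> (t, z)"] periodic by blast

lemma frac: "z \<in> ball 0 r \<Longrightarrow> \<tau> (frac t, z) = \<tau> (t, z)"
  using periodic_int[of z "frac t" "\<lfloor>t\<rfloor>"] by (simp add: frac_def)

lemma eq_iff:
  assumes "z \<in> ball 0 r" "w \<in> ball 0 r"
  shows "\<tau> (s, w) = \<tau> (t, z) \<longleftrightarrow> w = z \<and> (\<exists>n::int. s = t + of_int n)"
proof
  assume "\<tau> (s, w) = \<tau> (t, z)"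
  then have "\<tau> (frac s, w) = \<tau> (frac t, z)"
    using assms by (simp add: frac)
  then have "(frac s, w) = (frac t, z)"
    by (rule inj_onD[OF inj]) (use assms in \<open>auto simp: frac_lt_1\<close>)
  then show "w = z \<and> (\<exists>n::int. s = t + of_int n)"
    by (auto simp: frac_def intro!: exI[of _ "\<lfloor>s\<rfloor> - \<lfloor>t\<rfloor>"])
qed (use assms periodic_int in auto)

text \<open>Invariance of domain applies to pieces that are shorter than a period, on which \<open>\<tau>\<close> is injective.\<close>

lemma open_image:
  assumes "open T" "T \<subseteq> UNIV \<times> ball 0 r"
  shows "open (\<tau> ` T)"
proof -
  have "open (\<tau> ` (T \<inter> ({a<..<a+1} \<times> UNIV)))" for a
  proof (rule invariance_of_domain_gen)
    show "open (T \<inter> ({a<..<a+1} \<times> UNIV))"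
      using assms by (intro open_Int open_Times) auto
    show "continuous_on (T \<inter> ({a<..<a+1} \<times> UNIV)) \<tau>"
      using assms by (intro continuous_on_subset[OF cont]) auto
    show "inj_on \<tau> (T \<inter> ({a<..<a+1} \<times> UNIV))"
    proof (rule inj_onI, clarsimp)
      fix s w t z
      assume *: "(s, w) \<in> T" "(t, z) \<in> T" "\<tau> (s, w) = \<tau> (t, z)" "a < s" "s < a + 1" "a < t" "t < a + 1"
      then obtain n :: int where n: "w = z" "s = t + of_int n"
        using eq_iff[of z w s t] assms(2) by blast
      then have "\<bar>real_of_int n\<bar> < 1" using * by linarith
      then have "n = 0" by linarith
      then show "s = t \<and> w = z" using n by simp
    qed
  qed simp
  then have "open (\<Union>a. \<tau> ` (T \<inter> ({a<..<a+1} \<times> UNIV)))"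
    by blast
  moreover have "(\<Union>a. \<tau> ` (T \<inter> ({a<..<a+1} \<times> UNIV))) = \<tau> ` T"
  proof -
    have "x \<in> T \<inter> ({fst x - 1/2<..<fst x - 1/2 + 1} \<times> UNIV)" if "x \<in> T" for x
      using that by (cases x) auto
    then show ?thesis by blast
  qed
  ultimately show ?thesis by simp
qed

text \<open>Maps out of the image of \<open>\<tau>\<close> are constructed on the universal cover: since \<open>\<tau>\<close> is open, its image
  carries the quotient topology.\<close>

lemma descend:
  fixes F :: "real \<times> complex \<Rightarrow> 'b::topological_space"
  assumes D: "D \<subseteq> ball 0 r" and F: "continuous_on (UNIV \<times> D) F"
    and per: "\<And>t z. z \<in> D \<Longrightarrow> F (t + 1, z) = F (t, z)"
  obtains f where "continuous_on (\<tau> ` (UNIV \<times> D)) f" "\<And>t z. z \<in> D \<Longrightarrow> f (\<tau> (t, z)) = F (t, z)"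
proof -
  have perF: "F (t + of_int n, z) = F (t, z)" if "z \<in> D" for t z n
    using unit_periodic_int[of "\<lambda>t. F (t, z)"] per that by blast
  define f where "f y = F (SOME q. q \<in> UNIV \<times> D \<and> \<tau> q = y)" for y
  have f: "f (\<tau> (t, z)) = F (t, z)" if "z \<in> D" for t z
  proof -
    define q where "q = (SOME q. q \<in> UNIV \<times> D \<and> \<tau> q = \<tau> (t, z))"
    have q: "q \<in> UNIV \<times> D \<and> \<tau> q = \<tau> (t, z)"
      unfolding q_def by (rule someI[of _ "(t, z)"]) (use that in auto)
    obtain s w where sw: "q = (s, w)" by fastforce
    then have "z \<in> ball 0 r" "w \<in> ball 0 r" "\<tau> (s, w) = \<tau> (t, z)"
      using q D that by auto
    then obtain n :: int where "w = z" "s = t + of_int n"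
      using eq_iff[of z w s t] by blast
    then have "F q = F (t, z)"
      using perF[OF that] sw by simp
    then show ?thesis by (simp add: f_def q_def)
  qed
  have "continuous_on (\<tau> ` (UNIV \<times> D)) f"
    unfolding continuous_on_open_invariant
  proof (intro allI impI)
    fix B :: "'b set" assume "open B"
    then obtain G where G: "open G" "G \<inter> (UNIV \<times> D) = F -` B \<inter> (UNIV \<times> D)"
      using F unfolding continuous_on_open_invariant by blast
    let ?G = "G \<inter> (UNIV \<times> ball 0 r)"
    have "open (\<tau> ` ?G)"
      using G by (intro open_image open_Int open_Times) auto
    moreover have "\<tau> ` ?G \<inter> \<tau> ` (UNIV \<times> D) = f -` B \<inter> \<tau> ` (UNIV \<times> D)"
    proof (intro equalityI subsetI)
      fix y assume "y \<in> \<tau> ` ?G \<inter> \<tau> ` (UNIV \<times> D)"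
      then obtain s w t z where y: "(s, w) \<in> G" "w \<in> ball 0 r" "y = \<tau> (s, w)" "z \<in> D" "y = \<tau> (t, z)"
        by auto
      then have "w = z" using eq_iff[of z w s t] D by auto
      then have "F (s, w) \<in> B" using y G(2) by blast
      then show "y \<in> f -` B \<inter> \<tau> ` (UNIV \<times> D)"
        using y \<open>w = z\<close> f[of w s] by auto
    next
      fix y assume "y \<in> f -` B \<inter> \<tau> ` (UNIV \<times> D)"
      then obtain t z where y: "y = \<tau> (t, z)" "z \<in> D" "f y \<in> B" by auto
      then have "(t, z) \<in> G" using G(2) f[of z t] by (metis IntI Int_iff SigmaI UNIV_I vimageI)
      then show "y \<in> \<tau> ` ?G \<inter> \<tau> ` (UNIV \<times> D)"
        using y D by auto
    qed
    ultimately show "\<exists>A. open A \<and> A \<inter> \<tau> ` (UNIV \<times> D) = f -` B \<inter> \<tau> ` (UNIV \<times> D)"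
      by blast
  qed
  then show ?thesis using f that by blast
qed

lemma compact_image:
  assumes "compact D" "D \<subseteq> ball 0 r"
  shows "compact (\<tau> ` (UNIV \<times> D))"
proof -
  have "\<tau> ` (UNIV \<times> D) = \<tau> ` ({0..1} \<times> D)"
  proof (intro equalityI subsetI)
    fix y assume "y \<in> \<tau> ` (UNIV \<times> D)"
    then obtain t z where "y = \<tau> (t, z)" "z \<in> D" by auto
    then have "y = \<tau> (frac t, z)" using frac[of z t] assms by auto
    then show "y \<in> \<tau> ` ({0..1} \<times> D)"
      using \<open>z \<in> D\<close> frac_lt_1[of t] by (intro image_eqI[of _ _ "(frac t, z)"]) auto
  qed auto
  moreover have "compact (\<tau> ` ({0..1} \<times> D))"
    using assms by (intro compact_continuous_image compact_Times continuous_on_subset[OF cont]) auto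
  ultimately show ?thesis by simp
qed

definition core where "core = \<tau> ` (UNIV \<times> {0})"
definition open_tube where "open_tube = \<tau> ` (UNIV \<times> ball 0 1)"

lemma r_mem: "norm z \<le> 1 \<Longrightarrow> z \<in> ball 0 r"
  using r by auto

lemma open_open_tube: "open open_tube"
  unfolding open_tube_def using r by (intro open_image open_Times) auto

lemma closed_core: "closed core"
  unfolding core_def using r by (intro compact_imp_closed compact_image) auto

lemma compact_tube: "compact (tube \<tau>)"
  unfolding tube_def using r by (intro compact_image) auto

lemma mem_open_tube: "norm z \<le> 1 \<Longrightarrow> \<tau> (t, z) \<in> open_tube \<longleftrightarrow> norm z < 1"
  unfolding open_tube_def using r by (auto simp: eq_iff)

lemma mem_core: "norm z \<le> 1 \<Longrightarrow> \<tau> (t, z) \<in> core \<longleftrightarrow> z = 0"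
  unfolding core_def using r by (auto simp: eq_iff)

lemma mem_tube: "z \<in> ball 0 r \<Longrightarrow> \<tau> (t, z) \<in> tube \<tau> \<longleftrightarrow> norm z \<le> 1"
  unfolding tube_def using r by (auto simp: eq_iff)

lemma tubeE: "y \<in> tube \<tau> \<Longrightarrow> (\<And>t z. y = \<tau> (t, z) \<Longrightarrow> norm z \<le> 1 \<Longrightarrow> thesis) \<Longrightarrow> thesis"
  unfolding tube_def by auto

text \<open>A point \<open>\<tau> (t, z)\<close> of the boundary torus is the limit of the points \<open>\<tau> (t, s z)\<close> as \<open>s\<close>
  decreases to \<open>1\<close>. They exist because the embedding extends beyond the closed tube.\<close>

lemma exterior_eq: "exterior \<tau> = - open_tube"
proof (intro equalityI subsetI)
  fix y assume "y \<in> exterior \<tau>"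
  moreover have "closure (- tube \<tau>) \<subseteq> - open_tube"
    using open_open_tube by (intro closure_minimal) (auto simp: open_tube_def tube_def)
  ultimately show "y \<in> - open_tube" by (auto simp: exterior_def)
next
  fix y assume y: "y \<in> - open_tube"
  show "y \<in> exterior \<tau>"
  proof (cases "y \<in> tube \<tau>")
    case True
    then obtain t z where tz: "y = \<tau> (t, z)" "norm z \<le> 1" by (rule tubeE)
    then have z: "norm z = 1" using y mem_open_tube by force
    let ?f = "\<lambda>s. \<tau> (t, complex_of_real s * z)" and ?J = "{1<..<(1 + r) / 2}"
    have cl: "closure ?J = {1..(1 + r) / 2}"
      using r by (intro closure_greaterThanLessThan) auto
    have "?f ` closure ?J \<subseteq> closure (- tube \<tau>)"
    proof (rule image_closure_subset)
      show "continuous_on (closure ?J) ?f"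
        unfolding cl using z r
        by (intro continuous_intros continuous_on_compose2[OF cont]) (auto simp: norm_mult)
      have "\<tau> (t, complex_of_real s * z) \<notin> tube \<tau>" if "s \<in> ?J" for s
        using that z r by (subst mem_tube) (auto simp: norm_mult)
      then show "?f ` ?J \<subseteq> closure (- tube \<tau>)"
        using closure_subset[of "- tube \<tau>"] by blast
    qed simp
    moreover have "?f 1 \<in> ?f ` closure ?J"
      unfolding cl using r by (intro imageI) auto
    ultimately show ?thesis
      using tz by (auto simp: exterior_def)
  next
    case False
    then show ?thesis
      using closure_subset[of "- tube \<tau>"] by (auto simp: exterior_def)
  qed
qed

lemma boundary_in_exterior: "norm z = 1 \<Longrightarrow> \<tau> (t, z) \<in> exterior \<tau>"
  by (simp add: exterior_eq mem_open_tube)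

lemma exterior_subset: "exterior \<tau> \<subseteq> - core"
  unfolding exterior_eq core_def open_tube_def by auto

text \<open>Radial projection of the punctured meridian disks onto their boundary circles.\<close>

lemma retraction:
  obtains ret where "continuous_on (- core) ret" "ret ` (- core) \<subseteq> exterior \<tau>" "\<And>y. y \<in> exterior \<tau> \<Longrightarrow> ret y = y"
proof -
  let ?D = "cball 0 1 - {0::complex}"
  have "continuous_on (UNIV \<times> ?D) (\<lambda>q. \<tau> (fst q, sgn (snd q)))"
    using r by (intro continuous_on_compose2[OF cont] continuous_intros) (auto simp: norm_sgn)
  moreover have "?D \<subseteq> ball 0 r" using r by auto
  ultimately obtain f where f: "continuous_on (\<tau> ` (UNIV \<times> ?D)) f"
      "\<And>t z. z \<in> ?D \<Longrightarrow> f (\<tau> (t, z)) = \<tau> (t, sgn z)"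
    using descend[of ?D "\<lambda>q. \<tau> (fst q, sgn (snd q))"] r periodic by (auto simp: norm_sgn)
  have img: "\<tau> ` (UNIV \<times> ?D) = (- core) \<inter> tube \<tau>"
    by (auto simp: mem_core elim!: tubeE) (auto simp: tube_def)
  define ret where "ret y = (if y \<in> tube \<tau> then f y else y)" for y
  have id: "f y = y" if y: "y \<in> tube \<tau>" "y \<in> exterior \<tau>" for y
  proof -
    obtain t z where tz: "y = \<tau> (t, z)" "norm z \<le> 1" using y(1) by (rule tubeE)
    then have "norm z = 1" using y(2) mem_open_tube[of z t] by (auto simp: exterior_eq)
    then have "sgn z = z" "z \<in> ?D" by (auto simp: sgn_eq)
    then show ?thesis using f(2)[of z t] tz by simp
  qed
  have "continuous_on ((- core) \<inter> tube \<tau> \<union> exterior \<tau>) (\<lambda>y. if y \<in> tube \<tau> then f y else y)"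
  proof (rule continuous_on_cases_local)
    have eq: "- core \<inter> tube \<tau> \<union> exterior \<tau> = - core"
      using exterior_subset by (auto simp: exterior_eq open_tube_def tube_def)
    show "closedin (top_of_set (- core \<inter> tube \<tau> \<union> exterior \<tau>)) (- core \<inter> tube \<tau>)"
      unfolding eq using compact_tube compact_imp_closed by (auto simp: closedin_closed)
    show "closedin (top_of_set (- core \<inter> tube \<tau> \<union> exterior \<tau>)) (exterior \<tau>)"
      unfolding eq using exterior_subset
      by (metis closed_closure closedin_closed_Int exterior_def inf.absorb_iff2 inf_commute)
    show "continuous_on (- core \<inter> tube \<tau>) f"
      using f(1) by (simp add: img)
    show "f x = x" if "x \<in> - core \<inter> tube \<tau> \<and> x \<notin> tube \<tau> \<or> x \<in> exterior \<tau> \<and> x \<in> tube \<tau>" for x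
      using that id by blast
  qed auto
  moreover have "- core \<inter> tube \<tau> \<union> exterior \<tau> = - core"
    using exterior_subset by (auto simp: exterior_eq open_tube_def tube_def)
  ultimately have "continuous_on (- core) ret"
    unfolding ret_def by simp
  moreover have "ret y \<in> exterior \<tau>" if "y \<in> - core" for y
  proof (cases "y \<in> tube \<tau>")
    case True
    then obtain t z where tz: "y = \<tau> (t, z)" "norm z \<le> 1" by (rule tubeE)
    then have "z \<noteq> 0" using that mem_core[of z t] by auto
    then show ?thesis
      using True tz f(2)[of z t] by (auto simp: ret_def norm_sgn intro!: boundary_in_exterior)
  next
    case False
    then show ?thesis
      by (auto simp: ret_def exterior_eq open_tube_def tube_def)
  qed
  moreover have "ret y = y" if "y \<in> exterior \<tau>" for y
    using that id by (auto simp: ret_def)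
  ultimately show ?thesis using that by blast
qed

text \<open>Every meridian disk is collapsed to its point on the longitude.\<close>

lemma longitude_push:
  obtains \<sigma> where "continuous_on open_tube \<sigma>" "\<And>t z. norm z < 1 \<Longrightarrow> \<sigma> (\<tau> (t, z)) = \<tau> (t, 1)"
proof -
  have D: "ball 0 1 \<subseteq> (ball 0 r :: complex set)" using r by auto
  have "continuous_on (UNIV \<times> ball 0 1) (\<lambda>q. \<tau> (fst q, 1))"
    using r by (intro continuous_on_compose2[OF cont] continuous_intros) auto
  then obtain \<sigma> where "continuous_on open_tube \<sigma>" "\<And>t z. z \<in> ball 0 1 \<Longrightarrow> \<sigma> (\<tau> (t, z)) = \<tau> (t, 1)"
    using descend[OF D, of "\<lambda>q. \<tau> (fst q, 1)"] r periodic unfolding open_tube_def by (auto simp: open_tube_def)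
  then show ?thesis by (intro that) auto
qed

text \<open>The punctured closed tube is covered by the convex set \<open>strip\<close>, through \<open>w \<mapsto> exp w\<close> on the
  punctured unit disk. Homotopies in the tube become questions about endpoints in \<open>strip\<close>.\<close>

abbreviation strip :: "(real \<times> complex) set" where "strip \<equiv> UNIV \<times> {w. Re w \<le> 0}"

definition wrap :: "real \<times> complex \<Rightarrow> real^3" where "wrap p = \<tau> (fst p, exp (snd p))"

lemma convex_strip: "convex strip"
  by (intro convex_Times convex_halfspace_Re_le) auto

lemma wrap_continuous: "continuous_on strip wrap"
proof -
  have "exp (Re w) < r" if "Re w \<le> 0" for w
    using that r exp_le_one_iff[of "Re w"] by linarith
  then show ?thesis
    unfolding wrap_def by (intro continuous_on_compose2[OF cont] continuous_intros) auto
qed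

lemma wrap_core: "wrap ` strip \<subseteq> - core"
  by (auto simp: wrap_def mem_core)

lemma wrap_shift: "p \<in> strip \<Longrightarrow> wrap (p + (of_int m, 2 * pi * of_int n * \<i>)) = wrap p"
proof -
  have "exp (w + 2 * complex_of_real pi * of_int n * \<i>) = exp w" for w
    using exp_plus_2pin[of w n] by (simp only: mult_ac)
  then show "p \<in> strip \<Longrightarrow> ?thesis"
    using periodic_int[of "exp (snd p)" "fst p" m] r_mem[of "exp (snd p)"] by (auto simp: wrap_def)
qed

end


section \<open>The knot group\<close>

context solid_torus
begin

lemma base_exterior: "base_point \<tau> \<in> exterior \<tau>"
  by (simp add: base_point_def boundary_in_exterior)

lemma base_core: "base_point \<tau> \<in> - core"
  using base_exterior exterior_subset by blast

lemma group_knot_group: "group (knot_group \<tau>)"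
  unfolding knot_group_def by (rule group_fundamental_group[OF base_exterior])

text \<open>The exterior is not compact, but loops in it can be pushed radially into a ball that contains the
  tube. The loops in this compact part are expressed by finitely many loops in the complement of the
  core, and the retraction carries these back to the exterior.\<close>

lemma knot_group_finitely_generated:
  obtains Gs where "finite Gs" "Gs \<subseteq> carrier (knot_group \<tau>)" "carrier (knot_group \<tau>) = generate (knot_group \<tau>) Gs"
proof -
  let ?X = "exterior \<tau>" and ?x = "base_point \<tau>" and ?G = "knot_group \<tau>"
  interpret G: group ?G by (rule group_knot_group)
  obtain R where R: "R > 0" "tube \<tau> \<subseteq> ball 0 R"
    using bounded_subset_ballD[OF compact_imp_bounded[OF compact_tube], of 0] by auto
  let ?C = "?X \<inter> cball 0 R"
  have x: "?x \<in> tube \<tau>" using r by (simp add: base_point_def mem_tube)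
  have C: "compact ?C" "?C \<subseteq> - core" "?x \<in> ?C"
  proof -
    show "compact ?C" by (intro closed_Int_compact) (auto simp: exterior_def)
    show "?C \<subseteq> - core" using exterior_subset by blast
    show "?x \<in> ?C" using x R(2) base_exterior by (auto simp: less_imp_le)
  qed
  have oA: "open (- core)" using closed_core by (simp add: open_Compl)
  obtain Gs where Gs: "finite Gs" "Gs \<subseteq> carrier (fundamental_group (- core) ?x)"
      "\<And>p. p \<in> loops ?C ?x \<Longrightarrow> homotopy_class (- core) p \<in> generate (fundamental_group (- core) ?x) Gs"
    using finitely_generated_loops[OF oA C] by blast
  obtain ret where ret: "continuous_on (- core) ret" "ret ` (- core) \<subseteq> ?X" "\<And>y. y \<in> ?X \<Longrightarrow> ret y = y"
    by (rule retraction) blast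
  define \<psi> where "\<psi> = induced ?X ret"
  have \<psi>: "\<psi> \<in> hom (fundamental_group (- core) ?x) ?G"
    using induced_hom[OF ret(1,2), of ?x] ret(3)[OF base_exterior] by (simp add: \<psi>_def knot_group_def)
  interpret \<psi>: group_hom "fundamental_group (- core) ?x" ?G \<psi>
    by (intro group_hom.intro group_hom_axioms.intro \<psi> G.group_axioms group_fundamental_group[OF base_core])
  have "a \<in> generate ?G (\<psi> ` Gs)" if a: "a \<in> carrier ?G" for a
  proof -
    obtain p where p: "p \<in> loops ?X ?x" "a = homotopy_class ?X p"
      using a by (auto simp: knot_group_def carrier_fundamental_group)
    then have p': "path p" "path_image p \<subseteq> ?X" "p 0 = ?x" "p 1 = ?x"
      by (auto simp: loops_def pathstart_def pathfinish_def)
    have pX: "p t \<in> ?X" if "t \<in> {0..1}" for t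
      using p'(2) that by (auto simp: path_image_def)
    define s where "s t = max 1 (norm (p t) / R)" for t
    define q where "q t = (1 / s t) *\<^sub>R p t" for t
    have s1: "s t \<ge> 1" for t by (simp add: s_def)
    have near: "q t = p t" if "norm (p t) \<le> R" for t
      using that R(1) by (simp add: q_def s_def max_def)
    have far: "z \<in> ?X \<and> norm z \<ge> R" if that1: "norm (p t) > R" and that2: "z \<in> closed_segment (p t) (q t)" for t z
    proof -
      have st: "s t = norm (p t) / R" using that1 R(1) by (simp add: s_def max_def field_simps)
      obtain u where u: "0 \<le> u" "u \<le> 1" "z = (1 - u) *\<^sub>R p t + u *\<^sub>R q t"
        using that2 by (auto simp: closed_segment_def)
      have "z = ((1 - u) + u * (1 / s t)) *\<^sub>R p t"
        by (simp add: u(3) q_def algebra_simps)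
      moreover have nn: "(1 - u) + u * (1 / s t) \<ge> 0"
        using u s1[of t] by (intro add_nonneg_nonneg mult_nonneg_nonneg) auto
      moreover have ns: "norm (p t) / s t = R"
      proof -
        have "norm (p t) \<noteq> 0" using that1 R(1) by linarith
        then show ?thesis using st R(1) by simp
      qed
      ultimately have "norm z = ((1 - u) + u * (1 / s t)) * norm (p t)"
        by (simp add: abs_of_nonneg)
      also have "\<dots> = (1 - u) * norm (p t) + u * R"
        by (simp add: distrib_right flip: ns)
      also have "\<dots> \<ge> (1 - u) * R + u * R"
        using u that1 by (intro add_right_mono mult_left_mono) auto
      finally have "norm z \<ge> R" by (simp add: algebra_simps)
      moreover from this have "z \<notin> tube \<tau>" using R(2) by auto
      then have "z \<in> ?X" by (auto simp: exterior_eq open_tube_def tube_def)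
      ultimately show ?thesis by blast
    qed
    have cq: "path q"
      using p'(1) R(1) s1 unfolding path_def q_def s_def
      by (intro continuous_intros) (auto simp: max_def)
    have x_norm: "norm ?x \<le> R" using C(3) by simp
    have hom: "homotopic_paths ?X p q"
    proof (rule homotopic_paths_linear)
      show "pathstart q = pathstart p" "pathfinish q = pathfinish p"
        using near[of 0] near[of 1] x_norm p' by (simp_all add: pathstart_def pathfinish_def)
      show "closed_segment (p t) (q t) \<subseteq> ?X" if "t \<in> {0..1}" for t
        using far[of t] near[of t] pX[OF that] by (cases "norm (p t) \<le> R") (auto simp: not_le)
    qed (use p' cq in auto)
    have "q t \<in> ?C" if "t \<in> {0..1}" for t
    proof (cases "norm (p t) \<le> R")
      case True
      then show ?thesis using near pX[OF that] by simp
    next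
      case False
      then have "norm (q t) = R"
        using R(1) by (auto simp: q_def s_def max_def field_simps)
      then show ?thesis using far[of t "q t"] False by simp
    qed
    then have qC: "q \<in> loops ?C ?x"
      using cq near[of 0] near[of 1] x_norm p' by (auto simp: loops_def path_image_def pathstart_def pathfinish_def)
    then have q: "q \<in> loops (- core) ?x" "\<And>t. t \<in> {0..1} \<Longrightarrow> q t \<in> ?X"
      using C(2) by (auto simp: loops_def path_image_def)
    have "homotopic_paths ?X (ret \<circ> q) q"
      using q ret(3) cq by (intro homotopic_paths_sym[OF homotopic_paths_eq]) (auto simp: path_image_def)
    then have "\<psi> (homotopy_class (- core) q) = homotopy_class ?X q"
      using induced_class[OF ret(1,2) q(1)] by (simp add: \<psi>_def homotopy_class_cong)
    also have "\<dots> = a"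
      using homotopy_class_cong[OF hom] p by simp
    finally have "a = \<psi> (homotopy_class (- core) q)" by simp
    also have "\<dots> \<in> \<psi> ` generate (fundamental_group (- core) ?x) Gs"
      using Gs(3)[OF qC] by blast
    also have "\<dots> = generate ?G (\<psi> ` Gs)"
      by (rule \<psi>.generate_img[OF Gs(2), symmetric])
    finally show ?thesis .
  qed
  moreover have sub: "\<psi> ` Gs \<subseteq> carrier ?G"
    using Gs(2) \<psi> by (auto simp: hom_def)
  moreover have "generate ?G (\<psi> ` Gs) \<subseteq> carrier ?G"
    by (rule G.generate_incl[OF sub])
  ultimately show ?thesis
    using that[of "\<psi> ` Gs"] Gs(1) by blast
qed

lemma meridian_loop: "meridian_loop \<tau> \<in> loops (exterior \<tau>) (base_point \<tau>)"
  "meridian_loop \<tau> = wrap \<circ> linepath (0, 0) (0, 2 * pi * \<i>)"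
proof -
  show eq: "meridian_loop \<tau> = wrap \<circ> linepath (0, 0) (0, 2 * pi * \<i>)"
    by (rule ext) (simp add: meridian_loop_def wrap_def linepath_def cis_conv_exp scaleR_conv_of_real mult_ac)
  have "path (meridian_loop \<tau>)"
    unfolding eq by (intro path_continuous_image path_linepath continuous_on_subset[OF wrap_continuous]) (auto simp: linepath_def path_image_def)
  then show "meridian_loop \<tau> \<in> loops (exterior \<tau>) (base_point \<tau>)"
    by (auto simp: loops_def path_image_def meridian_loop_def pathstart_def pathfinish_def base_point_def boundary_in_exterior)
qed

lemma longitude_loop: "longitude_loop \<tau> \<in> loops (exterior \<tau>) (base_point \<tau>)"
  "longitude_loop \<tau> = wrap \<circ> linepath (0, 0) (1, 0)"
proof -
  show eq: "longitude_loop \<tau> = wrap \<circ> linepath (0, 0) (1, 0)"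
    by (rule ext) (simp add: longitude_loop_def wrap_def linepath_def)
  have "path (longitude_loop \<tau>)"
    unfolding eq by (intro path_continuous_image path_linepath continuous_on_subset[OF wrap_continuous]) (auto simp: linepath_def path_image_def)
  then show "longitude_loop \<tau> \<in> loops (exterior \<tau>) (base_point \<tau>)"
    using periodic[of 1 0] r
    by (auto simp: loops_def path_image_def longitude_loop_def pathstart_def pathfinish_def base_point_def boundary_in_exterior)
qed

lemma meridian_in_carrier: "meridian \<tau> \<in> carrier (knot_group \<tau>)"
  and longitude_in_carrier: "longitude \<tau> \<in> carrier (knot_group \<tau>)"
  using meridian_loop longitude_loop
  by (simp_all add: meridian_def longitude_def knot_group_def carrier_fundamental_group)

text \<open>Both loops lie on the boundary torus, which is covered by the plane \<open>Re w = 0\<close> in \<open>strip\<close>.\<close>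

lemma meridian_longitude_commute:
  "meridian \<tau> \<otimes>\<^bsub>knot_group \<tau>\<^esub> longitude \<tau> = longitude \<tau> \<otimes>\<^bsub>knot_group \<tau>\<^esub> meridian \<tau>"
proof -
  let ?D = "UNIV \<times> {w. Re w = 0} :: (real \<times> complex) set" and ?X = "exterior \<tau>"
  let ?p = "linepath (0, 0) (0, 2 * pi * \<i>) +++ linepath (0, 2 * pi * \<i>) (1, 2 * pi * \<i>) :: real \<Rightarrow> real \<times> complex"
  let ?q = "linepath (0, 0) (1, 0) +++ linepath (1, 0) (1, 2 * pi * \<i>) :: real \<Rightarrow> real \<times> complex"
  have D: "convex ?D"
  proof (intro convex_Times convex_UNIV)
    show "convex {w. Re w = 0}"
      by (auto simp: convex_def)
  qed
  have seg: "closed_segment a b \<subseteq> ?D" if "a \<in> ?D" "b \<in> ?D" for a b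
    using D that by (simp add: closed_segment_subset)
  have hom: "homotopic_paths ?D ?p ?q"
  proof -
    have "path_image ?p \<subseteq> ?D" "path_image ?q \<subseteq> ?D"
      using seg[of "(0, 0)" "(0, 2 * pi * \<i>)"] seg[of "(0, 2 * pi * \<i>)" "(1, 2 * pi * \<i>)"]
        seg[of "(0, 0)" "(1, 0)"] seg[of "(1, 0)" "(1, 2 * pi * \<i>)"] by (simp_all add: path_image_join)
    then show ?thesis
      using convex_imp_simply_connected[OF D] unfolding simply_connected_eq_homotopic_paths by auto
  qed
  have "continuous_on ?D wrap" by (rule continuous_on_subset[OF wrap_continuous]) auto
  moreover have "wrap ` ?D \<subseteq> ?X" by (auto simp: wrap_def intro!: boundary_in_exterior)
  ultimately have "homotopic_paths ?X (wrap \<circ> ?p) (wrap \<circ> ?q)"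
    using hom by (intro homotopic_paths_continuous_image) auto
  moreover have "wrap \<circ> linepath (0, 2 * pi * \<i>) (1, 2 * pi * \<i>) = longitude_loop \<tau>"
    by (rule ext) (simp add: longitude_loop_def wrap_def linepath_def algebra_simps scaleR_conv_of_real)
  moreover have "wrap \<circ> linepath (1, 0) (1, 2 * pi * \<i>) = meridian_loop \<tau>"
  proof (rule ext)
    fix s
    have "\<tau> (1, cis (2 * pi * s)) = \<tau> (0, cis (2 * pi * s))"
      using periodic[of "cis (2 * pi * s)" 0] r by simp
    then show "(wrap \<circ> linepath (1, 0) (1, 2 * pi * \<i>)) s = meridian_loop \<tau> s"
      by (simp add: meridian_loop_def wrap_def linepath_def cis_conv_exp scaleR_conv_of_real mult_ac)
  qed
  ultimately have "homotopic_paths ?X (meridian_loop \<tau> +++ longitude_loop \<tau>) (longitude_loop \<tau> +++ meridian_loop \<tau>)"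
    by (simp only: path_compose_join meridian_loop(2)[symmetric] longitude_loop(2)[symmetric])
  then show ?thesis
    unfolding knot_group_def meridian_def longitude_def
    using meridian_loop(1) longitude_loop(1) by (simp add: fundamental_group_mult homotopy_class_cong)
qed

text \<open>The meridian generates the knot group as a normal subgroup. Via the retraction, \<open>\<theta>\<close> defines a
  transport \<open>h\<close> along paths in the complement of the core. Paths in the tube that may meet the core
  are first pushed to the longitude by \<open>\<sigma>\<close>. The two rules agree where both apply, because the choices
  can be made such that \<open>h\<close> is trivial on radial paths, and it is trivial on meridians. By
  \<open>group_van_Kampen\<close> the result is trivial on loops that contract in space, and these are all loops.\<close>

lemma hom_trivial_if_meridian_trivial:
  assumes Q: "group Q" and \<theta>: "\<theta> \<in> hom (knot_group \<tau>) Q" and m: "\<theta> (meridian \<tau>) = \<one>\<^bsub>Q\<^esub>"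
    and a: "a \<in> carrier (knot_group \<tau>)"
  shows "\<theta> a = \<one>\<^bsub>Q\<^esub>"
proof -
  interpret Q: group Q by fact
  let ?A = "- core" and ?X = "exterior \<tau>" and ?x = "base_point \<tau>"
  obtain ret where ret: "continuous_on ?A ret" "ret ` ?A \<subseteq> ?X" "\<And>y. y \<in> ?X \<Longrightarrow> ret y = y"
    by (rule retraction) blast
  define \<rho> where "\<rho> = \<theta> \<circ> induced ?X ret"
  have \<rho>: "\<rho> \<in> hom (fundamental_group ?A ?x) Q"
    unfolding \<rho>_def using induced_hom[OF ret(1,2), of ?x] ret(3)[OF base_exterior] \<theta>
    by (intro hom_compose) (auto simp: knot_group_def)
  have \<rho>_class: "\<rho> (homotopy_class ?A p) = \<theta> (homotopy_class ?X p)" if p: "p \<in> loops ?X ?x" for p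
  proof -
    have "p \<in> loops ?A ?x" using p exterior_subset by (auto simp: loops_def)
    then have "\<rho> (homotopy_class ?A p) = \<theta> (homotopy_class ?X (ret \<circ> p))"
      using induced_class[OF ret(1,2)] by (simp add: \<rho>_def)
    also have "p t \<in> ?X" if "t \<in> {0..1}" for t
      using p that by (auto simp: loops_def path_image_def)
    then have "homotopic_paths ?X (ret \<circ> p) p"
      using p ret(3) by (intro homotopic_paths_sym[OF homotopic_paths_eq]) (auto simp: loops_def)
    then have "homotopy_class ?X (ret \<circ> p) = homotopy_class ?X p"
      by (rule homotopy_class_cong)
    finally show ?thesis .
  qed
  obtain \<sigma> where \<sigma>: "continuous_on open_tube \<sigma>" "\<And>t z. norm z < 1 \<Longrightarrow> \<sigma> (\<tau> (t, z)) = \<tau> (t, 1)"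
    by (rule longitude_push) blast
  obtain d where d: "basing_paths ?A ?x d" "d ?x = linepath ?x ?x" by (rule basing_paths_exist)

  \<comment> \<open>\<open>fib y\<close> runs in a meridian disk from the longitude to \<open>y\<close>, and \<open>c\<close> makes transport along it trivial\<close>
  define coord where "coord y = (SOME q. \<tau> q = y \<and> norm (snd q) < 1)" for y
  have coord: "\<tau> (coord y) = y \<and> norm (snd (coord y)) < 1" if "y \<in> open_tube" for y
  proof -
    have "\<exists>q. \<tau> q = y \<and> norm (snd q) < 1" using that unfolding open_tube_def by force
    then show ?thesis unfolding coord_def by (rule someI_ex)
  qed
  define fib where "fib y = wrap \<circ> linepath (fst (coord y), 0) (fst (coord y), Ln (snd (coord y)))" for y
  have fib: "path (fib y)" "path_image (fib y) \<subseteq> ?A" "pathstart (fib y) = \<sigma> y" "pathfinish (fib y) = y"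
    "\<sigma> y \<in> ?A" "\<sigma> y \<notin> open_tube"
    if y: "y \<in> open_tube" "y \<in> ?A" for y
  proof -
    obtain t z where tz: "coord y = (t, z)" by fastforce
    then have yz: "y = \<tau> (t, z)" "norm z < 1" using coord[OF y(1)] by auto
    then have z0: "z \<noteq> 0" using y(2) mem_core[of z t] by auto
    have "ln (norm z) \<le> 0" using yz z0 by simp
    then have re: "(t, 0) \<in> strip" "(t, Ln z) \<in> strip" using z0 by (auto simp: Re_Ln)
    then have "closed_segment (t, 0) (t, Ln z) \<subseteq> strip"
      using convex_strip by (simp add: closed_segment_subset)
    then have *: "path_image (linepath (t, 0) (t, Ln z)) \<subseteq> strip" by simp
    show "path (fib y)"
      unfolding fib_def tz fst_conv snd_conv using *
      by (intro path_continuous_image continuous_on_subset[OF wrap_continuous]) auto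
    show "path_image (fib y) \<subseteq> ?A"
      unfolding fib_def tz fst_conv snd_conv path_image_compose using * wrap_core by blast
    have "fib y = wrap \<circ> linepath (t, 0) (t, Ln z)" by (simp add: fib_def tz)
    then show "pathstart (fib y) = \<sigma> y" "pathfinish (fib y) = y"
      using yz z0 \<sigma>(2)[of z t] by (simp_all add: pathstart_compose pathfinish_compose wrap_def)
    show "\<sigma> y \<in> ?A" "\<sigma> y \<notin> open_tube"
      using yz \<sigma>(2)[of z t] mem_core[of 1 t] mem_open_tube[of 1 t] by simp_all
  qed
  define c where "c y = (if y \<in> open_tube then d (\<sigma> y) +++ fib y else d y)" for y
  have c: "basing_paths ?A ?x c"
    unfolding basing_paths_def
  proof (intro allI impI)
    fix y assume y: "path_component ?A ?x y"
    show "path (c y) \<and> path_image (c y) \<subseteq> ?A \<and> pathstart (c y) = ?x \<and> pathfinish (c y) = y"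
    proof (cases "y \<in> open_tube")
      case True
      have yA: "y \<in> ?A" using y path_component_mem(2) by metis
      note f = fib[OF True yA]
      have "path_component ?A ?x (\<sigma> y)"
        using path_component_ends[OF f(1,2), of ?x] f(3,4) y by simp
      then have "path (d (\<sigma> y)) \<and> path_image (d (\<sigma> y)) \<subseteq> ?A \<and> pathstart (d (\<sigma> y)) = ?x \<and> pathfinish (d (\<sigma> y)) = \<sigma> y"
        using d(1) by (simp add: basing_paths_def)
      then show ?thesis
        using True f by (simp add: c_def path_image_join)
    qed (use d(1) y in \<open>simp add: c_def basing_paths_def\<close>)
  qed
  have x_notin: "?x \<notin> open_tube" by (simp add: base_point_def mem_open_tube)
  define h where "h = transport Q ?A ?x \<rho> c"
  interpret h: path_functor Q ?A h
    unfolding h_def by (rule path_functor_transport[OF Q base_core \<rho> c])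
  have h_loop: "h p = \<theta> (homotopy_class ?X p)" if "p \<in> loops ?X ?x" for p
  proof -
    have "p \<in> loops ?A ?x" using that exterior_subset by (auto simp: loops_def)
    then show ?thesis
      unfolding h_def using transport_loop[of p ?A ?x c Q \<rho>] d(2) x_notin base_core \<rho>_class[OF that] by (simp add: c_def)
  qed
  have h_fib: "h (fib y) = \<one>\<^bsub>Q\<^esub>" if "y \<in> open_tube" "y \<in> ?A" for y
    unfolding h_def using fib[OF that] that
    by (intro transport_basing_path[OF Q \<rho> c base_core]) (auto simp: c_def)
  define seg where "seg = h.segment wrap"
  note strip = convex_strip wrap_continuous wrap_core
  have seg_trans: "seg P R \<otimes>\<^bsub>Q\<^esub> seg R S = seg P S" if "P \<in> strip" "R \<in> strip" "S \<in> strip" for P R S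
    unfolding seg_def using that by (intro h.segment_trans[OF strip])
  have seg_closed: "seg P R \<in> carrier Q" if "P \<in> strip" "R \<in> strip" for P R
    unfolding seg_def using that by (intro h.segment_closed[OF strip])
  have seg_refl: "seg P P = \<one>\<^bsub>Q\<^esub>" if "P \<in> strip" for P
    unfolding seg_def using that by (intro h.segment_refl[OF strip])
  have seg_shift: "seg (P + v) (R + v) = seg P R"
    if P: "P \<in> strip" and R: "R \<in> strip" and v: "v = (of_int m, 2 * pi * of_int n * \<i>)" for P R v m n
  proof -
    have sub: "closed_segment P R \<subseteq> strip"
      using P R convex_strip by (simp add: closed_segment_subset)
    have "h (wrap \<circ> linepath P R) = h (wrap \<circ> linepath (P + v) (R + v))"
    proof (rule h.eq_on_unit)
      show "path (wrap \<circ> linepath P R)"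
        using sub by (intro path_continuous_image continuous_on_subset[OF wrap_continuous]) auto
      show "path_image (wrap \<circ> linepath P R) \<subseteq> ?A"
        using sub wrap_core by (auto simp: path_image_compose)
      show "(wrap \<circ> linepath P R) t = (wrap \<circ> linepath (P + v) (R + v)) t" if "t \<in> {0..1}" for t
      proof -
        have "linepath P R t \<in> strip" using sub linepath_in_path[OF that] by blast
        moreover have "linepath (P + v) (R + v) t = linepath P R t + v"
          by (simp add: linepath_def algebra_simps)
        ultimately show ?thesis using wrap_shift v by simp
      qed
    qed
    then show ?thesis by (simp add: seg_def h.segment_def)
  qed
  let ?v = "\<lambda>n. 2 * pi * of_int n * \<i>"
  have v_strip: "(t, ?v n) \<in> strip" for t and n :: int by simp
  have zero_strip: "(t, 0) \<in> strip" for t :: real by simp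
  \<comment> \<open>meridian loops over any point of the longitude have trivial transport, and so have their multiples\<close>
  have turn0: "seg (0, 0) (0, ?v 1) = \<one>\<^bsub>Q\<^esub>"
    using h_loop[OF meridian_loop(1)] m by (simp add: seg_def h.segment_def meridian_loop(2) meridian_def)
  have turn1: "seg (t, 0) (t, ?v 1) = \<one>\<^bsub>Q\<^esub>" for t
  proof -
    have "seg (t, 0) (t, ?v 1) = seg (t, 0) (0, 0) \<otimes>\<^bsub>Q\<^esub> seg (0, 0) (0, ?v 1) \<otimes>\<^bsub>Q\<^esub> seg (0, ?v 1) (t, ?v 1)"
      using seg_trans[OF zero_strip zero_strip v_strip] seg_trans[OF zero_strip v_strip v_strip] by metis
    also have "seg (0, ?v 1) (t, ?v 1) = seg (0, 0) (t, 0)"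
      using seg_shift[of "(0, 0)" "(t, 0)" "(0, ?v 1)" 0 1] by simp
    also have "seg (t, 0) (0, 0) \<otimes>\<^bsub>Q\<^esub> seg (0, 0) (0, ?v 1) \<otimes>\<^bsub>Q\<^esub> seg (0, 0) (t, 0) = \<one>\<^bsub>Q\<^esub>"
      using seg_trans[OF zero_strip zero_strip zero_strip, of t 0 t] seg_refl[OF zero_strip] seg_closed[OF zero_strip zero_strip] turn0 by simp
    finally show ?thesis .
  qed
  have turn_step: "seg (t, 0) (t, ?v (n + 1)) = seg (t, 0) (t, ?v n)" for t n
  proof -
    have "seg (t, ?v n) (t, ?v (n + 1)) = seg (t, 0) (t, ?v 1)"
      using seg_shift[of "(t, 0)" "(t, ?v 1)" "(0, ?v n)" 0 n] by (simp add: algebra_simps)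
    then have "seg (t, 0) (t, ?v n) \<otimes>\<^bsub>Q\<^esub> \<one>\<^bsub>Q\<^esub> = seg (t, 0) (t, ?v (n + 1))"
      using seg_trans[OF zero_strip v_strip v_strip, of t t n t "n + 1"] turn1 by simp
    then show ?thesis using seg_closed[OF zero_strip v_strip] by simp
  qed
  have turn: "seg (t, 0) (t, ?v n) = \<one>\<^bsub>Q\<^esub>" for t n
  proof (induction n rule: int_induct[where k=0])
    case base
    then show ?case using seg_refl[OF zero_strip, of t] by simp
  next
    case (step1 i)
    then show ?case using turn_step by simp
  next
    case (step2 i)
    then show ?case using turn_step[of t "i - 1"] by simp
  qed
  \<comment> \<open>any path in a punctured disk is \<open>fib\<close> up to full turns and the choice of the preimage under \<open>\<tau>\<close>\<close>
  have radial: "seg (t, 0) (t, w) = \<one>\<^bsub>Q\<^esub>" if w: "Re w < 0" for t w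
  proof -
    let ?y = "wrap (t, w)"
    have yA: "?y \<in> ?A" using subsetD[OF wrap_core imageI[of "(t, w)" strip]] w by simp
    have y: "?y = \<tau> (t, exp w)" "norm (exp w) < 1" using w by (simp_all add: wrap_def)
    then have yi: "?y \<in> open_tube" using mem_open_tube[of "exp w" t] by simp
    obtain s z where sz: "coord ?y = (s, z)" by fastforce
    then have "\<tau> (s, z) = \<tau> (t, exp w)" "norm z < 1" using coord[OF yi] y by auto
    moreover from this have "exp w \<in> ball 0 r" "z \<in> ball 0 r"
      using r_mem[of "exp w"] r_mem[of z] y(2) by auto
    ultimately obtain k :: int where k: "z = exp w" "s = t + of_int k"
      using eq_iff[of "exp w" z s t] by blast
    have "exp (Ln z) = exp w" using k by simp
    then obtain n :: int where "w = Ln z + (of_int (2 * n) * pi) * \<i>"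
      using exp_eq[of w "Ln z"] by auto
    then have n: "w = Ln z + ?v n" by (simp add: mult_ac)
    have Ln: "Re (Ln z) < 0" using n w by simp
    have "seg (s, 0) (s, Ln z) = h (fib ?y)" by (simp add: seg_def h.segment_def fib_def sz)
    then have "seg (s, 0) (s, Ln z) = \<one>\<^bsub>Q\<^esub>" using h_fib[OF yi yA] by simp
    moreover have "seg (s, 0) (s, Ln z) = seg (t, 0) (t, Ln z)"
      using seg_shift[of "(t, 0)" "(t, Ln z)" "(of_int k, 0)" k 0] Ln by (simp add: k)
    moreover have "seg (t, ?v n) (t, w) = seg (t, 0) (t, Ln z)"
      using seg_shift[of "(t, 0)" "(t, Ln z)" "(0, ?v n)" 0 n] Ln by (simp add: n)
    moreover have "seg (t, 0) (t, w) = seg (t, 0) (t, ?v n) \<otimes>\<^bsub>Q\<^esub> seg (t, ?v n) (t, w)"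
      using w by (intro seg_trans[symmetric]) auto
    ultimately show ?thesis using turn by simp
  qed
  have parallel: "seg (s, w) (t, v) = seg (s, 0) (t, 0)" if w: "Re w < 0" "Re v < 0" for s t w v
  proof -
    have S: "(s, w) \<in> strip" "(t, v) \<in> strip" using w by auto
    have "seg (s, w) (s, 0) = \<one>\<^bsub>Q\<^esub>"
      using seg_trans[OF zero_strip S(1) zero_strip, of s s] radial[OF w(1), of s] seg_refl[OF zero_strip]
        seg_closed[OF S(1) zero_strip, of s] by simp
    moreover have "seg (s, w) (t, v) = seg (s, w) (s, 0) \<otimes>\<^bsub>Q\<^esub> (seg (s, 0) (t, 0) \<otimes>\<^bsub>Q\<^esub> seg (t, 0) (t, v))"
      using seg_trans[OF zero_strip zero_strip S(2)] seg_trans[OF S(1) zero_strip S(2)] by metis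
    ultimately show ?thesis
      using radial[OF w(2), of t] seg_closed[OF zero_strip zero_strip, of s t] by simp
  qed

  \<comment> \<open>on the part \<open>B a\<close> of the tube, shorter than a period, paths lift to the universal cover\<close>
  define B where "B a = \<tau> ` ({a<..<a + 1} \<times> ball 0 1)" for a
  have B_open: "open (B a)" and B_sub: "B a \<subseteq> open_tube" for a
    unfolding B_def open_tube_def using r by (auto intro!: open_image open_Times)
  have push: "h p = h (\<sigma> \<circ> p)" if p: "path p" "path_image p \<subseteq> B a" "path_image p \<subseteq> ?A" for p a
  proof -
    let ?S = "{a<..<a + 1} \<times> ball 0 1 :: (real \<times> complex) set"
    have contS: "continuous_on ?S \<tau>"
      using r by (intro continuous_on_subset[OF cont]) auto
    have injS: "inj_on \<tau> ?S"
    proof (rule inj_onI, clarsimp)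
      fix s w t z
      assume *: "\<tau> (s, w) = \<tau> (t, z)" "a < s" "s < a + 1" "a < t" "t < a + 1" "cmod w < 1" "cmod z < 1"
      then obtain n :: int where n: "w = z" "s = t + of_int n"
        using eq_iff[of z w s t] r by auto
      then have "\<bar>real_of_int n\<bar> < 1" using * by linarith
      then have "n = 0" by linarith
      then show "s = t \<and> w = z" using n by simp
    qed
    have openS: "open ?S" by (intro open_Times) auto
    obtain g where g: "homeomorphism ?S (\<tau> ` ?S) \<tau> g"
      using invariance_of_domain_homeomorphism[OF openS contS _ injS] by auto
    define q where "q = g \<circ> p"
    have pB: "p s \<in> \<tau> ` ?S" if "s \<in> {0..1}" for s
      using p(2) that by (auto simp: B_def path_image_def)
    have q: "q s \<in> ?S" "\<tau> (q s) = p s" if "s \<in> {0..1}" for s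
      using g pB[OF that] unfolding q_def homeomorphism_def by auto
    have contq: "continuous_on {0..1} q"
      unfolding q_def
    proof (rule continuous_on_compose)
      show "continuous_on {0..1} p" using p(1) by (simp add: path_def)
      show "continuous_on (p ` {0..1}) g"
      proof (rule continuous_on_subset)
        show "continuous_on (\<tau> ` ?S) g" using g by (simp add: homeomorphism_def)
        show "p ` {0..1} \<subseteq> \<tau> ` ?S" using pB by blast
      qed
    qed
    have q0: "snd (q s) \<noteq> 0" if "s \<in> {0..1}" for s
    proof
      assume "snd (q s) = 0"
      then have "q s \<in> UNIV \<times> {0}" by (simp add: mem_Times_iff)
      then have "p s \<in> core" unfolding core_def using q(2)[OF that] by (metis image_eqI)
      moreover have "p s \<in> ?A" using p(3) that unfolding path_image_def by blast
      ultimately show False by simp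
    qed
    obtain w where w: "continuous_on {0..1} w" "\<And>s. s \<in> {0..1} \<Longrightarrow> snd (q s) = exp (w s)"
      using continuous_logarithm_on_contractible[of "{0..1}" "\<lambda>s. snd (q s)"] contq q0
      by (auto intro: continuous_on_snd convex_imp_contractible)
    have Re: "Re (w s) < 0" if "s \<in> {0..1}" for s
    proof -
      have "norm (exp (w s)) < 1" using q(1)[OF that] w(2)[OF that] by (auto simp: mem_Times_iff)
      then show ?thesis by simp
    qed
    define P where "P s = (fst (q s), w s)" for s
    define P0 where "P0 s = (fst (q s), 0::complex)" for s
    have P: "path P" "path_image P \<subseteq> strip" "path P0" "path_image P0 \<subseteq> strip"
      using contq w(1) Re by (auto simp: path_def P_def P0_def path_image_def less_imp_le intro!: continuous_intros)
    have "h (wrap \<circ> P) = h p"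
    proof (rule h.eq_on_unit)
      show "path (wrap \<circ> P)" using P by (intro path_continuous_image continuous_on_subset[OF wrap_continuous])
      show "path_image (wrap \<circ> P) \<subseteq> ?A" unfolding path_image_compose using P(2) wrap_core by blast
      show "(wrap \<circ> P) s = p s" if "s \<in> {0..1}" for s
        using q(2)[OF that] w(2)[OF that] by (simp add: wrap_def P_def flip: w(2)[OF that])
    qed
    moreover have "h (wrap \<circ> P) = seg (pathstart P) (pathfinish P)"
      unfolding seg_def using P by (intro h.segment_path[OF strip])
    moreover have "\<dots> = seg (pathstart P0) (pathfinish P0)"
      using parallel Re[of 0] Re[of 1] by (simp add: P_def P0_def pathstart_def pathfinish_def)
    moreover have "h (wrap \<circ> P0) = seg (pathstart P0) (pathfinish P0)"
      unfolding seg_def using P by (intro h.segment_path[OF strip])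
    moreover have "h (wrap \<circ> P0) = h (\<sigma> \<circ> p)"
    proof (rule h.eq_on_unit)
      show "path (wrap \<circ> P0)" using P by (intro path_continuous_image continuous_on_subset[OF wrap_continuous])
      show "path_image (wrap \<circ> P0) \<subseteq> ?A" unfolding path_image_compose using P(4) wrap_core by blast
      show "(wrap \<circ> P0) s = (\<sigma> \<circ> p) s" if "s \<in> {0..1}" for s
        using q(1)[OF that] \<sigma>(2)[of "snd (q s)" "fst (q s)"]
        by (simp add: wrap_def P0_def mem_Times_iff flip: q(2)[OF that])
    qed
    ultimately show ?thesis by simp
  qed
  define k where "k p = (if path_image p \<subseteq> ?A then h p else h (\<sigma> \<circ> p))" for p
  have \<sigma>_core: "\<sigma> ` open_tube \<subseteq> ?A"
    using \<sigma>(2) by (auto simp: open_tube_def mem_core)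
  have k_push: "k p = h (\<sigma> \<circ> p)" if "path p" "path_image p \<subseteq> B a" for p a
    using push[OF that] by (simp add: k_def)
  have \<sigma>_path: "path (\<sigma> \<circ> p)" "path_image (\<sigma> \<circ> p) \<subseteq> ?A" if "path p" "path_image p \<subseteq> B a" for p a
  proof -
    have sub: "path_image p \<subseteq> open_tube" using that(2) B_sub by blast
    show "path (\<sigma> \<circ> p)"
      using that(1) sub by (intro path_continuous_image continuous_on_subset[OF \<sigma>(1)])
    show "path_image (\<sigma> \<circ> p) \<subseteq> ?A" using sub \<sigma>_core by (auto simp: path_image_compose)
  qed
  have kA: "path_functor Q ?A k"
  proof
    fix p q assume pq: "path p" "path_image p \<subseteq> ?A" "path q" "path_image q \<subseteq> ?A" "pathfinish p = pathstart q"
    then have "path_image (p +++ q) \<subseteq> ?A" by (simp add: path_image_join)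
    then show "k (p +++ q) = k p \<otimes>\<^bsub>Q\<^esub> k q" using pq h.join by (simp add: k_def)
  next
    fix p q assume "homotopic_paths ?A p q"
    then show "k p = k q"
      using h.homotopic homotopic_paths_imp_subset[of ?A p q] by (simp add: k_def)
  qed (auto simp: k_def)
  have kB: "path_functor Q (B a) k" for a
  proof
    fix p assume p: "path p" "path_image p \<subseteq> B a"
    show "k p \<in> carrier Q" using \<sigma>_path[OF p] by (simp add: k_push[OF p])
  next
    fix p q assume p: "path p" "path_image p \<subseteq> B a" and q: "path q" "path_image q \<subseteq> B a" and e: "pathfinish p = pathstart q"
    have "path_image (p +++ q) \<subseteq> B a" using p q e by (simp add: path_image_join)
    then have "k (p +++ q) = h ((\<sigma> \<circ> p) +++ (\<sigma> \<circ> q))"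
      using k_push[of "p +++ q" a] p q e by (simp add: path_compose_join)
    also have "\<dots> = k p \<otimes>\<^bsub>Q\<^esub> k q"
      using \<sigma>_path[OF p] \<sigma>_path[OF q] e
      by (simp add: k_push[OF p] k_push[OF q] h.join pathfinish_compose pathstart_compose)
    finally show "k (p +++ q) = k p \<otimes>\<^bsub>Q\<^esub> k q" .
  next
    fix p q assume pq: "homotopic_paths (B a) p q"
    then have p: "path p" "path_image p \<subseteq> B a" and q: "path q" "path_image q \<subseteq> B a"
      using homotopic_paths_imp_path homotopic_paths_imp_subset by blast+
    have "homotopic_paths ?A (\<sigma> \<circ> p) (\<sigma> \<circ> q)"
    proof (rule homotopic_paths_continuous_image[OF pq])
      show "continuous_on (B a) \<sigma>" using \<sigma>(1) B_sub by (rule continuous_on_subset)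
      show "\<sigma> \<in> B a \<rightarrow> ?A" using \<sigma>_core B_sub by blast
    qed
    then show "k p = k q" by (simp add: k_push[OF p] k_push[OF q] h.homotopic)
  qed
  have cover: "\<Union> (insert ?A (range B)) = UNIV"
  proof -
    have "y \<in> \<Union> (range B)" if "y \<in> core" for y
    proof -
      obtain t where "y = \<tau> (t, 0)" using \<open>y \<in> core\<close> by (auto simp: core_def)
      then have "y \<in> B (t - 1/2)" unfolding B_def by (intro image_eqI[of _ _ "(t, 0)"]) auto
      then show ?thesis by blast
    qed
    then show ?thesis by auto
  qed
  obtain p where p: "p \<in> loops ?X ?x" "a = homotopy_class ?X p"
    using a by (auto simp: knot_group_def carrier_fundamental_group)
  then have p': "path p" "path_image p \<subseteq> ?A" "p 0 = ?x" "p 1 = ?x"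
    using exterior_subset by (auto simp: loops_def pathstart_def pathfinish_def)
  \<comment> \<open>the straight-line contraction of \<open>p\<close> in space\<close>
  define H where "H st = (1 - snd st) *\<^sub>R p (fst st) + snd st *\<^sub>R ?x" for st
  have "k (\<lambda>s. H (s, 0)) = \<one>\<^bsub>Q\<^esub>"
  proof (rule group_van_Kampen[where x="?x"])
    show "open U \<and> path_functor Q U k" if "U \<in> insert ?A (range B)" for U
      using that kA kB B_open closed_core by (auto simp: open_Compl)
    show "continuous_on ({0..1} \<times> {0..1}) H"
    proof -
      have "continuous_on (fst ` ({0..1} \<times> {0..1})) p"
        using p'(1) by (simp add: path_def)
      then have "continuous_on ({0..1} \<times> {0..1}) (p \<circ> fst)"
        by (intro continuous_on_compose continuous_on_fst continuous_on_id)
      then show ?thesis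
        unfolding H_def by (intro continuous_intros) (simp_all add: o_def)
    qed
    show "H ` ({0..1} \<times> {0..1}) \<subseteq> \<Union> (insert ?A (range B))" using cover by simp
    show "(\<lambda>s. H (s, 0)) ` {0..1} \<subseteq> ?A" using p'(2) by (simp add: H_def path_image_def)
  qed (use p' in \<open>auto simp: H_def algebra_simps\<close>)
  then have "k p = \<one>\<^bsub>Q\<^esub>" by (simp add: H_def)
  then have "h p = \<one>\<^bsub>Q\<^esub>" using p'(2) by (simp add: k_def)
  then show ?thesis using h_loop[OF p(1)] p(2) by simp
qed

end


section \<open>The two curves coincide\<close>

lemma (in marked_group) KCH_points_eq_augmentation_points:
  assumes H: "finite H" "H \<subseteq> carrier G" "carrier G = generate G ((\<lambda>h. h \<otimes> m \<otimes> inv h) ` H)"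
  shows "KCH_points G m l = augmentation_points G m l"
proof (intro equalityI subsetI; clarify)
  fix l0 m0 assume "(l0, m0) \<in> KCH_points G m l"
  then obtain n \<rho> v where irr: "KCH_irrep G m n \<rho>" "m0 \<noteq> 1" "eigenvector (\<rho> m) v m0" "eigenvector (\<rho> l) v l0"
    unfolding KCH_points_def by blast
  show "(l0, m0) \<in> augmentation_points G m l"
    using cord_function_of_KCH_irrep[OF irr] irr(2) by (simp add: augmentation_points_iff)
next
  fix l0 m0 assume "(l0, m0) \<in> augmentation_points G m l"
  then obtain e where e: "m0 \<noteq> 0" "m0 \<noteq> 1" "cord_function G m l l0 m0 e"
    by (auto simp: augmentation_points_iff)
  interpret cord_point G m l l0 m0 e
    by unfold_locales (use e in auto)
  obtain S where "finite S" "V = fun_vs.span S"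
    using translates_finite_dim[OF H] by blast
  then show "(l0, m0) \<in> KCH_points G m l"
    by (rule KCH_point)
qed

lemma (in solid_torus) KCH_points_eq_augmentation_points:
  "KCH_points (knot_group \<tau>) (meridian \<tau>) (longitude \<tau>) =
     augmentation_points (knot_group \<tau>) (meridian \<tau>) (longitude \<tau>)"
proof -
  interpret G: group "knot_group \<tau>" by (rule group_knot_group)
  interpret marked_group "knot_group \<tau>" "meridian \<tau>" "longitude \<tau>"
    by unfold_locales (fact meridian_in_carrier longitude_in_carrier meridian_longitude_commute)+
  obtain Gs where Gs: "finite Gs" "Gs \<subseteq> carrier (knot_group \<tau>)" "carrier (knot_group \<tau>) = generate (knot_group \<tau>) Gs"
    by (rule knot_group_finitely_generated)
  obtain H where "finite H" "H \<subseteq> carrier (knot_group \<tau>)"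
      "carrier (knot_group \<tau>) = generate (knot_group \<tau>) ((\<lambda>h. h \<otimes>\<^bsub>knot_group \<tau>\<^esub> meridian \<tau> \<otimes>\<^bsub>knot_group \<tau>\<^esub> inv\<^bsub>knot_group \<tau>\<^esub> h) ` H)"
  proof (rule G.finitely_many_conjugates_generate[OF meridian_in_carrier Gs])
    fix Q :: "(real \<Rightarrow> real^3) set set monoid" and \<theta> a
    assume "group Q" "\<theta> \<in> hom (knot_group \<tau>) Q" "\<theta> (meridian \<tau>) = \<one>\<^bsub>Q\<^esub>" "a \<in> carrier (knot_group \<tau>)"
    then show "\<theta> a = \<one>\<^bsub>Q\<^esub>" by (rule hom_trivial_if_meridian_trivial)
  qed
  then show ?thesis by (rule KCH_points_eq_augmentation_points)
qed

lemma smooth_on_imp_continuous_on: "smooth_on S f \<Longrightarrow> continuous_on S f"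
  unfolding smooth_on_def
  by (metis continuous_at_imp_continuous_on has_derivative_continuous)

lemma solid_torus_of_tubular_param:
  assumes "tubular_param k \<tau>"
  obtains r where "solid_torus \<tau> r"
proof -
  obtain r where r: "r > 1" "smooth_on (UNIV \<times> ball 0 r) \<tau>"
      "\<forall>t. \<forall>z\<in>ball 0 r. \<tau> (t + 1, z) = \<tau> (t, z)" "inj_on \<tau> ({0..<1} \<times> ball 0 r)"
    using assms unfolding tubular_param_def by blast
  have "solid_torus \<tau> r"
    by unfold_locales (use r smooth_on_imp_continuous_on in auto)
  then show ?thesis by (rule that)
qed

theorem corollary1p6:
  fixes k :: "real \<Rightarrow> real^3"
    and \<tau> :: "real \<times> complex \<Rightarrow> real^3"
    and Aug A :: "int poly poly"
  assumes "knot k" and "tubular_param k \<tau>" and "seifert_framed \<tau>"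
    and "augmentation_polynomial \<tau> Aug"
    and "stable_A_polynomial \<tau> A"
  shows "Aug = (1 - poly_mu) * A \<or> Aug = - ((1 - poly_mu) * A)"
proof -
  obtain r where "solid_torus \<tau> r"
    using assms(2) by (rule solid_torus_of_tubular_param)
  then interpret solid_torus \<tau> r .
  obtain P where P: "curve_polynomial (augmentation_points (knot_group \<tau>) (meridian \<tau>) (longitude \<tau>)) P"
      "Aug = (1 - poly_mu) * P"
    using assms(4) unfolding augmentation_polynomial_def by blast
  have "curve_polynomial (augmentation_points (knot_group \<tau>) (meridian \<tau>) (longitude \<tau>)) A"
    using assms(5) unfolding stable_A_polynomial_def KCH_points_eq_augmentation_points .
  then have "P = A \<or> P = - A"
    using P(1) defining_polynomial_unique unfolding curve_polynomial_def Let_def by blast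
  then show ?thesis
    using P(2) by auto
qed

end
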